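(* Let $G$ be a group of the form $A_{6}.\mu_{4}$, and let $N=c(G)<\mathrm{Aut}(A_6)$ be the image of the conjugation homomorphism $c:G\to\mathrm{Aut}(A_6)$. There are exactly four possible group structures of $G$, up to isomorphism. More explicitly, $N$ is one of the subgroups $A_6$, $S_6$, $\mathrm{PGL}(2,9)$, $M_{10}$ of $\mathrm{Aut}(A_6)$, and $G$ is isomorphic to the following subgroup of $N\times\mu_4$ corresponding to each of these four candidates for $N$: (1) If $N=A_6$, then $G=A_6\times\mu_4$. In this case, set $\tilde g=(1,\zeta_4)$. Then $\tilde g$ is an element of order $4$ and $G=A_6\times\langle\tilde g\rangle$. (2) If $N=S_6$, then $G=A_6.\langle\tilde g\rangle=A_6:\langle\tilde g\rangle$, where $\tilde g=(g,\zeta_4)$ and $g=(1,2)\in S_6$. (3) If $N=\mathrm{PGL}(2,9)$, then $G=A_6.\langle\tilde g\rangle=A_6:\langle\tilde g\rangle$, where $\tilde g=(h^5,\zeta_4)$ for some element $h\in\mathrm{PGL}(2,9)$ of order $10$. (4) If $N=M_{10}$, then $G=A_6.\langle\tilde g\rangle=A_6:\langle\tilde g\rangle$, where $\tilde g=(g,\zeta_4)$ and $g$ is an element of order $4$ of $M_{10}\setminus A_6$. In each case, the semi-direct product structure is the natural one (given by conjugation inside $N\times\mu_4$).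
   Context: Notation. $A_n$, $S_n$ are the alternating and symmetric groups of degree $n$; $\mu_4=\langle\zeta_4\rangle\subset\mathbf{C}^\times$ with $\zeta_4=\exp(2\pi i/4)$. $\mathrm{PGL}(2,9)$ is the projective linear group over $\mathbf{F}_9$. $M_{10}$ is the Mathieu group of degree $10$, i.e. the pointwise stabilizer of $\{11,12\}$ in $M_{12}$ acting naturally on $\{1,\dots,12\}$. $G=A.B$ means $G$ fits in an exact sequence $1\to A\to G\to B\to 1$, with $A$ regarded as a normal subgroup of $G$; $A:B$ denotes a semi-direct product with $A$ normal and $B$ a subgroup. A group of the form $A_6.\mu_4$ thus comes with an exact sequence $1\to A_6\to G\to\mu_4\to 1$; such a $G$ contains exactly one subgroup isomorphic to $A_6$. The homomorphism $c:G\to\mathrm{Aut}(A_6)$ is $c(g)(a)=gag^{-1}$ for $g\in G$, $a\in A_6$. $\mathrm{Aut}(A_6)$ is of the form $A_6.C_2^2$, where $A_6$ is identified with the group of inner automorphisms. It has exactly three subgroups of index $2$ containing $A_6$, and these are isomorphic to $S_6$, $\mathrm{PGL}(2,9)$ and $M_{10}$ respectively; each is the unique subgroup of $\mathrm{Aut}(A_6)$ of its isomorphism type, and "the subgroups $A_6$, $S_6$, $\mathrm{PGL}(2,9)$, $M_{10}$ of $\mathrm{Aut}(A_6)$" are understood in this sense. In $N\times\mu_4$, the group $A_6$ is identified with $A_6\times\{1\}$; the groups in (2), (3), (4) are the subgroups of $N\times\mu_4$ generated by $A_6\times\{1\}$ and $\tilde g$. The groups in (1), (2), (3), (4) are denoted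 $A_6(4)$, $S_6(2)$, $\mathrm{PGL}(2,9)(2)$, $M_{10}(2)$ respectively. *)

theory Defs
  imports
    "HOL-Analysis.Cartesian_Space"
    "HOL-Algebra.Sym_Groups"
    "HOL-Algebra.Multiplicative_Group"
    "HOL-Algebra.Bij"
begin

subsection \<open>The field with nine elements\<close>

text \<open>\<open>F9 a b\<close> stands for \<open>a + b * i\<close> with \<open>i\<^sup>2 = -1\<close>; the polynomial \<open>X\<^sup>2 + 1\<close> is
  irreducible over the prime field \<^typ>\<open>3\<close>.\<close>

datatype f9 = F9 (f9_re: "3") (f9_im: "3")

lemma three_cases: "x = 0 \<or> x = 1 \<or> x = 2" for x :: "3"
proof (cases x)
  case (of_int z)
  then have "z = 0 \<or> z = 1 \<or> z = 2" by auto
  with of_int show ?thesis by auto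
qed

lemma three_square: "x \<noteq> 0 \<Longrightarrow> x * x = 1" for x :: "3"
  using three_cases[of x] by auto

lemma three_norm: "a * a + b * b = 0 \<longleftrightarrow> a = 0 \<and> b = 0" for a b :: "3"
  using three_cases[of a] three_cases[of b] by auto

instantiation f9 :: field
begin

definition "0 = F9 0 0"
definition "1 = F9 1 0"
definition "x + y = F9 (f9_re x + f9_re y) (f9_im x + f9_im y)"
definition "- x = F9 (- f9_re x) (- f9_im x)"
definition "x - y = F9 (f9_re x - f9_re y) (f9_im x - f9_im y)"
definition "x * y = F9 (f9_re x * f9_re y - f9_im x * f9_im y) (f9_re x * f9_im y + f9_im x * f9_re y)"

text \<open>The inverse of \<open>a + b * i\<close> is \<open>(a - b * i) / n\<close> with \<open>n = a\<^sup>2 + b\<^sup>2\<close>, and \<open>1 / n = n\<close> in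
  \<^typ>\<open>3\<close>.\<close>

definition "inverse x =
  (let n = f9_re x * f9_re x + f9_im x * f9_im x in F9 (n * f9_re x) (- (n * f9_im x)))"
definition "x div y = x * inverse y" for x y :: f9

instance
proof
  fix x y z :: f9
  show "x * y * z = x * (y * z)" by (simp add: times_f9_def algebra_simps)
  show "x * y = y * x" by (simp add: times_f9_def algebra_simps)
  show "1 * x = x" by (simp add: times_f9_def one_f9_def)
  show "x + y + z = x + (y + z)" by (simp add: plus_f9_def algebra_simps)
  show "x + y = y + x" by (simp add: plus_f9_def algebra_simps)
  show "0 + x = x" by (simp add: plus_f9_def zero_f9_def)
  show "- x + x = 0" by (simp add: plus_f9_def uminus_f9_def zero_f9_def)
  show "x - y = x + - y" by (simp add: plus_f9_def uminus_f9_def minus_f9_def)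
  show "(x + y) * z = x * z + y * z" by (simp add: plus_f9_def times_f9_def algebra_simps)
  show "(0::f9) \<noteq> 1" by (simp add: zero_f9_def one_f9_def)
  show "x div y = x * inverse y" by (simp add: divide_f9_def)
  show "inverse (0::f9) = 0" by (simp add: inverse_f9_def zero_f9_def)
  assume "x \<noteq> 0"
  obtain a b where x: "x = F9 a b" by (cases x)
  let ?n = "a * a + b * b"
  from \<open>x \<noteq> 0\<close> x have "?n * ?n = 1"
    by (intro three_square) (auto simp: zero_f9_def three_norm)
  then show "inverse x * x = 1"
    by (simp add: x inverse_f9_def times_f9_def one_f9_def Let_def algebra_simps)
qed

end

lemma card_f9: "CARD(f9) = 9"
proof -
  have "bij_betw (\<lambda>(a, b). F9 a b) UNIV UNIV"
    by (rule bij_betwI[where g = "\<lambda>x. (f9_re x, f9_im x)"]) auto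
  then have "CARD(3 \<times> 3) = CARD(f9)"
    by (rule bij_betw_same_card)
  then show ?thesis by simp
qed

subsection \<open>Projective linear groups and the Mathieu group of degree 10\<close>

definition GL2 :: "('a::field ^ 2 ^ 2) monoid" where
  "GL2 = \<lparr>carrier = {A. invertible A}, mult = (**), one = mat 1\<rparr>"

definition PGL2 :: "('a::field ^ 2 ^ 2) set monoid" where
  "PGL2 = GL2 Mod {mat k |k. k \<noteq> 0}"

abbreviation PGL29 :: "(f9 ^ 2 ^ 2) set monoid" where
  "PGL29 \<equiv> PGL2"

text \<open>The three permutations are the customary generators of \<open>M\<^sub>1\<^sub>2\<close> (the first two generate
  \<open>M\<^sub>1\<^sub>1\<close>, the point stabilizer of 12).\<close>

definition M12 :: "(nat \<Rightarrow> nat) monoid" where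
  "M12 = (sym_group 12) \<lparr>carrier := generate (sym_group 12)
     {cycle_of_list [1, 2, 3, 4, 5, 6, 7, 8, 9, 10, 11],
      cycle_of_list [3, 7, 11, 8] \<circ> cycle_of_list [4, 10, 5, 6],
      cycle_of_list [1, 12] \<circ> cycle_of_list [2, 11] \<circ> cycle_of_list [3, 6]
        \<circ> cycle_of_list [4, 8] \<circ> cycle_of_list [5, 9] \<circ> cycle_of_list [7, 10]}\<rparr>"

definition M10 :: "(nat \<Rightarrow> nat) monoid" where
  "M10 = M12 \<lparr>carrier := {p \<in> carrier M12. p 11 = 11 \<and> p 12 = 12}\<rparr>"

subsection \<open>Roots of unity\<close>

definition complex_units :: "complex monoid" where
  "complex_units = \<lparr>carrier = UNIV - {0}, mult = (*), one = 1\<rparr>"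

definition zeta4 :: complex where
  "zeta4 = exp (2 * of_real pi * \<i> / 4)"

definition mu4 :: "complex monoid" where
  "mu4 = complex_units \<lparr>carrier := generate complex_units {zeta4}\<rparr>"

subsection \<open>Extensions and semi-direct products\<close>

text \<open>Exactness of \<open>1 \<rightarrow> A \<rightarrow> G \<rightarrow> B \<rightarrow> 1\<close>. The library's \<open>short_exact_sequence\<close> forces the three
  groups to share one element type.\<close>

definition group_extension ::
  "('a, 'm) monoid_scheme \<Rightarrow> ('g, 'n) monoid_scheme \<Rightarrow> ('b, 'k) monoid_scheme
    \<Rightarrow> ('a \<Rightarrow> 'g) \<Rightarrow> ('g \<Rightarrow> 'b) \<Rightarrow> bool" where
  "group_extension A G B \<iota> \<pi> \<longleftrightarrow>
     group A \<and> group G \<and> group B \<and> \<iota> \<in> mon A G \<and> \<pi> \<in> epi G B \<and>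
     kernel G B \<pi> = \<iota> ` carrier A"

text \<open>Internal products: the action of \<open>B\<close> on \<open>A\<close> is conjugation inside \<open>G\<close>.\<close>

definition internal_semidirect :: "('g, 'n) monoid_scheme \<Rightarrow> 'g set \<Rightarrow> 'g set \<Rightarrow> bool" where
  "internal_semidirect G A B \<longleftrightarrow>
     A \<lhd> G \<and> subgroup B G \<and> A \<inter> B = {\<one>\<^bsub>G\<^esub>} \<and> A <#>\<^bsub>G\<^esub> B = carrier G"

definition internal_direct :: "('g, 'n) monoid_scheme \<Rightarrow> 'g set \<Rightarrow> 'g set \<Rightarrow> bool" where
  "internal_direct G A B \<longleftrightarrow> internal_semidirect G A B \<and> B \<lhd> G"

subsection \<open>The automorphism group of the alternating group of degree 6\<close>

abbreviation A6 :: "(nat \<Rightarrow> nat) monoid" where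
  "A6 \<equiv> alt_group 6"

type_synonym aut = "(nat \<Rightarrow> nat) \<Rightarrow> (nat \<Rightarrow> nat)"

abbreviation AutA6 :: "aut monoid" where
  "AutA6 \<equiv> AutoGroup A6"

text \<open>The map \<open>c(g)(a) = g a g\<^sup>-\<^sup>1\<close> for a group \<open>G\<close> containing \<open>A\<^sub>6\<close> as the normal subgroup
  \<open>\<iota>(A\<^sub>6)\<close>.\<close>

definition conj_A6 :: "('g, 'n) monoid_scheme \<Rightarrow> ((nat \<Rightarrow> nat) \<Rightarrow> 'g) \<Rightarrow> 'g \<Rightarrow> aut" where
  "conj_A6 G \<iota> g =
     (\<lambda>a \<in> carrier A6. inv_into (carrier A6) \<iota> (g \<otimes>\<^bsub>G\<^esub> \<iota> a \<otimes>\<^bsub>G\<^esub> inv\<^bsub>G\<^esub> g))"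

definition InnA6 :: "aut set" where
  "InnA6 = conj_A6 A6 id ` carrier A6"

text \<open>The unique subgroup of \<open>Aut(A\<^sub>6)\<close> of the isomorphism type of \<open>H\<close> (for those \<open>H\<close> for which
  it is unique).\<close>

definition the_subgroup :: "('h, 'm) monoid_scheme \<Rightarrow> aut set" where
  "the_subgroup H = (THE K. subgroup K AutA6 \<and> AutA6 \<lparr>carrier := K\<rparr> \<cong> H)"

abbreviation S6_sub :: "aut set" where
  "S6_sub \<equiv> the_subgroup (sym_group 6)"

abbreviation PGL29_sub :: "aut set" where
  "PGL29_sub \<equiv> the_subgroup PGL29"

abbreviation M10_sub :: "aut set" where
  "M10_sub \<equiv> the_subgroup M10"

text \<open>The transposition \<open>(1,2)\<close>, with \<open>S\<^sub>6\<close> embedded in \<open>Aut(A\<^sub>6)\<close> by conjugation; this is the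
  embedding that extends the identification of \<open>A\<^sub>6\<close> with the inner automorphisms.\<close>

definition swap12 :: aut where
  "swap12 = conj_A6 (sym_group 6) id (cycle_of_list [1, 2])"

subsection \<open>The candidate groups\<close>

definition times_mu4 :: "aut set \<Rightarrow> (aut \<times> complex) monoid" where
  "times_mu4 N = (AutA6 \<lparr>carrier := N\<rparr>) \<times>\<times> mu4"

definition A6x1 :: "(aut \<times> complex) set" where
  "A6x1 = InnA6 \<times> {1}"

definition gen_group :: "aut set \<Rightarrow> aut \<Rightarrow> (aut \<times> complex) monoid" where
  "gen_group N g =
     (times_mu4 N) \<lparr>carrier := generate (times_mu4 N) (A6x1 \<union> {(g, zeta4)})\<rparr>"

definition A6_4 :: "(aut \<times> complex) monoid" where
  "A6_4 = times_mu4 InnA6"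

definition S6_2 :: "(aut \<times> complex) monoid" where
  "S6_2 = gen_group S6_sub swap12"

definition PGL29_2 :: "aut \<Rightarrow> (aut \<times> complex) monoid" where
  "PGL29_2 h = gen_group PGL29_sub (h [^]\<^bsub>AutA6\<^esub> (5::nat))"

definition M10_2 :: "aut \<Rightarrow> (aut \<times> complex) monoid" where
  "M10_2 g = gen_group M10_sub g"

text \<open>\<open>E = A\<^sub>6.\<langle>x\<rangle> = A\<^sub>6:\<langle>x\<rangle>\<close> inside \<open>N \<times> \<mu>\<^sub>4\<close>, with \<open>A\<^sub>6\<close> identified with \<open>A\<^sub>6 \<times> {1}\<close>.\<close>

definition split_by :: "(aut \<times> complex) monoid \<Rightarrow> aut set \<Rightarrow> aut \<times> complex \<Rightarrow> bool" where
  "split_by E N x \<longleftrightarrow>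
     subgroup (carrier E) (times_mu4 N) \<and>
     (\<exists>\<pi>. group_extension A6 E (E \<lparr>carrier := generate E {x}\<rparr>) (\<lambda>a. (conj_A6 A6 id a, 1)) \<pi>) \<and>
     internal_semidirect E A6x1 (generate E {x})"

end

theory Submission
  imports Defs "HOL-Combinatorics.Multiset_Permutations" "HOL-Analysis.Determinants"
begin

text \<open>Let \<open>G\<close> be an extension of \<open>\<mu>\<^sub>4\<close> by \<open>A\<^sub>6\<close>, let \<open>\<pi> : G \<rightarrow> \<mu>\<^sub>4\<close> be the projection
and \<open>c : G \<rightarrow> Aut(A\<^sub>6)\<close> the conjugation map, with image \<open>N\<close>. As \<open>A\<^sub>6\<close> has trivial centre,
\<open>g \<mapsto> (c(g), \<pi>(g))\<close> is injective, so \<open>G\<close> is a subgroup of \<open>N \<times> \<mu>\<^sub>4\<close> (\<open>F_inj\<close>). Choose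
\<open>g\<close> with \<open>\<pi>(g) = i\<close>; then \<open>G\<close> is generated by \<open>A\<^sub>6\<close> and \<open>g\<close>, and \<open>N\<close> by the inner
automorphisms and \<open>c(g)\<close>. The group \<open>Aut(A\<^sub>6)\<close> is the union of three subgroups \<open>S\<^sub>6\<close>,
\<open>PGL(2,9)\<close> and \<open>M\<^sub>1\<^sub>0\<close> in which \<open>A\<^sub>6\<close> has index 2 (\<open>Aut_cover\<close>). Hence \<open>N\<close> is
\<open>A\<^sub>6\<close> or the one among the three that contains \<open>c(g)\<close> (\<open>N_cases\<close>). The group \<open>G\<close> can be read
off from \<open>N\<close>: if \<open>N = A\<^sub>6\<close>, then every pair in \<open>N \<times> \<mu>\<^sub>4\<close> occurs; otherwise \<open>c(g)\<close> may be
moved to any prescribed element \<open>n\<close> of \<open>N - A\<^sub>6\<close> by multiplying \<open>g\<close> with an element of \<open>A\<^sub>6\<close>,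
and \<open>G\<close> is generated by \<open>A\<^sub>6\<close> and \<open>(n, i)\<close> (\<open>iso_direct\<close>, \<open>iso_gen\<close>). If \<open>n\<^sup>4 = 1\<close>, the cyclic
group generated by \<open>(n, i)\<close> maps isomorphically to \<open>\<mu>\<^sub>4\<close> and is a complement of \<open>A\<^sub>6\<close>
(\<open>split_section\<close>).

That the four groups are not isomorphic rests on \<open>A\<^sub>6\<close> being perfect: it is the derived subgroup of
every group considered here, so an isomorphism carries one copy of \<open>A\<^sub>6\<close> to the other and
conjugates the images in \<open>Aut(A\<^sub>6)\<close> by some automorphism (\<open>A6_ext_iso\<close>). These images are normal
subgroups of \<open>Aut(A\<^sub>6)\<close>, so they are equal. The same argument shows that each of the three
overgroups is the only subgroup of its isomorphism type (\<open>the_subgroup_eq\<close>).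

The structure of \<open>Aut(A\<^sub>6)\<close> comes from two estimates. First, \<open>Aut(A\<^sub>6)\<close> has at most 1440 elements
(\<open>card_Aut_le\<close>): an automorphism is determined by the images of the generators \<open>x = (1,2,3,4,5)\<close> and
\<open>y = (4,5,6)\<close>, there are 144 elements of order 5 to which \<open>x\<close> can go, and those automorphisms that
fix \<open>x\<close> send \<open>y\<close> to one of ten solutions of three equations that \<open>y\<close> satisfies. Secondly, \<open>S\<^sub>6\<close>,
\<open>PGL(2,9)\<close> and \<open>M\<^sub>1\<^sub>0\<close> contain \<open>A\<^sub>6\<close> with index 2 and trivial centralizer, so they embed into
\<open>Aut(A\<^sub>6)\<close>, and their images are distinct. Three distinct subgroups of order 720, any two of which meet
in the 360 inner automorphisms, cover \<open>360 + 3 * 360 = 1440\<close> elements.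

To find \<open>A\<^sub>6\<close> in \<open>PGL(2,9)\<close> and \<open>M\<^sub>1\<^sub>0\<close>, everything is made to act on the points \<open>1, ..., 10\<close>: \<open>A\<^sub>6\<close>
through the ten partitions of \<open>{1..6}\<close> into two triples (\<open>rho\<close>), \<open>PGL(2,9)\<close> through the projective
line over the field with nine elements (\<open>theta\<close>), and \<open>M\<^sub>1\<^sub>0\<close> through its definition. The numberings
of partitions and of projective points are chosen so that \<open>rho x\<close> and \<open>rho y\<close> coincide with two
projective maps and lie in \<open>M\<^sub>1\<^sub>2\<close>. The order of \<open>PGL(2,9)\<close> is at most 720 because a projective map
is determined by the images of three points; the stabilizers of 12 and then of 11 in \<open>M\<^sub>1\<^sub>2\<close> are found
by enumerating cosets (\<open>generate_subset_cosets\<close>), which yields \<open>M\<^sub>1\<^sub>0 = A\<^sub>6 \<union> m A\<^sub>6\<close> for an explicit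
\<open>m\<close>. Element orders separate \<open>S\<^sub>6\<close> from the other two groups: all its elements have order dividing 4,
5 or 6, while \<open>PGL(2,9)\<close> has an element of order 10 and \<open>M\<^sub>1\<^sub>0\<close> has the element \<open>X m\<close>
of order 8, where \<open>X = rho x\<close>. Finally \<open>m\<close> is not projective, since it agrees on three points with a projective map from which it
differs (\<open>m_notin_theta\<close>).

The finite verifications are counts of permutations and equations between words in explicit
permutations, which are represented by their tables of values.\<close>

section \<open>Subgroups of index 2\<close>

lemma index2_hom:
  assumes G: "group G" and H: "subgroup H G" and fin: "finite (carrier G)"
    and card: "card (carrier G) = 2 * card H"
  shows "(\<lambda>g. if g \<in> H then 1 else -1) \<in> hom G sign_img"
proof -
  interpret group G by fact
  interpret H: subgroup H G by fact
  have finH: "finite H" using fin H.subset finite_subset by blast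
  \<comment> \<open>Left multiplication by \<open>a\<close> maps \<open>H\<close> injectively into its complement, which has the same size.\<close>
  have key: "a \<otimes>\<^bsub>G\<^esub> b \<in> H" if a: "a \<in> carrier G - H" and b: "b \<in> carrier G - H" for a b
  proof -
    let ?f = "\<lambda>x. a \<otimes>\<^bsub>G\<^esub> x"
    have inj: "inj_on ?f (carrier G)"
      using a by (intro inj_onI) auto
    have out: "?f ` H \<subseteq> carrier G - H"
      using a H.subset
      by (auto dest!: subsetD) (metis H.m_closed H.m_inv_closed H.mem_carrier inv_solve_right)
    have "card (?f ` H) = card H"
      using inj H.subset by (intro card_image) (rule inj_on_subset)
    also have "\<dots> = card (carrier G - H)"
      using card finH H.subset by (simp add: card_Diff_subset)
    finally have eq: "?f ` H = carrier G - H"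
      using out fin by (intro card_subset_eq) auto
    show ?thesis
    proof (rule ccontr)
      assume "a \<otimes>\<^bsub>G\<^esub> b \<notin> H"
      then have "?f b \<in> ?f ` H" using a b eq by auto
      then have "b \<in> H" using inj b H.subset by (auto dest: inj_onD)
      with b show False by auto
    qed
  qed
  have mix1: "a \<otimes>\<^bsub>G\<^esub> b \<notin> H" if "a \<in> H" "b \<in> carrier G - H" for a b
    using that by (metis DiffD1 DiffD2 H.m_closed H.m_inv_closed H.mem_carrier inv_solve_left')
  have mix2: "a \<otimes>\<^bsub>G\<^esub> b \<notin> H" if "b \<in> H" "a \<in> carrier G - H" for a b
    using that by (metis DiffD1 DiffD2 H.m_closed H.m_inv_closed H.mem_carrier inv_solve_right')
  show ?thesis
    using key mix1 mix2 by (auto simp: hom_def sign_img_def)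
qed

lemma comm_group_sign_img: "comm_group sign_img"
  using sign_img_is_group
  by (intro group.group_comm_groupI) (auto simp: sign_img_def)

lemma kernel_index2:
  assumes "subgroup H G"
  shows "kernel G sign_img (\<lambda>g. if g \<in> H then 1 else -1) = H"
  using subgroup.subset[OF assms] by (auto simp: kernel_def sign_img_def)

lemma derived_subset_kernel:
  assumes "group G" "comm_group C" "\<pi> \<in> hom G C"
  shows "derived G (carrier G) \<subseteq> kernel G C \<pi>"
proof -
  interpret G: group G by fact
  interpret C: comm_group C by fact
  interpret h: group_hom G C \<pi> using assms by unfold_locales
  have "\<pi> (a \<otimes>\<^bsub>G\<^esub> b \<otimes>\<^bsub>G\<^esub> inv\<^bsub>G\<^esub> a \<otimes>\<^bsub>G\<^esub> inv\<^bsub>G\<^esub> b) = \<one>\<^bsub>C\<^esub>"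
    if "a \<in> carrier G" "b \<in> carrier G" for a b
    using that C.m_comm[of "\<pi> a" "\<pi> b"] by (simp add: C.m_assoc C.inv_solve_right')
  then show ?thesis
    unfolding derived_def
    by (intro G.generate_subgroup_incl h.subgroup_kernel) (auto simp: kernel_def)
qed

lemma index2_subgroup_normal:
  assumes G: "group G" and H: "subgroup H G" and fin: "finite (carrier G)"
    and card: "card (carrier G) = 2 * card H"
  shows "H \<lhd> G" "derived G (carrier G) \<subseteq> H"
proof -
  let ?\<pi> = "\<lambda>g. if g \<in> H then 1 else (-1::int)"
  interpret h: group_hom G sign_img ?\<pi>
    using index2_hom[OF assms] G sign_img_is_group by (simp add: group_hom_def group_hom_axioms_def)
  show "H \<lhd> G" using h.normal_kernel kernel_index2[OF H] by simp
  show "derived G (carrier G) \<subseteq> H"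
    using derived_subset_kernel[OF G comm_group_sign_img index2_hom[OF assms]] kernel_index2[OF H] by simp
qed

section \<open>Groups that contain the alternating group of degree 6\<close>

interpretation A6: group A6 by (rule alt_group_is_group)
interpretation Aut: group AutA6 by (rule A6.AutoGroup)

lemmas A6_simps = alt_group_mult alt_group_one

lemma A6_permutes: "a \<in> carrier A6 \<Longrightarrow> a permutes {1..6}"
  by (simp add: alt_group_carrier)

lemma finite_A6: "finite (carrier A6)"
  using alt_group_card_carrier[of 6] by (intro card_ge_0_finite) (simp add: fact_numeral)

lemma card_A6: "card (carrier A6) = 360"
  using alt_group_card_carrier[of 6] by (simp add: fact_numeral)

lemma card_S6: "card (carrier (sym_group 6)) = 720"
  using sym_group_card_carrier[of 6] by (simp add: fact_numeral)

lemma A6_perfect: "derived A6 (carrier A6) = carrier A6"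
  by (rule derived_alt_group_const) simp

lemma Aut_carrier: "\<phi> \<in> carrier AutA6 \<longleftrightarrow>
    \<phi> \<in> hom A6 A6 \<and> \<phi> \<in> extensional (carrier A6) \<and> bij_betw \<phi> (carrier A6) (carrier A6)"
  by (auto simp: AutoGroup_def auto_def Bij_def)

lemma Aut_closed: "\<phi> \<in> carrier AutA6 \<Longrightarrow> a \<in> carrier A6 \<Longrightarrow> \<phi> a \<in> carrier A6"
  by (auto simp: Aut_carrier hom_def)

lemma Aut_hom: "\<phi> \<in> carrier AutA6 \<Longrightarrow> \<phi> \<in> hom A6 A6"
  by (auto simp: Aut_carrier)

lemma Aut_mult_apply:
  "\<phi> \<in> carrier AutA6 \<Longrightarrow> \<psi> \<in> carrier AutA6 \<Longrightarrow> a \<in> carrier A6 \<Longrightarrow> (\<phi> \<otimes>\<^bsub>AutA6\<^esub> \<psi>) a = \<phi> (\<psi> a)"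
  by (auto simp: AutoGroup_def BijGroup_def auto_def compose_def)

lemma Aut_one_apply: "a \<in> carrier A6 \<Longrightarrow> \<one>\<^bsub>AutA6\<^esub> a = a"
  by (auto simp: AutoGroup_def BijGroup_def)

lemma Aut_eqI:
  assumes "\<phi> \<in> carrier AutA6" "\<psi> \<in> carrier AutA6" "\<And>a. a \<in> carrier A6 \<Longrightarrow> \<phi> a = \<psi> a"
  shows "\<phi> = \<psi>"
  using assms by (auto simp: Aut_carrier intro: extensionalityI)

lemma Aut_inj: "\<phi> \<in> carrier AutA6 \<Longrightarrow> inj_on \<phi> (carrier A6)"
  by (auto simp: Aut_carrier bij_betw_def)

lemma Aut_inv_apply:
  assumes "\<phi> \<in> carrier AutA6" "a \<in> carrier A6"
  shows "\<phi> ((inv\<^bsub>AutA6\<^esub> \<phi>) a) = a" "(inv\<^bsub>AutA6\<^esub> \<phi>) (\<phi> a) = a"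
  using Aut_mult_apply[of \<phi> "inv\<^bsub>AutA6\<^esub> \<phi>" a] Aut_mult_apply[of "inv\<^bsub>AutA6\<^esub> \<phi>" \<phi> a] assms
  by (simp_all add: Aut_one_apply)

text \<open>The conjugation map is a homomorphism into \<open>Aut(A\<^sub>6)\<close> as soon as the image of \<open>\<iota>\<close> is normal.
The identities are proved in the form \<open>\<iota> b \<otimes> g = g \<otimes> \<iota> a\<close>, which avoids both inverses and the
inverse function of \<open>\<iota>\<close>.\<close>

locale A6_normal = group G for G (structure) +
  fixes \<iota> :: "(nat \<Rightarrow> nat) \<Rightarrow> 'a"
  assumes mon: "\<iota> \<in> mon A6 G" and normal: "\<iota> ` carrier A6 \<lhd> G"
begin

sublocale \<iota>: group_hom A6 G \<iota>
  using mon by unfold_locales (simp add: mon_def)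

lemma inj: "inj_on \<iota> (carrier A6)"
  using mon by (simp add: mon_def)

abbreviation c :: "'a \<Rightarrow> aut" where "c \<equiv> conj_A6 G \<iota>"

lemma conj_image: "g \<in> carrier G \<Longrightarrow> a \<in> carrier A6 \<Longrightarrow> g \<otimes> \<iota> a \<otimes> inv g \<in> \<iota> ` carrier A6"
  using normal by (auto simp: normal_inv_iff)

lemma c_closed: "g \<in> carrier G \<Longrightarrow> a \<in> carrier A6 \<Longrightarrow> c g a \<in> carrier A6"
  using conj_image by (simp add: conj_A6_def inv_into_into)

lemma c_apply: "g \<in> carrier G \<Longrightarrow> a \<in> carrier A6 \<Longrightarrow> \<iota> (c g a) = g \<otimes> \<iota> a \<otimes> inv g"
  using conj_image by (simp add: conj_A6_def f_inv_into_f)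

lemma c_eqI:
  assumes "g \<in> carrier G" "a \<in> carrier A6" "b \<in> carrier A6" "\<iota> b \<otimes> g = g \<otimes> \<iota> a"
  shows "c g a = b"
proof (rule inj_onD[OF inj])
  have "g \<otimes> \<iota> a \<otimes> inv g = \<iota> b \<otimes> g \<otimes> inv g" using assms by simp
  also have "\<dots> = \<iota> b" using assms(1,3) by (simp add: m_assoc)
  finally show "\<iota> (c g a) = \<iota> b" using assms by (simp add: c_apply)
qed (use assms c_closed in auto)

lemma c_comm: "g \<in> carrier G \<Longrightarrow> a \<in> carrier A6 \<Longrightarrow> \<iota> (c g a) \<otimes> g = g \<otimes> \<iota> a"
  by (simp add: c_apply m_assoc)

lemma c_mult: "g \<in> carrier G \<Longrightarrow> h \<in> carrier G \<Longrightarrow> a \<in> carrier A6 \<Longrightarrow> c (g \<otimes> h) a = c g (c h a)"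
  by (rule c_eqI) (auto simp: c_closed m_assoc[symmetric] c_comm, simp add: c_closed m_assoc c_comm)

lemma c_one: "a \<in> carrier A6 \<Longrightarrow> c \<one> a = a"
  by (rule c_eqI) auto

lemma c_Aut: assumes g: "g \<in> carrier G" shows "c g \<in> carrier AutA6"
proof -
  have "c g (a \<otimes>\<^bsub>A6\<^esub> b) = c g a \<otimes>\<^bsub>A6\<^esub> c g b" if "a \<in> carrier A6" "b \<in> carrier A6" for a b
  proof (rule c_eqI)
    have "\<iota> (c g a \<otimes>\<^bsub>A6\<^esub> c g b) \<otimes> g = \<iota> (c g a) \<otimes> (\<iota> (c g b) \<otimes> g)"
      using that g c_closed by (simp add: m_assoc)
    also have "\<dots> = \<iota> (c g a) \<otimes> (g \<otimes> \<iota> b)"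
      using that g by (simp only: c_comm)
    also have "\<dots> = \<iota> (c g a) \<otimes> g \<otimes> \<iota> b"
      using that g c_closed by (simp add: m_assoc)
    also have "\<dots> = g \<otimes> \<iota> a \<otimes> \<iota> b"
      using that g by (simp only: c_comm)
    also have "\<dots> = g \<otimes> \<iota> (a \<otimes>\<^bsub>A6\<^esub> b)"
      using that g by (simp add: m_assoc)
    finally show "\<iota> (c g a \<otimes>\<^bsub>A6\<^esub> c g b) \<otimes> g = g \<otimes> \<iota> (a \<otimes>\<^bsub>A6\<^esub> b)" .
  qed (use that g c_closed in auto)
  moreover have "bij_betw (c g) (carrier A6) (carrier A6)"
  proof (rule bij_betwI[where g = "c (inv g)"])
    fix a assume a: "a \<in> carrier A6"
    show "c (inv g) (c g a) = a" using c_mult[of "inv g" g a] a g by (simp add: c_one)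
    show "c g (c (inv g) a) = a" using c_mult[of g "inv g" a] a g by (simp add: c_one)
  qed (use g c_closed in auto)
  ultimately show ?thesis
    using g c_closed by (auto simp: Aut_carrier hom_def conj_A6_def)
qed

lemma c_hom: "c \<in> hom G AutA6"
  by (auto simp: hom_def c_Aut c_mult Aut_mult_apply intro!: Aut_eqI)

sublocale c: group_hom G AutA6 c
  by unfold_locales (rule c_hom)

lemma c_Aut_eqI:
  assumes "g \<in> carrier G" "\<phi> \<in> carrier AutA6" "\<And>a. a \<in> carrier A6 \<Longrightarrow> \<iota> (\<phi> a) \<otimes> g = g \<otimes> \<iota> a"
  shows "c g = \<phi>"
  using assms by (intro Aut_eqI c_Aut c_eqI) (auto simp: Aut_closed)

lemma image_subgroup: "subgroup (c ` carrier G) AutA6"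
  by (rule c.img_is_subgroup)

lemma inj_c:
  assumes "\<And>g. g \<in> carrier G \<Longrightarrow> (\<And>a. a \<in> carrier A6 \<Longrightarrow> g \<otimes> \<iota> a = \<iota> a \<otimes> g) \<Longrightarrow> g = \<one>"
  shows "inj_on c (carrier G)"
proof (rule c.trivial_ker_imp_inj, rule equalityI)
  show "kernel G AutA6 c \<subseteq> {\<one>}"
  proof
    fix g assume "g \<in> kernel G AutA6 c"
    then have g: "g \<in> carrier G" "c g = \<one>\<^bsub>AutA6\<^esub>" by (auto simp: kernel_def)
    then have "g \<otimes> \<iota> a = \<iota> a \<otimes> g" if "a \<in> carrier A6" for a
      using c_comm[OF g(1) that] that by (simp add: Aut_one_apply)
    with assms g show "g \<in> {\<one>}" by blast
  qed
qed (auto simp: kernel_def)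

end

abbreviation inn :: "(nat \<Rightarrow> nat) \<Rightarrow> aut" where "inn \<equiv> conj_A6 A6 id"

interpretation A6self: A6_normal A6 id
proof (intro A6_normal.intro A6_normal_axioms.intro A6.is_group)
  show "id \<in> mon A6 A6" by (auto simp: mon_def hom_def)
  have "carrier A6 \<lhd> A6" by (rule A6.normal_invI[OF A6.subgroup_self]) simp
  then show "id ` carrier A6 \<lhd> A6" by simp
qed

context A6_normal begin

lemma c_iota: "a \<in> carrier A6 \<Longrightarrow> c (\<iota> a) = inn a"
proof (rule c_Aut_eqI)
  fix b assume "a \<in> carrier A6" "b \<in> carrier A6"
  then show "\<iota> (inn a b) \<otimes> \<iota> a = \<iota> a \<otimes> \<iota> b"
    using A6self.c_comm[of a b] A6self.c_closed[of a b]
    by (metis \<iota>.hom_mult id_apply)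
qed (auto intro: A6self.c_Aut)

lemma Inn_subset: "InnA6 \<subseteq> c ` carrier G"
  by (auto simp: InnA6_def c_iota[symmetric])

end

text \<open>If \<open>p\<close> moves \<open>i\<close>, then a 3-cycle \<open>(i, k, l)\<close> with \<open>k\<close>, \<open>l\<close> different from \<open>p i\<close> moves \<open>i\<close> but fixes
\<open>p i\<close>; commuting with \<open>p\<close> it would have to move both or neither. For \<open>p\<close> in \<open>A\<^sub>6\<close> this says that the
centre is trivial, and for \<open>p\<close> in \<open>S\<^sub>6\<close> that \<open>S\<^sub>6\<close> embeds into \<open>Aut(A\<^sub>6)\<close>.\<close>

lemma A6_centralizer_sym:
  assumes p: "p permutes {1..6}" and comm: "\<And>a. a \<in> carrier A6 \<Longrightarrow> p \<circ> a = a \<circ> p"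
  shows "p = id"
proof (rule ccontr)
  assume "p \<noteq> id"
  then obtain i where i: "p i \<noteq> i" by (auto simp: fun_eq_iff)
  then have i6: "i \<in> {1..6}" "p i \<in> {1..6}" using p by (metis permutes_not_in, metis permutes_in_image permutes_not_in)
  have "card ({1..6} - {i, p i}) = (4::nat)"
    using i i6 by (subst card_Diff_subset) auto
  then have "2 \<le> card ({1..6} - {i, p i})" by simp
  then obtain T where "T \<subseteq> {1..6} - {i, p i}" "card T = 2"
    by (rule obtain_subset_with_card_n)
  then obtain k l where kl: "k \<in> {1..6} - {i, p i}" "l \<in> {1..6} - {i, p i}" "k \<noteq> l"
    by (auto simp: card_2_iff)
  let ?t = "cycle_of_list [i, k, l]"
  have "?t \<in> three_cycles 6" using i6 kl i by (intro CollectI exI[of _ "[i,k,l]"]) auto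
  then have "?t \<in> carrier A6" using three_cycles_incl by blast
  from comm[OF this] have "p (?t i) = ?t (p i)" by (metis comp_apply)
  moreover have "?t i = k" using i i6 kl by (auto simp: transpose_def)
  moreover have "?t (p i) = p i" using i i6 kl by (auto simp: transpose_def)
  ultimately have "p k = p i" by simp
  then have "k = i" using p by (metis permutes_inverses(2))
  with kl show False by auto
qed

lemma inn_mon: "inn \<in> mon A6 AutA6"
  unfolding mon_def
  by (auto intro!: A6self.c_hom A6self.inj_c A6_centralizer_sym A6_permutes simp: A6_simps)

lemma Aut_inn:
  assumes "\<phi> \<in> carrier AutA6" "a \<in> carrier A6"
  shows "\<phi> \<otimes>\<^bsub>AutA6\<^esub> inn a = inn (\<phi> a) \<otimes>\<^bsub>AutA6\<^esub> \<phi>"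
proof (rule Aut_eqI)
  note [simp] = A6self.c_closed A6self.c_Aut Aut_closed assms Aut_mult_apply
  fix b assume b: "b \<in> carrier A6"
  have "\<phi> (inn a b) = inn (\<phi> a) (\<phi> b)"
  proof (rule A6self.c_eqI[symmetric])
    have "\<phi> (inn a b \<otimes>\<^bsub>A6\<^esub> a) = \<phi> (a \<otimes>\<^bsub>A6\<^esub> b)" using b A6self.c_comm[of a b] by simp
    then show "id (\<phi> (inn a b)) \<otimes>\<^bsub>A6\<^esub> \<phi> a = \<phi> a \<otimes>\<^bsub>A6\<^esub> id (\<phi> b)"
      using b Aut_hom[OF assms(1)] by (simp add: hom_def)
  qed (use b in auto)
  then show "(\<phi> \<otimes>\<^bsub>AutA6\<^esub> inn a) b = (inn (\<phi> a) \<otimes>\<^bsub>AutA6\<^esub> \<phi>) b" using b by simp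
qed (simp_all add: assms A6self.c_Aut Aut_closed)

lemma A6_normal_Aut:
  assumes "subgroup K AutA6" "InnA6 \<subseteq> K"
  shows "A6_normal (AutA6\<lparr>carrier := K\<rparr>) inn"
proof -
  interpret K: group "AutA6\<lparr>carrier := K\<rparr>" using assms(1) by (rule Aut.subgroup_imp_group)
  have inn_K: "inn a \<in> K" if "a \<in> carrier A6" for a using assms(2) that by (auto simp: InnA6_def)
  have KA: "K \<subseteq> carrier AutA6" using assms(1) by (rule subgroup.subset)
  have hom: "inn \<in> hom A6 (AutA6\<lparr>carrier := K\<rparr>)"
    using inn_mon inn_K by (auto simp: mon_def hom_def)
  then interpret h: group_hom A6 "AutA6\<lparr>carrier := K\<rparr>" inn by unfold_locales
  show ?thesis
  proof (intro A6_normal.intro A6_normal_axioms.intro K.is_group)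
    show "inn \<in> mon A6 (AutA6\<lparr>carrier := K\<rparr>)" using inn_mon hom by (auto simp: mon_def)
    show "inn ` carrier A6 \<lhd> AutA6\<lparr>carrier := K\<rparr>"
    proof (rule K.normal_invI[OF h.img_is_subgroup], safe)
      fix \<phi> a assume *: "\<phi> \<in> carrier (AutA6\<lparr>carrier := K\<rparr>)" "a \<in> carrier A6"
      then have \<phi>: "\<phi> \<in> K" "\<phi> \<in> carrier AutA6" using KA by auto
      have "\<phi> \<otimes>\<^bsub>AutA6\<^esub> inn a \<otimes>\<^bsub>AutA6\<^esub> inv\<^bsub>AutA6\<^esub> \<phi> = inn (\<phi> a)"
        using \<phi> * by (simp add: Aut_inn Aut.m_assoc A6self.c_Aut Aut_closed)
      then show "\<phi> \<otimes>\<^bsub>AutA6\<lparr>carrier := K\<rparr>\<^esub> inn a \<otimes>\<^bsub>AutA6\<lparr>carrier := K\<rparr>\<^esub> inv\<^bsub>AutA6\<lparr>carrier := K\<rparr>\<^esub> \<phi> \<in> inn ` carrier A6"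
        using \<phi> * by (simp add: Aut.m_inv_consistent[OF assms(1)] Aut_closed)
    qed
  qed
qed

text \<open>Under the identification of \<open>A\<^sub>6\<close> with the inner automorphisms, an automorphism acts on \<open>A\<^sub>6\<close> by
conjugation inside \<open>Aut(A\<^sub>6)\<close> exactly as it acts by evaluation.\<close>

lemma conj_Aut_self:
  assumes "subgroup K AutA6" "InnA6 \<subseteq> K" "\<phi> \<in> K"
  shows "conj_A6 (AutA6\<lparr>carrier := K\<rparr>) inn \<phi> = \<phi>"
proof -
  interpret K: A6_normal "AutA6\<lparr>carrier := K\<rparr>" inn using assms(1,2) by (rule A6_normal_Aut)
  have "K \<subseteq> carrier AutA6" using assms(1) by (rule subgroup.subset)
  then show ?thesis using assms(3) Aut_inn[of \<phi>] by (intro K.c_Aut_eqI) auto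
qed

lemma Inn_subgroup: "subgroup InnA6 AutA6"
  unfolding InnA6_def by (rule A6self.image_subgroup)

lemma Inn_normal: "InnA6 \<lhd> AutA6"
proof -
  interpret K: A6_normal AutA6 inn
    using A6_normal_Aut[OF Aut.subgroup_self subgroup.subset[OF Inn_subgroup]] by simp
  show ?thesis using K.normal by (simp add: InnA6_def)
qed

lemma card_Inn: "card InnA6 = 360"
  using inn_mon card_A6 unfolding InnA6_def mon_def by (simp add: card_image)

text \<open>Here the copy of \<open>A\<^sub>6\<close> is the derived subgroup, hence it is preserved by all isomorphisms. This covers
both the extensions of \<open>\<mu>\<^sub>4\<close> and the groups that contain \<open>A\<^sub>6\<close> with index 2.\<close>

locale A6_ext = group G for G (structure) +
  fixes \<iota> :: "(nat \<Rightarrow> nat) \<Rightarrow> 'a"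
  assumes mon': "\<iota> \<in> mon A6 G" and derived_eq: "derived G (carrier G) = \<iota> ` carrier A6"
begin

sublocale A6_normal
  using derived_is_normal[OF normal_invI[OF subgroup_self]] mon' derived_eq
  by (intro A6_normal.intro A6_normal_axioms.intro is_group) simp_all

end

lemma perfect_image_in_derived:
  assumes "group G" "\<iota> \<in> mon A6 G"
  shows "\<iota> ` carrier A6 \<subseteq> derived G (carrier G)"
proof -
  interpret group G by fact
  interpret h: group_hom A6 G \<iota> using assms(2) by unfold_locales (simp add: mon_def)
  have "\<iota> ` carrier A6 = derived G (\<iota> ` carrier A6)"
    using h.derived_img[of "carrier A6"] A6_perfect by simp
  also have "\<dots> \<subseteq> derived G (carrier G)"
    by (rule mono_derived) auto
  finally show ?thesis .
qed

text \<open>The derived subgroup lies in the kernel of every map to an abelian group, and it contains \<open>A\<^sub>6\<close>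
because \<open>A\<^sub>6\<close> is perfect.\<close>

lemma A6_ext_kernelI:
  assumes "group G" "\<iota> \<in> mon A6 G" "comm_group C" "\<pi> \<in> hom G C" "kernel G C \<pi> \<subseteq> \<iota> ` carrier A6"
  shows "A6_ext G \<iota>"
proof -
  interpret group G by fact
  show ?thesis
    using derived_subset_kernel[OF assms(1,3,4)] perfect_image_in_derived[OF assms(1,2)] assms(2,5)
    by unfold_locales auto
qed

lemma A6_ext_index2I:
  assumes "group G" "\<iota> \<in> mon A6 G" "card (carrier G) = 720"
  shows "A6_ext G \<iota>"
proof -
  interpret group G by fact
  interpret h: group_hom A6 G \<iota> using assms(2) by unfold_locales (simp add: mon_def)
  have fin: "finite (carrier G)" using assms(3) by (intro card_ge_0_finite) simp
  have "card (\<iota> ` carrier A6) = 360" using assms(2) card_A6 by (simp add: mon_def card_image)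
  then have *: "card (carrier G) = 2 * card (\<iota> ` carrier A6)" using assms(3) by simp
  show ?thesis
    using A6_ext_kernelI[OF assms(1,2) comm_group_sign_img index2_hom[OF assms(1) h.img_is_subgroup fin *]]
      kernel_index2[OF h.img_is_subgroup] by simp
qed

text \<open>An isomorphism restricts to an isomorphism between the derived subgroups, that is, to an automorphism
\<open>\<alpha>\<close> of \<open>A\<^sub>6\<close>. Transporting the conjugation action along it conjugates the image in \<open>Aut(A\<^sub>6)\<close>
by \<open>\<alpha>\<close>.\<close>

lemma A6_ext_iso:
  fixes G (structure) and G'
  assumes "A6_ext G \<iota>" "A6_ext G' \<iota>'" "G \<cong> G'"
  obtains \<alpha> where "\<alpha> \<in> carrier AutA6"
    "conj_A6 G' \<iota>' ` carrier G' = (\<lambda>\<phi>. \<alpha> \<otimes>\<^bsub>AutA6\<^esub> \<phi> \<otimes>\<^bsub>AutA6\<^esub> inv\<^bsub>AutA6\<^esub> \<alpha>) ` conj_A6 G \<iota> ` carrier G"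
proof -
  interpret G: A6_ext G \<iota> by fact
  interpret G': A6_ext G' \<iota>' by fact
  obtain f where f: "f \<in> hom G G'" "bij_betw f (carrier G) (carrier G')"
    using assms(3) by (auto simp: is_iso_def iso_def)
  interpret f: group_hom G G' f using f(1) by unfold_locales
  have fG: "f ` carrier G = carrier G'" and injf: "inj_on f (carrier G)"
    using f(2) by (auto simp: bij_betw_def)
  have im: "f ` \<iota> ` carrier A6 = \<iota>' ` carrier A6"
    using f.derived_img[of "carrier G"] G.derived_eq G'.derived_eq fG by simp
  define \<alpha> where "\<alpha> = (\<lambda>a\<in>carrier A6. inv_into (carrier A6) \<iota>' (f (\<iota> a)))"
  have \<alpha>: "\<alpha> a \<in> carrier A6" "\<iota>' (\<alpha> a) = f (\<iota> a)" if "a \<in> carrier A6" for a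
  proof -
    have "f (\<iota> a) \<in> \<iota>' ` carrier A6" using that im by blast
    then show "\<alpha> a \<in> carrier A6" "\<iota>' (\<alpha> a) = f (\<iota> a)"
      using that by (simp_all add: \<alpha>_def inv_into_into f_inv_into_f)
  qed
  have "\<alpha> (a \<otimes>\<^bsub>A6\<^esub> b) = \<alpha> a \<otimes>\<^bsub>A6\<^esub> \<alpha> b" if "a \<in> carrier A6" "b \<in> carrier A6" for a b
    using that \<alpha> by (intro inj_onD[OF G'.inj]) auto
  moreover have "inj_on \<alpha> (carrier A6)"
    using \<alpha> injf G.inj by (metis (no_types, lifting) G.\<iota>.hom_closed inj_on_def)
  moreover have "\<alpha> ` carrier A6 \<subseteq> carrier A6" using \<alpha> by auto
  ultimately have \<alpha>A: "\<alpha> \<in> carrier AutA6"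
    using endo_inj_surj[OF finite_A6, of \<alpha>] by (auto simp: Aut_carrier hom_def bij_betw_def \<alpha>_def)
  have *: "conj_A6 G' \<iota>' (f g) = \<alpha> \<otimes>\<^bsub>AutA6\<^esub> conj_A6 G \<iota> g \<otimes>\<^bsub>AutA6\<^esub> inv\<^bsub>AutA6\<^esub> \<alpha>" if g: "g \<in> carrier G" for g
  proof -
    have "conj_A6 G' \<iota>' (f g) \<otimes>\<^bsub>AutA6\<^esub> \<alpha> = \<alpha> \<otimes>\<^bsub>AutA6\<^esub> conj_A6 G \<iota> g"
    proof (rule Aut_eqI)
      fix a assume a: "a \<in> carrier A6"
      have "G'.c (f g) (\<alpha> a) = \<alpha> (G.c g a)"
      proof (rule G'.c_eqI)
        have "f (\<iota> (G.c g a) \<otimes> g) = f (g \<otimes> \<iota> a)" using G.c_comm[OF g a] by simp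
        then show "\<iota>' (\<alpha> (G.c g a)) \<otimes>\<^bsub>G'\<^esub> f g = f g \<otimes>\<^bsub>G'\<^esub> \<iota>' (\<alpha> a)"
          using a g by (simp add: \<alpha> G.c_closed)
      qed (use a g \<alpha> G.c_closed in auto)
      then show "(conj_A6 G' \<iota>' (f g) \<otimes>\<^bsub>AutA6\<^esub> \<alpha>) a = (\<alpha> \<otimes>\<^bsub>AutA6\<^esub> conj_A6 G \<iota> g) a"
        using a g \<alpha>A \<alpha> by (simp add: Aut_mult_apply G.c_Aut G'.c_Aut)
    qed (use g \<alpha>A G.c_Aut G'.c_Aut in auto)
    then show ?thesis using \<alpha>A g G'.c_Aut by (simp add: Aut.inv_solve_right G.c_Aut)
  qed
  show ?thesis
  proof (rule that[OF \<alpha>A])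
    show "conj_A6 G' \<iota>' ` carrier G' = (\<lambda>\<phi>. \<alpha> \<otimes>\<^bsub>AutA6\<^esub> \<phi> \<otimes>\<^bsub>AutA6\<^esub> inv\<^bsub>AutA6\<^esub> \<alpha>) ` conj_A6 G \<iota> ` carrier G"
      using * unfolding fG[symmetric] image_image by (intro image_cong) auto
  qed
qed

lemma conj_normal:
  assumes "K \<lhd> AutA6" "\<alpha> \<in> carrier AutA6"
  shows "(\<lambda>\<phi>. \<alpha> \<otimes>\<^bsub>AutA6\<^esub> \<phi> \<otimes>\<^bsub>AutA6\<^esub> inv\<^bsub>AutA6\<^esub> \<alpha>) ` K = K"
proof -
  interpret K: normal K AutA6 by fact
  have 1: "\<alpha> \<otimes>\<^bsub>AutA6\<^esub> \<phi> \<otimes>\<^bsub>AutA6\<^esub> inv\<^bsub>AutA6\<^esub> \<alpha> \<in> K" if "\<phi> \<in> K" for \<phi>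
    using K.inv_op_closed2 assms(2) that by auto
  have 2: "inv\<^bsub>AutA6\<^esub> \<alpha> \<otimes>\<^bsub>AutA6\<^esub> \<phi> \<otimes>\<^bsub>AutA6\<^esub> \<alpha> \<in> K" if "\<phi> \<in> K" for \<phi>
    using K.inv_op_closed1 assms(2) that by auto
  have 3: "\<phi> = \<alpha> \<otimes>\<^bsub>AutA6\<^esub> (inv\<^bsub>AutA6\<^esub> \<alpha> \<otimes>\<^bsub>AutA6\<^esub> \<phi> \<otimes>\<^bsub>AutA6\<^esub> \<alpha>) \<otimes>\<^bsub>AutA6\<^esub> inv\<^bsub>AutA6\<^esub> \<alpha>" if "\<phi> \<in> K" for \<phi>
  proof -
    note [simp] = assms(2) K.mem_carrier[OF that]
    have "\<alpha> \<otimes>\<^bsub>AutA6\<^esub> (inv\<^bsub>AutA6\<^esub> \<alpha> \<otimes>\<^bsub>AutA6\<^esub> \<phi> \<otimes>\<^bsub>AutA6\<^esub> \<alpha>) \<otimes>\<^bsub>AutA6\<^esub> inv\<^bsub>AutA6\<^esub> \<alpha>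
        = (\<alpha> \<otimes>\<^bsub>AutA6\<^esub> inv\<^bsub>AutA6\<^esub> \<alpha>) \<otimes>\<^bsub>AutA6\<^esub> \<phi> \<otimes>\<^bsub>AutA6\<^esub> (\<alpha> \<otimes>\<^bsub>AutA6\<^esub> inv\<^bsub>AutA6\<^esub> \<alpha>)"
      by (simp only: Aut.m_assoc Aut.m_closed Aut.inv_closed assms(2) K.mem_carrier[OF that])
    then show ?thesis by simp
  qed
  show ?thesis using 1 2 3 by (auto intro: image_eqI)
qed

section \<open>Permutation tables and words\<close>

(* The entries of tables are numerals; rewriting 1 to Suc 0 would hide them from each other. *)
declare One_nat_def [simp del]

text \<open>The permutations below act on \<open>{1..n}\<close> and are stored as the list of the images of \<open>1, ..., n\<close>; point
\<open>i\<close> sits at list position \<open>i - 1\<close>. A word is a list of indices into a list of generators and denotes the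
product in the order of the list, so that its last letter acts first.\<close>

definition tab :: "nat \<Rightarrow> (nat \<Rightarrow> nat) \<Rightarrow> nat list" where
  "tab n p = map p [1..<Suc n]"

definition tmul :: "nat list \<Rightarrow> nat list \<Rightarrow> nat list" where
  "tmul l k = map (\<lambda>i. l ! (i - 1)) k"

definition tword :: "nat \<Rightarrow> nat list list \<Rightarrow> nat list \<Rightarrow> nat list" where
  "tword n T w = foldr (\<lambda>k. tmul (T ! k)) w [1..<Suc n]"

text \<open>Words in \<open>x = (1,2,3,4,5)\<close> (letter 0) and \<open>y = (4,5,6)\<close> (letter 1) whose values are the forty
3-cycles of degree 6.\<close>

definition three_cycle_words :: "nat list list" where
  "three_cycle_words =
    [[1], [1,1], [0,1,0,0,0,0], [0,0,1,0,0,0], [1,0,1,0,0,0], [0,0,0,1,0,0], [0,1,0,1,0,0],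
     [0,0,0,0,1,0], [1,0,0,0,1,0], [0,0,1,0,1,0], [0,1,0,0,0,1], [0,0,0,1,0,1], [1,0,1,0,0,0,0],
     [0,1,1,0,0,0,0], [0,1,0,1,0,0,0], [0,0,1,0,1,0,0], [1,0,1,0,1,0,0], [1,0,0,0,0,1,0],
     [1,0,1,0,0,1,0], [0,0,0,1,0,1,0], [1,0,0,1,0,1,0], [0,0,0,0,1,0,1], [0,1,0,0,1,0,1],
     [1,0,1,1,0,1,0,0], [1,1,0,1,0,0,1,0], [0,1,0,1,1,0,1,0], [1,0,0,1,0,1,1,0],
     [1,0,1,0,0,1,0,1], [0,0,1,0,1,1,0,1], [0,1,0,0,1,0,1,1], [1,1,0,1,1,0,0,0,0],
     [1,1,0,0,0,1,0,0,1], [1,1,0,0,0,0,1,0,1], [1,0,0,1,0,0,0,1,1], [1,1,0,1,0,0,0,1,1],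
     [1,1,0,0,0,1,0,1,1], [0,1,0,1,1,0,1,0,0,0], [0,0,0,1,0,1,1,0,1,0], [0,0,0,0,1,0,1,0,0,0,0],
     [1,1,0,0,1,1,0,1,0,0,0]]"

definition covers_three_cycles :: "nat list list \<Rightarrow> bool" where
  "covers_three_cycles T \<longleftrightarrow> (\<forall>a\<in>{1..6}. \<forall>b\<in>{1..6}-{a}. \<forall>c\<in>{1..6}-{a,b}.
     map (\<lambda>i. if i = a then b else if i = b then c else if i = c then a else i) [1..<7] \<in> set T)"

lemma three_cycle_words_check:
  "covers_three_cycles (map (tword 6 [[2,3,4,5,1,6],[1,2,3,5,6,4]]) three_cycle_words)"
  by code_simp

text \<open>The size of the conjugacy class of \<open>x\<close> in \<open>Aut(A\<^sub>6)\<close> is at most the number of permutations of order 5.\<close>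

lemma order5_check:
  "length (filter (\<lambda>l. l \<noteq> [1..<7] \<and> tword 6 [l] [0,0,0,0,0] = [1..<7])
     (permutations_of_set_list [1..<7])) = 144"
  by code_simp

text \<open>The three relations \<open>y\<^sup>3 = (x y)\<^sup>4 = (x\<^sup>2 y)\<^sup>4 = 1\<close> of the generators leave only ten nontrivial
candidates for the image of \<open>y\<close> under an automorphism that fixes \<open>x\<close>.\<close>

lemma partner_check:
  "length (filter (\<lambda>l. l \<noteq> [1..<7] \<and> tword 6 [[2,3,4,5,1,6],l] [1,1,1] = [1..<7]
       \<and> tword 6 [[2,3,4,5,1,6],l] [0,1,0,1,0,1,0,1] = [1..<7]
       \<and> tword 6 [[2,3,4,5,1,6],l] [0,0,1,0,0,1,0,0,1,0,0,1] = [1..<7])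
     (permutations_of_set_list [1..<7])) = 10"
  by code_simp

text \<open>The fourth, fifth and sixth powers are computed from a shared square, as all 720 permutations are tested.\<close>

definition small_order :: "nat list \<Rightarrow> bool" where
  "small_order l \<longleftrightarrow> (let l2 = tmul l l; l4 = tmul l2 l2 in
     l4 = [1..<7] \<or> tmul l l4 = [1..<7] \<or> tmul l2 l4 = [1..<7])"

lemma small_order_check: "list_all small_order (permutations_of_set_list [1..<7])"
  by code_simp

text \<open>The seven letters of all words of degree 12. Letters 0, 1, 2 are the generators \<open>a\<close>, \<open>b\<close>, \<open>c\<close> of \<open>M\<^sub>1\<^sub>2\<close>;
3 and 4 are the actions \<open>X\<close>, \<open>Y\<close> of \<open>x\<close> and \<open>y\<close> on the ten partitions into triples; 5 is an element \<open>m\<close> of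
\<open>M\<^sub>1\<^sub>0\<close> outside \<open>A\<^sub>6\<close>; 6 is a projective map \<open>h\<close> of order 10. The letters 3 to 6 fix 11 and 12.\<close>

definition tabs12 :: "nat list list" where
  "tabs12 =
    [[2,3,4,5,6,7,8,9,10,11,1,12],
     [1,2,7,10,6,4,11,3,9,5,8,12],
     [12,11,6,8,9,3,10,4,5,7,2,1],
     [5,4,10,8,7,9,6,3,1,2,11,12],
     [10,2,4,5,3,7,9,1,6,8,11,12],
     [7,5,1,4,10,6,9,2,3,8,11,12],
     [10,4,7,5,9,3,1,6,8,2,11,12]]"

text \<open>The coset table for \<open>M\<^sub>1\<^sub>0\<close> in \<open>M\<^sub>1\<^sub>1\<close> with representatives \<open>a\<^sup>i\<close>: an entry \<open>(i, j, k)\<close> records that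
\<open>b a\<^sup>i = a\<^sup>j k\<close> with a word \<open>k\<close> in \<open>X\<close>, \<open>Y\<close>, \<open>m\<close>.\<close>

definition M11_coset_moves :: "(nat \<times> nat \<times> nat list) list" where
  "M11_coset_moves =
   [(0,8,[3,4,4,5,5,4]), (1,1,[3,5,4,4,5,5]), (2,2,[5,5,5,4]), (3,7,[3,4,3,5,4,5]), (4,10,[5]),
   (5,6,[3,5,3,3,3]), (6,4,[4,5,3,3,3]), (7,0,[4,5,4,3,5,3]), (8,3,[4,3,4,4,3,3]),
   (9,9,[5,5,3,3,4,4,3]), (10,5,[3,5,4])]"

lemma M11_coset_moves_check:
  "list_all (\<lambda>(i,j,k). tword 12 tabs12 (1 # replicate i 0) = tword 12 tabs12 (replicate j 0 @ k))
     M11_coset_moves"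
  by code_simp

text \<open>The coset table for \<open>M\<^sub>1\<^sub>1\<close> in \<open>M\<^sub>1\<^sub>2\<close> with representatives \<open>1\<close> and \<open>a\<^sup>i c\<close>: an entry \<open>(i, j, l, k)\<close>
records that \<open>b a\<^sup>i c = a\<^sup>j c a\<^sup>l k\<close> with a word \<open>k\<close> in \<open>X\<close>, \<open>Y\<close>, \<open>m\<close>. The second list does the same for
\<open>c a\<^sup>i c\<close>.\<close>

definition M12_coset_moves_b :: "(nat \<times> nat \<times> nat \<times> nat list) list" where
  "M12_coset_moves_b =
   [(0,0,0,[4,3,3,3,4]), (1,1,3,[4,4,5,4,4,3,3]), (2,6,8,[3,4,4,3,5,3]),
   (3,9,4,[3,5,4,5,3,3,5]), (4,5,7,[4,4,3,3,4,4,3]), (5,3,4,[4,4]), (6,10,8,[4,3,5,4,4,5,4]),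
   (7,2,10,[5,5,3,5,4,3,3]), (8,8,4,[5,4,3,5,3,3]), (9,4,8,[4,5,5,5]), (10,7,9,[3,3,5,4,4,3])]"

lemma M12_coset_moves_b_check:
  "list_all (\<lambda>(i,j,l,k). tword 12 tabs12 (1 # replicate i 0 @ [2])
     = tword 12 tabs12 (replicate j 0 @ 2 # replicate l 0 @ k)) M12_coset_moves_b"
  by code_simp

definition M12_coset_moves_c :: "(nat \<times> nat \<times> nat \<times> nat list) list" where
  "M12_coset_moves_c =
   [(1,10,10,[]), (2,5,6,[5,5,4,3,4,4]), (3,7,0,[3,5,4,5,3,3]), (4,8,3,[3,3,5,4,5,3,3,3]),
   (5,2,4,[5,3,3,5]), (6,9,3,[5,3,3,5]), (7,3,0,[3,3,5,4,5,3,3,3]), (8,4,6,[3,5,4,5,3,3]),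
   (9,6,10,[5,5,4,3,4,4]), (10,1,1,[])]"

lemma M12_coset_moves_c_check:
  "list_all (\<lambda>(i,j,l,k). tword 12 tabs12 (2 # replicate i 0 @ [2])
     = tword 12 tabs12 (replicate j 0 @ 2 # replicate l 0 @ k)) M12_coset_moves_c"
  by code_simp

text \<open>The powers \<open>a\<^sup>1\<^sup>1 = c\<^sup>2 = 1\<close>; expressions of \<open>X\<close>, \<open>Y\<close>, \<open>m\<close> by \<open>a\<close> and \<open>b\<close>; the relations that allow
\<open>m\<close> to be moved to the left of \<open>X\<close> and \<open>Y\<close> and express \<open>m\<^sup>2\<close> by \<open>X\<close> and \<open>Y\<close>; and
\<open>m\<^sup>4 = h\<^sup>1\<^sup>0 = 1\<close>.\<close>

definition relations12 :: "(nat list \<times> nat list) list" where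
  "relations12 =
    [(replicate 11 0, []), ([2,2], []),
     ([3], [1,1,0,0,0]), ([4], [0,1,0,0,1,0,0]), ([5], [0,1,0,0,0,0]),
     ([3,5], [5,4,4,3,3,4,3,4,4,3]), ([4,5], [5,3,3,4,3,3,4,3,4]), ([5,5], [4,3,3,4,4,3,4,3]),
     (replicate 4 5, []), (replicate 10 6, [])]"

lemma relations12_check:
  "list_all (\<lambda>(u,v). tword 12 tabs12 u = tword 12 tabs12 v) relations12"
  by code_simp

text \<open>Powers of \<open>m\<close>, \<open>h\<close> and \<open>X m\<close>; their nontriviality bounds the orders of these elements from below.\<close>

definition nonrelations12 :: "nat list list" where
  "nonrelations12 =
    [replicate 2 5, replicate 2 6, replicate 4 6, replicate 5 6, replicate 6 6,
      [3,5,3,5,3,5,3,5], [3,5,3,5,3,5,3,5,3,5], [3,5,3,5,3,5,3,5,3,5,3,5]]"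

lemma nonrelations12_check:
  "list_all (\<lambda>w. tword 12 tabs12 w \<noteq> tword 12 tabs12 []) nonrelations12"
  by code_simp

text \<open>The \<open>i\<close>-th word, in \<open>X\<close> and \<open>Y\<close>, fixes the point \<open>i\<close> and moves the other nine. Such words
force everything that centralizes \<open>X\<close> and \<open>Y\<close> to fix all ten points.\<close>

definition fixing_words :: "nat list list" where
  "fixing_words = [[3,4,3,3], [4], [3,3,3,4,3,3], [3,4,3,3,3,3], [3,3,4,3], [3,4,4,3], [4,4,3,3], [3,3,4,3,3,3], [4,3,3,3], [3,3,3,3,4,3]]"

lemma fixing_words_check:
  "list_all (\<lambda>i. list_all (\<lambda>j. (tword 12 tabs12 (fixing_words ! (i - 1)) ! (j - 1) = j) = (j = i)) [1..<11]) [1..<11]"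
  by code_simp

text \<open>The powers of \<open>a\<close> that represent the nontrivial cosets of \<open>M\<^sub>1\<^sub>0\<close> in \<open>M\<^sub>1\<^sub>1\<close> move the point 11.\<close>

lemma M11_points_check:
  "list_all (\<lambda>i. tword 12 tabs12 (replicate i 0) ! 10 \<noteq> 11) [1..<11]"
  by code_simp

text \<open>The points 2, 4, 5 are the points \<open>\<infinity>\<close>, 0, 1 of the projective line in the numbering \<open>pt\<close> used below.
On them \<open>m\<close> agrees with the projective map \<open>X\<^sup>2 h Y X\<close>.\<close>

lemma m_differs_check: "tword 12 tabs12 [5] \<noteq> tword 12 tabs12 [3,3,6,4,3]"
  "list_all (\<lambda>i. tword 12 tabs12 [5] ! (i - 1) = tword 12 tabs12 [3,3,6,4,3] ! (i - 1)) [2,4,5]"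
  by code_simp+

text \<open>A partition of \<open>{1..6}\<close> into two triples is named by the triple that avoids 6. The order of the list
matches the numbering \<open>pt\<close> of the projective line and the points of \<open>M\<^sub>1\<^sub>0\<close>.\<close>

definition half :: "nat \<Rightarrow> nat set" where
  "half i = [{1,2,4},{1,2,3},{1,4,5},{2,3,4},{2,3,5},{2,4,5},{1,3,4},{3,4,5},{1,3,5},{1,2,5}] ! (i - 1)"

definition bisection :: "nat \<Rightarrow> nat set set" where
  "bisection i = {half i, {1..6} - half i}"

lemma bisection_inj_check:
  "list_all (\<lambda>i. list_all (\<lambda>j. bisection i = bisection j \<longrightarrow> i = j) [1..<11]) [1..<11]"
  by code_simp

lemma half_check: "list_all (\<lambda>i. half i \<subseteq> {1..5} \<and> card (half i) = 3) [1..<11]"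
  by code_simp

lemma bisection_action_check:
  "list_all (\<lambda>i. image (image (\<lambda>i. [2,3,4,5,1,6] ! (i - 1))) (bisection i) = bisection (tabs12 ! 3 ! (i - 1))
      \<and> image (image (\<lambda>i. [1,2,3,5,6,4] ! (i - 1))) (bisection i) = bisection (tabs12 ! 4 ! (i - 1))) [1..<11]"
  by code_simp

section \<open>Words in a group\<close>

definition word_eval :: "('a, 'm) monoid_scheme \<Rightarrow> 'a list \<Rightarrow> nat list \<Rightarrow> 'a" where
  "word_eval G gs w = foldr (\<lambda>k g. gs ! k \<otimes>\<^bsub>G\<^esub> g) w \<one>\<^bsub>G\<^esub>"

lemma word_eval_simps:
  "word_eval G gs [] = \<one>\<^bsub>G\<^esub>"
  "word_eval G gs (k # w) = gs ! k \<otimes>\<^bsub>G\<^esub> word_eval G gs w"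
  by (simp_all add: word_eval_def)

lemma word_eval_A6: "word_eval A6 gs w = word_eval (sym_group 6) gs w"
  by (simp add: word_eval_def alt_group_mult alt_group_one sym_group_mult sym_group_one)

lemma word_eval_subgroup:
  assumes "subgroup J G" "set gs \<subseteq> J" "set w \<subseteq> {..<length gs}"
  shows "word_eval G gs w \<in> J"
  using assms(3)
  by (induction w)
    (use assms(1,2) nth_mem in \<open>auto simp: word_eval_simps intro!: subgroup.m_closed subgroup.one_closed\<close>)

lemma word_eval_hom:
  assumes "group_hom G H h" "set gs \<subseteq> carrier G" "set w \<subseteq> {..<length gs}"
  shows "h (word_eval G gs w) = word_eval H (map h gs) w"
proof -
  interpret group_hom G H h by fact
  show ?thesis
    using assms(3)
  proof (induction w)
    case (Cons k w)
    have "word_eval G gs w \<in> carrier G"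
      using Cons.prems assms(2) by (intro word_eval_subgroup[OF G.subgroup_self]) auto
    moreover have "gs ! k \<in> carrier G" using Cons.prems assms(2) nth_mem by fastforce
    ultimately show ?case using Cons by (simp add: word_eval_simps)
  qed (simp add: word_eval_simps)
qed

lemma length_tab [simp]: "length (tab n p) = n"
  by (simp add: tab_def)

lemma tab_nth: "i \<in> {1..n} \<Longrightarrow> tab n p ! (i - 1) = p i"
  by (auto simp: tab_def nth_append simp del: upt_Suc)

lemma tab_comp:
  assumes "q permutes {1..n}"
  shows "tab n (p \<circ> q) = tmul (tab n p) (tab n q)"
proof -
  have "p (q i) = tab n p ! (q i - 1)" if "i \<in> {1..n}" for i
    using that permutes_in_image[OF assms, of i] by (metis tab_nth)
  then show ?thesis
    by (auto simp: tmul_def tab_def simp del: upt_Suc)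
qed

lemma tab_eq_iff:
  assumes "p permutes {1..n}" "q permutes {1..n}"
  shows "tab n p = tab n q \<longleftrightarrow> p = q"
proof
  assume *: "tab n p = tab n q"
  have "p i = q i" for i
  proof (cases "i \<in> {1..n}")
    case True then show ?thesis using * by (metis tab_nth)
  next
    case False then show ?thesis using assms by (simp add: permutes_not_in)
  qed
  then show "p = q" by auto
qed simp

lemma tab_id: "tab n id = [1..<Suc n]"
  by (simp add: tab_def)

lemma tab_perms:
  assumes "p permutes {1..n}"
  shows "tab n p \<in> set (permutations_of_set_list [1..<Suc n])"
proof -
  have "inj_on p {1..n}" "p ` {1..n} = {1..n}"
    using assms by (auto intro: permutes_inj_on simp: permutes_image)
  then have "tab n p \<in> permutations_of_set (set [1..<Suc n])"
    by (auto simp: tab_def permutations_of_set_def distinct_map atLeastLessThanSuc_atLeastAtMost simp del: upt_Suc)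
  then show ?thesis by (subst (asm) permutations_of_list) (simp add: distinct_remdups_id del: upt_Suc)
qed

lemma word_eval_permutes:
  assumes "\<And>p. p \<in> set gs \<Longrightarrow> p permutes {1..n}" "set w \<subseteq> {..<length gs}"
  shows "word_eval (sym_group n) gs w permutes {1..n}"
proof -
  have "word_eval (sym_group n) gs w \<in> carrier (sym_group n)"
    using assms by (intro word_eval_subgroup group.subgroup_self sym_group_is_group) (auto simp: sym_group_carrier)
  then show ?thesis by (simp add: sym_group_carrier)
qed

text \<open>The link between computations with tables and identities in the symmetric group.\<close>

lemma tab_word_eval:
  assumes "\<And>p. p \<in> set gs \<Longrightarrow> p permutes {1..n}" "set w \<subseteq> {..<length gs}"
  shows "tab n (word_eval (sym_group n) gs w) = tword n (map (tab n) gs) w"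
  using assms(2)
proof (induction w)
  case Nil
  show ?case by (simp add: word_eval_simps sym_group_one tab_def tword_def del: upt_Suc)
next
  case (Cons k w)
  have "word_eval (sym_group n) gs w permutes {1..n}"
    using Cons.prems assms(1) by (intro word_eval_permutes) auto
  then have "tab n (word_eval (sym_group n) gs (k # w)) = tmul (tab n (gs ! k)) (tab n (word_eval (sym_group n) gs w))"
    unfolding word_eval_simps sym_group_mult by (rule tab_comp)
  then show ?case using Cons by (simp add: tword_def del: upt_Suc)
qed

lemma word_eval_eq_iff:
  assumes "\<And>p. p \<in> set gs \<Longrightarrow> p permutes {1..n}" "set w \<subseteq> {..<length gs}" "set v \<subseteq> {..<length gs}"
  shows "word_eval (sym_group n) gs w = word_eval (sym_group n) gs v
    \<longleftrightarrow> tword n (map (tab n) gs) w = tword n (map (tab n) gs) v"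
  using assms tab_word_eval[OF assms(1)] word_eval_permutes[OF assms(1)] by (metis tab_eq_iff)

section \<open>Generators and a bound for the automorphism group\<close>

definition a6x :: "nat \<Rightarrow> nat" where "a6x = cycle_of_list [1,2,3,4,5]"
definition a6y :: "nat \<Rightarrow> nat" where "a6y = cycle_of_list [4,5,6]"

lemma three_cycle_A6: "distinct [a,b,c] \<Longrightarrow> {a,b,c} \<subseteq> {1..6} \<Longrightarrow> cycle_of_list [a,b,c] \<in> carrier A6"
  using three_cycles_incl[of 6] by fastforce

lemma a6_closed: "a6x \<in> carrier A6" "a6y \<in> carrier A6"
proof -
  have "a6x = cycle_of_list [1,2,3] \<otimes>\<^bsub>A6\<^esub> cycle_of_list [3,4,5]"
    by (simp add: a6x_def A6_simps comp_assoc)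
  also have "\<dots> \<in> carrier A6" by (intro A6.m_closed three_cycle_A6) auto
  finally show "a6x \<in> carrier A6" .
  show "a6y \<in> carrier A6" unfolding a6y_def by (rule three_cycle_A6) auto
qed

lemma a6_permutes: "p \<in> set [a6x, a6y] \<Longrightarrow> p permutes {1..6}"
  using a6_closed A6_permutes by auto

lemma a6_tabs: "map (tab 6) [a6x, a6y] = [[2,3,4,5,1,6],[1,2,3,5,6,4]]"
  unfolding tab_def a6x_def a6y_def by code_simp

lemma three_cycle_words_letters: "w \<in> set three_cycle_words \<Longrightarrow> set w \<subseteq> {..<2}"
  by (auto simp: three_cycle_words_def)

text \<open>The 3-cycles generate \<open>A\<^sub>6\<close>, and each of them is a word in the two generators.\<close>

lemma A6_generated:
  assumes J: "subgroup J A6" "a6x \<in> J" "a6y \<in> J"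
  shows "J = carrier A6"
proof -
  have "three_cycles 6 \<subseteq> J"
  proof safe
    fix cs :: "nat list" assume cs: "cycle cs" "length cs = 3" "set cs \<subseteq> {1..6}"
    then obtain a b c where abc: "cs = [a, b, c]" by (metis stupid_lemma)
    let ?p = "cycle_of_list [a,b,c]"
    have p: "?p \<in> carrier A6" using cs abc by (intro three_cycle_A6) auto
    have "?p = (\<lambda>i. if i = a then b else if i = b then c else if i = c then a else i)"
      using cs abc by (auto simp: transpose_def)
    moreover have "a \<in> {1..6}" "b \<in> {1..6} - {a}" "c \<in> {1..6} - {a,b}" using cs abc by auto
    ultimately have "map ?p [1..<7] \<in> set (map (tword 6 (map (tab 6) [a6x, a6y])) three_cycle_words)"
      using three_cycle_words_check unfolding covers_three_cycles_def a6_tabs by (simp del: set_map)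
    then have "tab 6 ?p \<in> set (map (tword 6 (map (tab 6) [a6x, a6y])) three_cycle_words)"
      by (simp add: tab_def del: upt_Suc)
    then obtain w where w: "w \<in> set three_cycle_words" "tab 6 ?p = tword 6 (map (tab 6) [a6x, a6y]) w"
      by auto
    have lw: "set w \<subseteq> {..<length [a6x, a6y]}" using three_cycle_words_letters[OF w(1)] by (auto simp: numeral_2_eq_2)
    have "word_eval A6 [a6x, a6y] w \<in> J"
      using J lw by (intro word_eval_subgroup) auto
    moreover have "?p = word_eval A6 [a6x, a6y] w"
    proof (subst tab_eq_iff[symmetric])
      show "?p permutes {1..6}" using p by (rule A6_permutes)
      show "word_eval A6 [a6x, a6y] w permutes {1..6}"
        using calculation J(1) by (meson A6_permutes subgroup.mem_carrier)
      show "tab 6 ?p = tab 6 (word_eval A6 [a6x, a6y] w)"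
        unfolding word_eval_A6 using w(2) lw by (subst tab_word_eval) (auto intro: a6_permutes)
    qed
    ultimately show "cycle_of_list cs \<in> J" unfolding abc by simp
  qed
  then have "generate A6 (three_cycles 6) \<subseteq> J"
    using J(1) by (rule A6.generate_subgroup_incl)
  then show ?thesis
    using alt_group_carrier_as_three_cycles subgroup.subset[OF J(1)] by blast
qed

lemma Aut_eq_gens:
  assumes "\<phi> \<in> carrier AutA6" "\<psi> \<in> carrier AutA6" "\<phi> a6x = \<psi> a6x" "\<phi> a6y = \<psi> a6y"
  shows "\<phi> = \<psi>"
proof -
  interpret f: group_hom A6 A6 \<phi> using Aut_hom[OF assms(1)] by unfold_locales
  interpret g: group_hom A6 A6 \<psi> using Aut_hom[OF assms(2)] by unfold_locales
  have "subgroup {a \<in> carrier A6. \<phi> a = \<psi> a} A6"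
    by unfold_locales auto
  from A6_generated[OF this] show ?thesis
    using assms a6_closed by (intro Aut_eqI[OF assms(1,2)]) auto
qed

lemma A6_tab_word_eval:
  assumes "set gs \<subseteq> carrier A6" "set w \<subseteq> {..<length gs}"
  shows "tab 6 (word_eval A6 gs w) = tword 6 (map (tab 6) gs) w"
  unfolding word_eval_A6 using assms by (intro tab_word_eval) (auto dest: A6_permutes)

lemma A6_word_eval_id_iff:
  assumes "set gs \<subseteq> carrier A6" "set w \<subseteq> {..<length gs}"
  shows "word_eval A6 gs w = id \<longleftrightarrow> tword 6 (map (tab 6) gs) w = [1..<7]"
proof -
  have "word_eval A6 gs w \<in> carrier A6"
    using assms by (intro word_eval_subgroup A6.subgroup_self)
  then have "word_eval A6 gs w = id \<longleftrightarrow> tab 6 (word_eval A6 gs w) = tab 6 id"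
    by (intro tab_eq_iff[symmetric] A6_permutes permutes_id)
  also have "tab 6 id = [1..<7]" by (simp add: tab_id)
  finally show ?thesis using A6_tab_word_eval[OF assms] by metis
qed

lemma A6_tab_id_iff: "a \<in> carrier A6 \<Longrightarrow> tab 6 a = [1..<7] \<longleftrightarrow> a = id"
  using tab_eq_iff[OF A6_permutes permutes_id[of "{1..6}"], of a] by (simp add: tab_id)

lemma inj_tab: "inj_on (tab 6) (carrier A6)"
  by (intro inj_onI) (meson A6_permutes tab_eq_iff)

lemma card_by_tabs:
  assumes "A \<subseteq> carrier A6" "tab 6 ` A \<subseteq> set (filter P (permutations_of_set_list [1..<7]))"
  shows "card A \<le> length (filter P (permutations_of_set_list [1..<7]))"
proof -
  have "card A = card (tab 6 ` A)"
    using inj_on_subset[OF inj_tab assms(1)] by (simp add: card_image)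
  also have "\<dots> \<le> card (set (filter P (permutations_of_set_list [1..<7])))"
    using assms(2) by (intro card_mono) auto
  also have "\<dots> \<le> length (filter P (permutations_of_set_list [1..<7]))"
    by (rule card_length)
  finally show ?thesis .
qed

definition order5 :: "(nat \<Rightarrow> nat) set" where
  "order5 = {a \<in> carrier A6. a \<noteq> id \<and> word_eval A6 [a] [0,0,0,0,0] = id}"

text \<open>The permutations that can take the place of \<open>y\<close> next to \<open>x\<close>, as far as the three relations tell.\<close>

definition partners :: "(nat \<Rightarrow> nat) set" where
  "partners = {b \<in> carrier A6. b \<noteq> id \<and> (\<forall>w \<in> {[1,1,1], [0,1,0,1,0,1,0,1], [0,0,1,0,0,1,0,0,1,0,0,1]}.
     word_eval A6 [a6x, b] w = id)}"

lemma tabs_in_perms: "a \<in> carrier A6 \<Longrightarrow> tab 6 a \<in> set (permutations_of_set_list [1..<7])"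
  using tab_perms[OF A6_permutes, of a] by simp

lemma card_order5: "card order5 \<le> 144"
proof -
  have "tab 6 ` order5 \<subseteq> set (filter (\<lambda>l. l \<noteq> [1..<7] \<and> tword 6 [l] [0,0,0,0,0] = [1..<7])
     (permutations_of_set_list [1..<7]))"
    using A6_word_eval_id_iff[of "[a]" "[0,0,0,0,0]" for a]
    by (auto simp: order5_def A6_tab_id_iff tabs_in_perms simp del: upt_rec)
  from card_by_tabs[OF _ this] show ?thesis
    unfolding order5_check by (auto simp: order5_def)
qed

lemma card_partners: "card partners \<le> 10"
proof -
  have "tab 6 a6x = [2,3,4,5,1,6]" using a6_tabs by simp
  then have "tab 6 ` partners \<subseteq> set (filter (\<lambda>l. l \<noteq> [1..<7] \<and> tword 6 [[2,3,4,5,1,6],l] [1,1,1] = [1..<7]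
       \<and> tword 6 [[2,3,4,5,1,6],l] [0,1,0,1,0,1,0,1] = [1..<7]
       \<and> tword 6 [[2,3,4,5,1,6],l] [0,0,1,0,0,1,0,0,1,0,0,1] = [1..<7])
     (permutations_of_set_list [1..<7]))"
    using A6_word_eval_id_iff[of "[a6x, b]" for b] a6_closed One_nat_def
    by (auto simp: partners_def A6_tab_id_iff tabs_in_perms simp del: upt_rec)
  from card_by_tabs[OF _ this] show ?thesis
    unfolding partner_check by (auto simp: partners_def)
qed

lemma Aut_order5:
  assumes "\<phi> \<in> carrier AutA6" "a \<in> order5"
  shows "\<phi> a \<in> order5"
proof -
  have h: "group_hom A6 A6 \<phi>" using Aut_hom[OF assms(1)] by unfold_locales
  interpret group_hom A6 A6 \<phi> by fact
  have "word_eval A6 [\<phi> a] [0,0,0,0,0] = \<phi> (word_eval A6 [a] [0,0,0,0,0])"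
    using word_eval_hom[OF h, of "[a]" "[0,0,0,0,0]"] assms(2) by (auto simp: order5_def)
  also have "\<dots> = id" using assms(2) hom_one by (simp add: order5_def alt_group_one)
  moreover have "\<phi> a \<noteq> id"
    using assms(2) hom_one inj_onD[OF Aut_inj[OF assms(1)], of a id] A6.one_closed
    by (auto simp: alt_group_one order5_def)
  ultimately show ?thesis
    using assms(2) Aut_closed[OF assms(1)] by (simp add: order5_def)
qed

lemma Aut_partners:
  assumes "\<phi> \<in> carrier AutA6" "\<phi> a6x = a6x" "b \<in> partners"
  shows "\<phi> b \<in> partners"
proof -
  have h: "group_hom A6 A6 \<phi>" using Aut_hom[OF assms(1)] by unfold_locales
  interpret group_hom A6 A6 \<phi> by fact
  have b: "b \<in> carrier A6" "b \<noteq> id" using assms(3) by (auto simp: partners_def)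
  have "word_eval A6 [a6x, \<phi> b] w = id"
    if w: "w \<in> {[1,1,1], [0,1,0,1,0,1,0,1], [0,0,1,0,0,1,0,0,1,0,0,1]}" for w
  proof -
    have "set w \<subseteq> {..<length [a6x, b]}" using w by auto
    then have "word_eval A6 [\<phi> a6x, \<phi> b] w = \<phi> (word_eval A6 [a6x, b] w)"
      using word_eval_hom[OF h, of "[a6x, b]" w] b a6_closed by auto
    also have "word_eval A6 [a6x, b] w = id" using assms(3) w unfolding partners_def by blast
    also have "\<phi> id = id" using hom_one unfolding alt_group_one .
    finally show ?thesis using assms(2) by simp
  qed
  moreover have "\<phi> b \<noteq> id"
    using b hom_one inj_onD[OF Aut_inj[OF assms(1)], of b id] A6.one_closed by (auto simp: alt_group_one)
  ultimately show ?thesis using Aut_closed[OF assms(1) b(1)] by (simp add: partners_def)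
qed

lemma a6x_order5: "a6x \<in> order5"
proof -
  have "tword 6 (map (tab 6) [a6x, a6y]) [0,0,0,0,0] = [1..<7]" unfolding a6_tabs by code_simp
  moreover have "tab 6 a6x \<noteq> [1..<7]" using a6_tabs by (simp add: upt_rec)
  ultimately show ?thesis
    using A6_word_eval_id_iff[of "[a6x]" "[0,0,0,0,0]"] A6_tab_id_iff[of a6x] a6_closed
    by (simp add: order5_def tword_def del: upt_rec)
qed

lemma a6y_partner: "a6y \<in> partners"
proof -
  have "\<forall>w\<in>set [[1,1,1], [0,1,0,1,0,1,0,1], [0,0,1,0,0,1,0,0,1,0,0,1]].
      tword 6 (map (tab 6) [a6x, a6y]) w = [1..<7]"
    unfolding a6_tabs by code_simp
  moreover have "tab 6 a6y \<noteq> [1..<7]" using a6_tabs by (simp add: upt_rec)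
  ultimately show ?thesis
    using A6_word_eval_id_iff[of "[a6x, a6y]"] A6_tab_id_iff[of a6y] a6_closed
    unfolding partners_def by auto
qed

text \<open>For every value \<open>q\<close> that automorphisms take at \<open>x\<close> fix one automorphism \<open>s q\<close> that takes it.
Then \<open>\<phi>\<close> is determined by \<open>q = \<phi> x\<close> and by the automorphism \<open>(s q)\<^sup>-\<^sup>1 \<phi>\<close>, which fixes \<open>x\<close> and is
therefore determined by its value at \<open>y\<close>. This leaves \<open>144 * 10\<close> possibilities.\<close>

lemma card_Aut_le: "card (carrier AutA6) \<le> 1440"
proof -
  define s where "s q = (SOME \<phi>. \<phi> \<in> carrier AutA6 \<and> \<phi> a6x = q)" for q
  have s: "s (\<phi> a6x) \<in> carrier AutA6" "s (\<phi> a6x) a6x = \<phi> a6x" if "\<phi> \<in> carrier AutA6" for \<phi>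
    using someI[of "\<lambda>\<psi>. \<psi> \<in> carrier AutA6 \<and> \<psi> a6x = \<phi> a6x" \<phi>] that by (auto simp: s_def)
  define r where "r \<phi> = inv\<^bsub>AutA6\<^esub> (s (\<phi> a6x)) \<otimes>\<^bsub>AutA6\<^esub> \<phi>" for \<phi>
  have r: "r \<phi> \<in> carrier AutA6" if "\<phi> \<in> carrier AutA6" for \<phi>
    using s[OF that] that by (simp add: r_def)
  have rx: "r \<phi> a6x = a6x" if "\<phi> \<in> carrier AutA6" for \<phi>
    using s[OF that] that a6_closed Aut_inv_apply(2)[of "s (\<phi> a6x)" a6x]
    by (simp add: r_def Aut_mult_apply)
  have inj: "inj_on (\<lambda>\<phi>. (\<phi> a6x, r \<phi> a6y)) (carrier AutA6)"
  proof (rule inj_onI)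
    fix \<phi> \<psi> assume *: "\<phi> \<in> carrier AutA6" "\<psi> \<in> carrier AutA6" "(\<phi> a6x, r \<phi> a6y) = (\<psi> a6x, r \<psi> a6y)"
    then have "r \<phi> = r \<psi>" using rx by (intro Aut_eq_gens r) auto
    then show "\<phi> = \<psi>" using * s(1)[OF *(1)] by (auto simp: r_def)
  qed
  have fin: "finite (order5 \<times> partners)"
    by (rule finite_subset[of _ "carrier A6 \<times> carrier A6"]) (auto simp: order5_def partners_def finite_A6)
  have "card (carrier AutA6) \<le> card (order5 \<times> partners)"
    using Aut_order5 a6x_order5 Aut_partners a6y_partner r rx
    by (intro card_inj_on_le[OF inj _ fin]) auto
  also have "\<dots> = card order5 * card partners" by (rule card_cartesian_product)
  also have "\<dots> \<le> 144 * 10" using card_order5 card_partners by (rule mult_le_mono)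
  finally show ?thesis by simp
qed

lemma finite_Aut: "finite (carrier AutA6)"
proof (rule finite_subset)
  show "carrier AutA6 \<subseteq> (\<Pi>\<^sub>E a\<in>carrier A6. carrier A6)"
    by (auto simp: Aut_carrier hom_def PiE_def)
qed (use finite_A6 in \<open>auto intro: finite_PiE\<close>)

lemma S6_small_order:
  assumes "p \<in> carrier (sym_group 6)"
  shows "\<exists>k\<in>{4,5,6::nat}. p [^]\<^bsub>sym_group 6\<^esub> k = \<one>\<^bsub>sym_group 6\<^esub>"
proof -
  interpret S: group "sym_group 6" by (rule sym_group_is_group)
  have p: "p permutes {1..6}" using assms by (simp add: sym_group_carrier)
  define q where "q = p \<circ> p"
  define r where "r = q \<circ> q"
  have q: "q permutes {1..6}" and r: "r permutes {1..6}"
    using p by (auto simp: q_def r_def intro: permutes_compose)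
  have one: "f = \<one>\<^bsub>sym_group 6\<^esub> \<longleftrightarrow> tab 6 f = [1..<7]" if "f permutes {1..6}" for f
    using tab_eq_iff[OF that permutes_id] by (simp add: sym_group_one tab_id)
  have "small_order (tab 6 p)"
    using small_order_check tab_perms[OF p] by (simp add: list_all_iff)
  then have "tab 6 r = [1..<7] \<or> tab 6 (p \<circ> r) = [1..<7] \<or> tab 6 (q \<circ> r) = [1..<7]"
    using p q r by (simp add: small_order_def Let_def tab_comp q_def r_def)
  then have "r = \<one>\<^bsub>sym_group 6\<^esub> \<or> p \<circ> r = \<one>\<^bsub>sym_group 6\<^esub> \<or> q \<circ> r = \<one>\<^bsub>sym_group 6\<^esub>"
    using one p q r permutes_compose by blast
  moreover have "p [^]\<^bsub>sym_group 6\<^esub> (4::nat) = r" "p [^]\<^bsub>sym_group 6\<^esub> (5::nat) = p \<circ> r"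
    "p [^]\<^bsub>sym_group 6\<^esub> (6::nat) = q \<circ> r"
    using S.nat_pow_Suc2[OF assms]
    by (simp_all add: numeral_eq_Suc sym_group_mult sym_group_one q_def r_def comp_assoc del: S.nat_pow_Suc)
  ultimately show ?thesis by auto
qed

section \<open>Actions on numbered sets\<close>

lemma set_1_10: "{1..10::nat} = {1,2,3,4,5,6,7,8,9,10}"
  by code_simp

lemma tab12_eqI:
  assumes "length l = 12" "\<And>i. i \<in> {1..10} \<Longrightarrow> p i = l ! (i - 1)" "p 11 = 11" "p 12 = 12" "l ! 10 = 11" "l ! 11 = 12"
  shows "tab 12 p = l"
proof (rule nth_equalityI)
  fix k assume "k < length (tab 12 p)"
  then have k: "k < 12" by simp
  then have "tab 12 p ! k = p (k + 1)" using tab_nth[of "k + 1" 12 p] by simp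
  also have "\<dots> = l ! k"
  proof (cases "k < 10")
    case True then show ?thesis using assms(2)[of "k + 1"] by simp
  next
    case False
    then have "k = 10 \<or> k = 11" using k by auto
    then show ?thesis using assms by auto
  qed
  finally show "tab 12 p ! k = l ! k" .
qed (use assms in simp)

text \<open>The permutation of \<open>{1..n}\<close> that \<open>F\<close> induces through the numbering \<open>e\<close>; it is extended by the
identity, so that results for different \<open>n\<close> can be compared inside one symmetric group.\<close>

definition relabel :: "nat \<Rightarrow> (nat \<Rightarrow> 'b) \<Rightarrow> ('b \<Rightarrow> 'b) \<Rightarrow> nat \<Rightarrow> nat" where
  "relabel n e F i = (if i \<in> {1..n} then inv_into {1..n} e (F (e i)) else i)"

lemma relabel_eq:
  assumes "inj_on e {1..n}" "i \<in> {1..n}" "j \<in> {1..n}" "F (e i) = e j"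
  shows "relabel n e F i = j"
  using assms by (simp add: relabel_def)

lemma relabel_apply:
  assumes "F ` e ` {1..n} \<subseteq> e ` {1..n}" "i \<in> {1..n}"
  shows "relabel n e F i \<in> {1..n}" "e (relabel n e F i) = F (e i)"
proof -
  have "F (e i) \<in> e ` {1..n}" using assms by blast
  then show "relabel n e F i \<in> {1..n}" "e (relabel n e F i) = F (e i)"
    using assms(2) inv_into_into[of "F (e i)" e "{1..n}"] f_inv_into_f[of "F (e i)" e "{1..n}"]
    by (simp_all add: relabel_def)
qed

lemma relabel_comp:
  assumes "inj_on e {1..n}" "F ` e ` {1..n} \<subseteq> e ` {1..n}" "G ` e ` {1..n} \<subseteq> e ` {1..n}"
  shows "relabel n e (F \<circ> G) = relabel n e F \<circ> relabel n e G"
proof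
  fix i show "relabel n e (F \<circ> G) i = (relabel n e F \<circ> relabel n e G) i"
  proof (cases "i \<in> {1..n}")
    case True
    note G = relabel_apply[OF assms(3) True]
    note F = relabel_apply[OF assms(2) G(1)]
    show ?thesis using relabel_eq[OF assms(1) True F(1), of "F \<circ> G"] F G by simp
  next
    case False then show ?thesis by (auto simp: relabel_def)
  qed
qed

lemma relabel_permutes:
  assumes "inj_on e {1..n}" "F ` e ` {1..n} \<subseteq> e ` {1..n}" "inj_on F (e ` {1..n})"
  shows "relabel n e F permutes {1..n}"
proof (rule bij_imp_permutes)
  have "inj_on (relabel n e F) {1..n}"
  proof (rule inj_onI)
    fix i j assume *: "i \<in> {1..n}" "j \<in> {1..n}" "relabel n e F i = relabel n e F j"
    then have "F (e i) = F (e j)" using relabel_apply(2)[OF assms(2)] by metis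
    then have "e i = e j" using *(1,2) assms(3) by (auto dest!: inj_onD)
    then show "i = j" using *(1,2) inj_onD[OF assms(1)] by blast
  qed
  moreover have "relabel n e F ` {1..n} \<subseteq> {1..n}" using relabel_apply(1)[OF assms(2)] by auto
  ultimately show "bij_betw (relabel n e F) {1..n} {1..n}"
    using endo_inj_surj[of "{1..n}"] by (auto simp: bij_betw_def)
qed (auto simp: relabel_def)

lemma relabel_id_on:
  assumes "inj_on e {1..n}" "\<And>i. i \<in> {1..n} \<Longrightarrow> F (e i) = e i"
  shows "relabel n e F = id"
proof
  fix i show "relabel n e F i = id i"
  proof (cases "i \<in> {1..n}")
    case True then show ?thesis using relabel_eq[OF assms(1) True True, of F] assms(2)[OF True] by simp
  next
    case False then show ?thesis by (simp only: relabel_def if_False id_apply)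
  qed
qed

section \<open>The action on the ten partitions into triples\<close>

lemma bisection_inj: "inj_on bisection {1..10}"
  using bisection_inj_check by (auto simp: inj_on_def list_all_iff)

lemma half_props: "i \<in> {1..10} \<Longrightarrow> half i \<subseteq> {1..5} \<and> card (half i) = 3"
  using half_check by (auto simp: list_all_iff)

text \<open>There are ten triples in \<open>{1..5}\<close> and the listed ones are distinct, so all of them are listed.\<close>

lemma bisection_surj:
  assumes "S \<subseteq> {1..6}" "card S = 3"
  shows "{S, {1..6} - S} \<in> bisection ` {1..10}"
proof -
  let ?H = "{S. S \<subseteq> {1..5::nat} \<and> card S = 3}"
  have 5: "card ?H = 10" using n_subsets[of "{1..5::nat}" 3] by (simp add: eval_nat_numeral One_nat_def)
  have sub: "half ` {1..10} \<subseteq> ?H" using half_props by blast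
  have "inj_on half {1..10}"
    using bisection_inj by (auto simp: inj_on_def bisection_def)
  then have "card (half ` {1..10}) = card ?H" using 5 by (simp add: card_image)
  moreover have "finite ?H" using 5 by (intro card_ge_0_finite) simp
  ultimately have "half ` {1..10} = ?H" using sub by (intro card_subset_eq)
  then have surj: "\<exists>i\<in>{1..10}. half i = T" if "T \<subseteq> {1..5}" "card T = 3" for T
    using that by (auto simp: set_eq_iff image_iff) metis
  have six: "{1..5::nat} = {1..6} - {6}" by auto
  show ?thesis
  proof (cases "6 \<in> S")
    case False
    then have "S \<subseteq> {1..5}" using assms(1) unfolding six by blast
    then obtain i where "i \<in> {1..10}" "half i = S" using surj assms(2) by blast
    then show ?thesis by (auto simp: bisection_def)
  next
    case True
    let ?T = "{1..6} - S"
    have "?T \<subseteq> {1..5}" using True unfolding six by blast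
    moreover have "card ?T = 3" using assms by (simp add: card_Diff_subset finite_subset)
    ultimately obtain i where i: "i \<in> {1..10}" "half i = ?T" using surj by blast
    have "{1..6} - ?T = S" using assms(1) by auto
    then have "bisection i = {S, ?T}" using i by (auto simp: bisection_def)
    then show ?thesis using i by (metis imageI)
  qed
qed

lemma bisection_iff: "B \<in> bisection ` {1..10} \<longleftrightarrow> (\<exists>S. S \<subseteq> {1..6} \<and> card S = 3 \<and> B = {S, {1..6} - S})"
proof
  assume "B \<in> bisection ` {1..10}"
  then obtain i where i: "i \<in> {1..10}" "B = bisection i" by auto
  then have "half i \<subseteq> {1..6}" using half_props[of i] by fastforce
  then show "\<exists>S. S \<subseteq> {1..6} \<and> card S = 3 \<and> B = {S, {1..6} - S}"
    using i half_props[of i] by (auto simp: bisection_def)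
qed (use bisection_surj in auto)

definition rho :: "(nat \<Rightarrow> nat) \<Rightarrow> nat \<Rightarrow> nat" where
  "rho p = relabel 10 bisection (image (image p))"

lemma image_bisections:
  assumes "p permutes {1..6}"
  shows "image (image p) ` bisection ` {1..10} \<subseteq> bisection ` {1..10}"
proof
  fix B' assume "B' \<in> image (image p) ` bisection ` {1..10}"
  then obtain B where "B \<in> bisection ` {1..10}" "B' = image p ` B" by auto
  then obtain S where S: "S \<subseteq> {1..6}" "card S = 3" "B' = image p ` {S, {1..6} - S}"
    unfolding bisection_iff by auto
  have "p ` ({1..6} - S) = {1..6} - p ` S"
    using assms by (simp add: image_set_diff permutes_inj permutes_image)
  then have "B' = {p ` S, {1..6} - p ` S}" using S(3) by simp
  moreover have "p ` S \<subseteq> {1..6}" using S(1) assms by (metis image_mono permutes_image)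
  moreover have "card (p ` S) = 3" using S(2) assms by (metis card_image inj_on_subset permutes_inj subset_UNIV)
  ultimately show "B' \<in> bisection ` {1..10}" unfolding bisection_iff by blast
qed

lemma rho_permutes: assumes "p permutes {1..6}" shows "rho p permutes {1..10}"
  unfolding rho_def
proof (rule relabel_permutes[OF bisection_inj image_bisections[OF assms]])
  show "inj_on (image (image p)) (bisection ` {1..10})"
  proof (rule inj_onI)
    have "inj (image p)" by (intro injI) (simp add: inj_image_eq_iff[OF permutes_inj[OF assms]])
    then show "A = B" if "image p ` A = image p ` B" for A B :: "nat set set"
      using that by (simp add: inj_image_eq_iff)
  qed
qed

lemma rho_comp:
  assumes "p permutes {1..6}" "q permutes {1..6}"
  shows "rho (p \<circ> q) = rho p \<circ> rho q"
proof -
  have "image (image (p \<circ> q)) = image (image p) \<circ> image (image q)"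
    by (auto simp: fun_eq_iff image_image)
  then show ?thesis
    unfolding rho_def using relabel_comp[OF bisection_inj image_bisections[OF assms(1)] image_bisections[OF assms(2)]] by simp
qed

text \<open>If \<open>p a = b \<noteq> a\<close>, then a triple \<open>{a, b, c}\<close> and its image have \<open>b\<close> in common; as \<open>p\<close> fixes
the partition, it fixes the triple. Letting \<open>c\<close> vary, \<open>p\<close> swaps \<open>a\<close> and \<open>b\<close> and fixes the other points.
But then it sends \<open>{a, c, d}\<close> to \<open>{b, c, d}\<close>, which belongs to a different partition.\<close>

lemma rho_trivial:
  assumes p: "p permutes {1..6}" and "rho p = id"
  shows "p = id"
proof (rule ccontr)
  have fix_half: "p ` S = S \<or> p ` S = {1..6} - S" if S: "S \<subseteq> {1..6}" "card S = 3" for S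
  proof -
    obtain i where i: "i \<in> {1..10}" "bisection i = {S, {1..6} - S}"
      using bisection_surj[OF S] by (metis imageE)
    have "image p ` bisection i = bisection i"
      using relabel_apply(2)[OF image_bisections[OF p] i(1)] assms(2) by (simp add: rho_def)
    then show ?thesis using i(2) by (auto simp: doubleton_eq_iff)
  qed
  assume "p \<noteq> id"
  then obtain a where a: "p a \<noteq> a" by (auto simp: fun_eq_iff)
  define b where "b = p a"
  have ab: "a \<in> {1..6}" "b \<in> {1..6}" "a \<noteq> b"
    using a p by (auto simp: b_def) (metis atLeastAtMost_iff permutes_in_image permutes_not_in)+
  have inj: "p u = p v \<longleftrightarrow> u = v" for u v using permutes_inj[OF p] by (auto dest: injD)
  have tri: "p ` {a,b,c} = {a,b,c}" if c: "c \<in> {1..6} - {a,b}" for c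
    using fix_half[of "{a,b,c}"] ab c by (auto simp: b_def)
  have "card ({1..6} - {a, b}) = (4::nat)" using ab by (subst card_Diff_subset) auto
  then have "2 \<le> card ({1..6} - {a, b})" by simp
  then obtain T where "T \<subseteq> {1..6} - {a, b}" "card T = 2"
    by (rule obtain_subset_with_card_n)
  then obtain c d where cd: "c \<in> {1..6} - {a,b}" "d \<in> {1..6} - {a,b}" "c \<noteq> d"
    by (auto simp: card_2_iff)
  have "p ` {a,b} = {a,b}"
  proof -
    have "p ` {a,b} = p ` {a,b,c} \<inter> p ` {a,b,d}" using cd by (auto simp: inj)
    also have "\<dots> = {a,b}" using cd unfolding tri[OF cd(1)] tri[OF cd(2)] by auto
    finally show ?thesis .
  qed
  then have "p b = a" using inj[of a b] ab by (auto simp: b_def)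
  have fixed: "p e = e" if e: "e \<in> {1..6} - {a,b}" for e
  proof -
    have "p e \<in> {a,b,e}" using tri[OF e] by blast
    moreover have "p e \<noteq> p a" "p e \<noteq> p b" using e by (auto simp: inj)
    ultimately show ?thesis using \<open>p b = a\<close> by (auto simp: b_def)
  qed
  then have "p ` {a,c,d} = {b,c,d}" using fixed[OF cd(1)] fixed[OF cd(2)] by (simp add: b_def)
  moreover have "p ` {a,c,d} = {a,c,d} \<or> p ` {a,c,d} = {1..6} - {a,c,d}"
    using ab cd by (intro fix_half) auto
  ultimately have "b \<in> {a,c,d} \<or> c \<in> {1..6} - {a,c,d}" by blast
  then show False using ab cd by blast
qed

lemma rho_hom: "rho \<in> hom A6 (sym_group 12)"
proof -
  have "rho p permutes {1..12}" if "p permutes {1..6}" for p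
    using rho_permutes[OF that] by (rule permutes_subset) auto
  then show ?thesis
    using A6_permutes rho_comp by (simp add: hom_def sym_group_carrier sym_group_mult alt_group_mult)
qed

interpretation S12: group "sym_group 12" by (rule sym_group_is_group)

interpretation rho: group_hom A6 "sym_group 12" rho
  by (intro group_hom.intro group_hom_axioms.intro A6.is_group sym_group_is_group rho_hom)

lemma rho_inj: "inj_on rho (carrier A6)"
proof (rule rho.trivial_ker_imp_inj, rule equalityI)
  show "kernel A6 (sym_group 12) rho \<subseteq> {\<one>\<^bsub>A6\<^esub>}"
    using rho_trivial A6_permutes by (auto simp: kernel_def sym_group_one alt_group_one)
qed (use rho.hom_one in \<open>auto simp: kernel_def\<close>)

lemma tab12_rho_gen:
  assumes "a \<in> carrier A6" "length l = 12" "l ! 10 = 11" "l ! 11 = 12"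
    "\<forall>i\<in>{1..10}. l ! (i - 1) \<in> {1..10}"
    "\<And>i. i \<in> {1..10} \<Longrightarrow> image (image (\<lambda>i. tab 6 a ! (i - 1))) (bisection i) = bisection (l ! (i - 1))"
  shows "tab 12 (rho a) = l"
proof (rule tab12_eqI)
  show "rho a i = l ! (i - 1)" if i: "i \<in> {1..10}" for i
    unfolding rho_def
  proof (rule relabel_eq[OF bisection_inj i])
    show "l ! (i - 1) \<in> {1..10}" using assms(5) i by blast
    have "image (image (\<lambda>i. tab 6 a ! (i - 1))) (bisection i) = image (image a) (bisection i)"
    proof (rule image_cong[OF refl], rule image_cong[OF refl])
      fix S j assume "S \<in> bisection i" "j \<in> S"
      then have "j \<in> {1..6}" using half_props[OF i] by (auto simp: bisection_def)
      then show "tab 6 a ! (j - 1) = a j" by (rule tab_nth)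
    qed
    then show "image (image a) (bisection i) = bisection (l ! (i - 1))" using assms(6)[OF i] by simp
  qed
qed (use assms(2-4) in \<open>auto simp: rho_def relabel_def\<close>)

lemma tab_rho_gens: "tab 12 (rho a6x) = tabs12 ! 3" "tab 12 (rho a6y) = tabs12 ! 4"
proof -
  have t: "tab 6 a6x = [2,3,4,5,1,6]" "tab 6 a6y = [1,2,3,5,6,4]" using a6_tabs by auto
  have act: "image (image (\<lambda>i. tab 6 a6x ! (i - 1))) (bisection i) = bisection (tabs12 ! 3 ! (i - 1))"
    "image (image (\<lambda>i. tab 6 a6y ! (i - 1))) (bisection i) = bisection (tabs12 ! 4 ! (i - 1))"
    if "i \<in> {1..10}" for i
    using bisection_action_check that unfolding t list_all_iff by auto
  show "tab 12 (rho a6x) = tabs12 ! 3"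
    by (rule tab12_rho_gen[OF _ _ _ _ _ act(1)]) (simp_all add: a6_closed tabs12_def set_1_10)
  show "tab 12 (rho a6y) = tabs12 ! 4"
    by (rule tab12_rho_gen[OF _ _ _ _ _ act(2)]) (simp_all add: a6_closed tabs12_def set_1_10)
qed

section \<open>The projective linear group on the projective line\<close>

lemma GL2_simps: "carrier GL2 = {A. invertible A}" "A \<otimes>\<^bsub>GL2\<^esub> B = A ** B" "\<one>\<^bsub>GL2\<^esub> = mat 1"
  by (simp_all add: GL2_def)

lemma group_GL2: "group GL2"
proof (rule groupI)
  fix A :: "'a::field^2^2" assume "A \<in> carrier GL2"
  then obtain B where "A ** B = mat 1" "B ** A = mat 1" by (auto simp: GL2_simps invertible_def)
  then show "\<exists>B\<in>carrier GL2. B \<otimes>\<^bsub>GL2\<^esub> A = \<one>\<^bsub>GL2\<^esub>" by (auto simp: GL2_simps invertible_def)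
qed (auto simp: GL2_simps invertible_mult matrix_mul_assoc[symmetric] invertible_def[of "mat 1"])

definition line :: "f9^2 \<Rightarrow> (f9^2) set" where
  "line v = {k *s v |k. True}"

text \<open>A numbering of the projective line: point 2 is \<open>\<infinity>\<close>, and the other points are \<open>(z : 1)\<close> with \<open>z\<close> from
the list. The entry at the list position of 2 is a filler.\<close>

definition pt :: "nat \<Rightarrow> f9^2" where
  "pt i = (if i = 2 then vector [1, 0] else
     vector [[F9 0 2, 0, F9 2 0, F9 0 0, F9 1 0, F9 2 1, F9 0 1, F9 2 2, F9 1 1, F9 1 2] ! (i - 1), 1])"

lemma image_line: "(*v) A ` line v = line (A *v v)"
proof -
  have "A *v (k *s v) = k *s (A *v v)" for k
    by (simp add: vec_eq_iff matrix_vector_mult_def sum_distrib_left mult.left_commute)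
  then show ?thesis by (force simp: line_def image_iff)
qed

lemma line_smult: "k \<noteq> 0 \<Longrightarrow> line (k *s v) = line v"
  by (auto simp: line_def vector_smult_assoc) (metis mult.assoc divide_self_if mult.right_neutral nonzero_eq_divide_eq)

lemma line_eqD: "line v = line w \<Longrightarrow> \<exists>k. w = k *s v"
proof -
  assume *: "line v = line w"
  have "w = 1 *s w" by simp
  then have "w \<in> line w" unfolding line_def by blast
  then have "w \<in> line v" using * by simp
  then show ?thesis unfolding line_def by blast
qed

lemma line_pt_surj:
  assumes "v \<noteq> 0" shows "line v \<in> (\<lambda>i. line (pt i)) ` {1..10}"
proof (cases "v $ 2 = 0")
  case True
  then have "v $ 1 \<noteq> 0" using assms by (auto simp: vec_eq_iff forall_2)
  moreover have "v = (v $ 1) *s pt 2" using True by (auto simp: vec_eq_iff forall_2 pt_def)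
  ultimately have "line v = line (pt 2)" using line_smult by metis
  then show ?thesis by auto
next
  case False
  obtain a b where z: "v $ 1 / v $ 2 = F9 a b" by (cases "v $ 1 / v $ 2")
  have v: "v = (v $ 2) *s vector [F9 a b, 1]"
    using False by (auto simp: vec_eq_iff forall_2 z[symmetric])
  have "\<exists>i\<in>{1..10}. vector [F9 a b, 1] = pt i"
    using three_cases[of a] three_cases[of b]
    unfolding set_1_10 by (elim disjE) (simp_all add: pt_def vec_eq_iff forall_2 zero_f9_def)
  then obtain i where i: "i \<in> {1..10}" "vector [F9 a b, 1] = pt i" by blast
  then have "line v = line (pt i)" using v line_smult[OF False, of "pt i"] by metis
  then show ?thesis using i(1) by blast
qed

lemma line_pt_inj: "inj_on (\<lambda>i. line (pt i)) {1..10}"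
proof (rule inj_onI)
  fix i j assume *: "i \<in> {1..10::nat}" "j \<in> {1..10::nat}" "line (pt i) = line (pt j)"
  then obtain k where k: "pt j = k *s pt i" using line_eqD by blast
  then have 1: "pt j $ 1 = k * pt i $ 1" and 2: "pt j $ 2 = k * pt i $ 2" by auto
  show "i = j"
  proof (cases "i = 2 \<or> j = 2")
    case True
    with 1 2 show ?thesis by (auto simp: pt_def split: if_splits)
  next
    case False
    then have "k = 1" using 2 by (auto simp: pt_def)
    then have "pt i $ 1 = pt j $ 1" using 1 by simp
    then show ?thesis using *(1,2) False unfolding set_1_10 by (auto simp: pt_def zero_f9_def)
  qed
qed

definition theta :: "f9^2^2 \<Rightarrow> nat \<Rightarrow> nat" where
  "theta A = relabel 10 (\<lambda>i. line (pt i)) (image ((*v) A))"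

lemma pt_nonzero: "pt i \<noteq> 0"
  by (auto simp: pt_def vec_eq_iff forall_2)

lemma invertible_mult_vec:
  fixes A :: "'a::field^2^2"
  assumes "invertible A"
  shows "inj ((*v) A)" "v \<noteq> 0 \<Longrightarrow> A *v v \<noteq> 0"
proof -
  show inj: "inj ((*v) A)" using assms by (rule inj_matrix_vector_mult)
  show "A *v v \<noteq> 0" if "v \<noteq> 0"
    using injD[OF inj, of v 0] that by auto
qed

lemma image_lines:
  assumes "invertible A"
  shows "image ((*v) A) ` (\<lambda>i. line (pt i)) ` {1..10} \<subseteq> (\<lambda>i. line (pt i)) ` {1..10}"
  using invertible_mult_vec(2)[OF assms pt_nonzero] line_pt_surj by (auto simp: image_line)

lemma theta_permutes:
  assumes "invertible A" shows "theta A permutes {1..10}"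
  unfolding theta_def
proof (rule relabel_permutes[OF line_pt_inj image_lines[OF assms]])
  show "inj_on (image ((*v) A)) ((\<lambda>i. line (pt i)) ` {1..10})"
    using invertible_mult_vec(1)[OF assms] by (auto intro!: inj_onI simp: inj_image_eq_iff)
qed

lemma theta_hom: "theta \<in> hom GL2 (sym_group 12)"
proof -
  have "theta A permutes {1..12}" if "invertible A" for A
    using theta_permutes[OF that] by (rule permutes_subset) auto
  moreover have "theta (A ** B) = theta A \<circ> theta B" if "invertible A" "invertible B" for A B
  proof -
    have "image ((*v) (A ** B)) = image ((*v) A) \<circ> image ((*v) B)"
      by (auto simp: fun_eq_iff image_image matrix_vector_mul_assoc)
    then show ?thesis
      unfolding theta_def using relabel_comp[OF line_pt_inj image_lines[OF that(1)] image_lines[OF that(2)]] by simp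
  qed
  ultimately show ?thesis by (auto simp: hom_def sym_group_carrier sym_group_mult GL2_simps)
qed

interpretation theta: group_hom GL2 "sym_group 12" theta
  by (intro group_hom.intro group_hom_axioms.intro group_GL2 sym_group_is_group theta_hom)

lemma theta_apply:
  assumes "invertible A" "i \<in> {1..10}"
  shows "line (pt (theta A i)) = line (A *v pt i)"
  using relabel_apply(2)[OF image_lines[OF assms(1)] assms(2)] by (simp add: theta_def image_line)

lemma theta_mat:
  assumes "k \<noteq> 0" shows "invertible (mat k :: f9^2^2)" "theta (mat k) = id"
proof -
  show "invertible (mat k :: f9^2^2)"
    using assms by (simp add: invertible_det_nz det_2 mat_def)
  have "mat k *v v = k *s v" for v :: "f9^2"
    by (simp add: vec_eq_iff forall_2 matrix_vector_mult_def sum_2 mat_def)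
  then have "(*v) (mat k) ` line v = line v" for v
    unfolding image_line using line_smult[OF assms] by simp
  then show "theta (mat k) = id"
    unfolding theta_def by (intro relabel_id_on[OF line_pt_inj])
qed

text \<open>The points 2, 4, 5 are \<open>\<infinity>\<close>, 0 and 1: the first two make the matrix diagonal, and the third makes its
diagonal entries equal.\<close>

lemma theta_fixes_frame:
  assumes A: "invertible A" and frame: "theta A 2 = 2" "theta A 4 = 4" "theta A 5 = 5"
  shows "\<exists>k. k \<noteq> 0 \<and> A = mat k"
proof -
  have ev: "\<exists>k. A *v pt i = k *s pt i" if "i \<in> {2,4,5}" for i
    using theta_apply[OF A, of i] that frame by (auto dest!: line_eqD)
  obtain k2 where "A *v pt 2 = k2 *s pt 2" using ev[of 2] by auto
  then have 2: "A $ 1 $ 1 = k2" "A $ 2 $ 1 = 0"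
    by (auto simp: vec_eq_iff forall_2 matrix_vector_mult_def sum_2 pt_def)
  obtain k4 where "A *v pt 4 = k4 *s pt 4" using ev[of 4] by auto
  then have 4: "A $ 2 $ 2 = k4" "A $ 1 $ 2 = 0"
    by (auto simp: vec_eq_iff forall_2 matrix_vector_mult_def sum_2 pt_def zero_f9_def[symmetric])
  obtain k5 where "A *v pt 5 = k5 *s pt 5" using ev[of 5] by auto
  then have "A $ 1 $ 1 + A $ 1 $ 2 = k5" "A $ 2 $ 1 + A $ 2 $ 2 = k5"
    by (auto simp: vec_eq_iff forall_2 matrix_vector_mult_def sum_2 pt_def one_f9_def[symmetric])
  with 2 4 have "k2 = k5" "k4 = k5" by auto
  with 2 4 have *: "A = mat k5" by (auto simp: vec_eq_iff forall_2 mat_def)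
  moreover have "k5 \<noteq> 0" using A unfolding * by (auto simp: invertible_det_nz det_2 mat_def)
  ultimately show ?thesis by blast
qed

lemma kernel_theta: "kernel GL2 (sym_group 12) theta = {mat k |k. k \<noteq> 0}"
  using theta_fixes_frame theta_mat by (force simp: kernel_def GL2_simps sym_group_one)

text \<open>Projective maps that agree on the frame are equal; this bounds their number by \<open>10 * 9 * 8\<close>.\<close>

lemma theta_frame_eq:
  assumes "invertible A" "invertible B" "\<And>i. i \<in> {2,4,5} \<Longrightarrow> theta A i = theta B i"
  shows "theta A = theta B"
proof -
  let ?C = "inv\<^bsub>GL2\<^esub> B \<otimes>\<^bsub>GL2\<^esub> A"
  have AB: "A \<in> carrier GL2" "B \<in> carrier GL2" using assms(1,2) by (simp_all add: GL2_simps)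
  then have C: "?C \<in> carrier GL2" by simp
  have BC: "theta B \<circ> theta ?C = theta A"
  proof -
    have "B \<otimes>\<^bsub>GL2\<^esub> ?C = A" using AB by (simp add: theta.G.m_assoc[symmetric])
    then show ?thesis using theta.hom_mult[OF AB(2) C] by (simp add: sym_group_mult)
  qed
  have "theta ?C i = i" if "i \<in> {2,4,5}" for i
  proof -
    have "theta B (theta ?C i) = theta B i" using BC assms(3)[OF that] by (metis comp_apply)
    then show ?thesis using permutes_inj[OF theta_permutes[OF assms(2)]] by (auto dest: injD)
  qed
  then have "theta ?C = id"
    using theta_fixes_frame[of ?C] C theta_mat by (auto simp: GL2_simps)
  then show ?thesis using BC by simp
qed

lemma card_image_theta: "card (theta ` carrier GL2) \<le> 720"
proof -
  let ?D = "SIGMA i:{1..10::nat}. SIGMA j:{1..10} - {i}. {1..10::nat} - {i, j}"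
  have "card ?D = 720" by (simp add: card_SigmaI card_Diff_subset)
  moreover have "inj_on (\<lambda>q. (q 2, q 4, q 5)) (theta ` carrier GL2)"
    by (rule inj_onI) (auto simp: GL2_simps intro!: theta_frame_eq)
  moreover have "(\<lambda>q. (q 2, q 4, q 5)) ` theta ` carrier GL2 \<subseteq> ?D"
  proof
    fix z assume "z \<in> (\<lambda>q. (q 2, q 4, q 5)) ` theta ` carrier GL2"
    then obtain A where A: "A \<in> carrier GL2" "z = (theta A 2, theta A 4, theta A 5)" by blast
    then have p: "theta A permutes {1..10}" by (intro theta_permutes) (simp add: GL2_simps)
    have "theta A i \<in> {1..10}" if "i \<in> {2,4,5}" for i
      using that by (subst permutes_in_image[OF p]) auto
    moreover have "theta A i = theta A j \<longleftrightarrow> i = j" for i j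
      using permutes_inj[OF p] by (rule inj_eq)
    ultimately show "z \<in> ?D"
      unfolding A(2) by (intro SigmaI DiffI) simp_all
  qed
  moreover have "finite ?D" by (intro finite_SigmaI) auto
  ultimately show ?thesis using card_inj_on_le[of "\<lambda>q. (q 2, q 4, q 5)" "theta ` carrier GL2" ?D] by simp
qed

text \<open>Scalar matrices form the kernel of \<open>theta\<close>, so \<open>theta\<close> takes a single value on each coset. The
quotient group acts faithfully on the ten points.\<close>

definition theta_bar :: "(f9^2^2) set \<Rightarrow> nat \<Rightarrow> nat" where
  "theta_bar X = the_elem (theta ` X)"

lemma PGL29_eq: "PGL29 = GL2 Mod kernel GL2 (sym_group 12) theta"
  unfolding PGL2_def kernel_theta ..

lemma theta_bar_hom: "theta_bar \<in> hom PGL29 (sym_group 12)"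
  unfolding PGL29_eq theta_bar_def by (rule theta.FactGroup_hom)

lemma theta_bar_inj: "inj_on theta_bar (carrier PGL29)"
  unfolding PGL29_eq theta_bar_def by (rule theta.FactGroup_inj_on)

lemma group_PGL29: "group PGL29"
  unfolding PGL29_eq by (rule normal.factorgroup_is_group[OF theta.normal_kernel])

lemma theta_bar_image: "theta_bar ` carrier PGL29 = theta ` carrier GL2"
proof -
  have "theta_bar (kernel GL2 (sym_group 12) theta #>\<^bsub>GL2\<^esub> A) = theta A" if "A \<in> carrier GL2" for A
  proof -
    let ?X = "kernel GL2 (sym_group 12) theta #>\<^bsub>GL2\<^esub> A"
    have "A \<in> ?X" using theta.G.rcos_self[OF that theta.subgroup_kernel] .
    moreover have "theta B = theta A" if "B \<in> ?X" for B
      using that \<open>A \<in> carrier GL2\<close> by (auto simp: r_coset_def kernel_def)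
    ultimately show ?thesis unfolding theta_bar_def by (intro the_elem_image_unique) blast+
  qed
  then show ?thesis
    unfolding PGL29_eq carrier_FactGroup image_image by (intro image_cong) simp_all
qed

text \<open>The table of a projective map is verified on representatives: the matrix sends the vector of the point
\<open>i\<close> to a nonzero multiple, with factor \<open>ks ! (i - 1)\<close>, of the vector of its image.\<close>

lemma tab12_theta:
  assumes "invertible A" "length l = 12" "l ! 10 = 11" "l ! 11 = 12"
    "\<forall>i\<in>{1..10}. l ! (i - 1) \<in> {1..10}"
    "\<forall>i\<in>{1..10}. ks ! (i - 1) \<noteq> 0 \<and> A *v pt i = ks ! (i - 1) *s pt (l ! (i - 1))"
  shows "tab 12 (theta A) = l"
proof (rule tab12_eqI)
  show "theta A i = l ! (i - 1)" if i: "i \<in> {1..10}" for i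
    unfolding theta_def
  proof (rule relabel_eq[OF line_pt_inj i])
    show "l ! (i - 1) \<in> {1..10}" using assms(5) i by blast
    show "image ((*v) A) (line (pt i)) = line (pt (l ! (i - 1)))"
      using assms(6) i by (simp add: image_line line_smult)
  qed
qed (use assms(2-4) in \<open>auto simp: theta_def relabel_def\<close>)

text \<open>Matrices that act on the projective line as \<open>x\<close> and \<open>y\<close> act on the ten partitions, and a matrix \<open>h\<close> whose
projective map has order 10.\<close>

definition mat_x :: "f9^2^2" where "mat_x = vector [vector [0, 1], vector [F9 2 0, F9 1 2]]"
definition mat_y :: "f9^2^2" where "mat_y = vector [vector [1, 1], vector [0, 1]]"
definition mat_h :: "f9^2^2" where "mat_h = vector [vector [0, 1], vector [F9 1 1, 1]]"

lemma mat_invertible: "invertible mat_x" "invertible mat_y" "invertible mat_h"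
  by (auto simp: invertible_det_nz det_2 mat_x_def mat_y_def mat_h_def times_f9_def zero_f9_def one_f9_def minus_f9_def)

lemma mat_tabs:
  "tab 12 (theta mat_x) = tabs12 ! 3" "tab 12 (theta mat_y) = tabs12 ! 4" "tab 12 (theta mat_h) = tabs12 ! 6"
proof -
  note simps = set_1_10 tabs12_def vec_eq_iff forall_2 matrix_vector_mult_def sum_2 pt_def
    mat_x_def mat_y_def mat_h_def times_f9_def zero_f9_def one_f9_def plus_f9_def
  show "tab 12 (theta mat_x) = tabs12 ! 3"
    by (rule tab12_theta[OF mat_invertible(1), where ks =
        "[F9 1 0, F9 2 0, F9 2 2, F9 1 2, F9 0 2, F9 2 1, F9 1 1, F9 2 0, F9 0 1, F9 1 0]"])
      (simp_all add: simps)
  show "tab 12 (theta mat_y) = tabs12 ! 4"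
    by (rule tab12_theta[OF mat_invertible(2), where ks = "replicate 10 1"])
      (simp_all add: simps)
  show "tab 12 (theta mat_h) = tabs12 ! 6"
    by (rule tab12_theta[OF mat_invertible(3), where ks =
        "[F9 2 2, F9 1 1, F9 0 2, F9 1 0, F9 2 1, F9 2 0, F9 0 1, F9 1 1, F9 1 2, F9 1 0]"])
      (simp_all add: simps)
qed

section \<open>The Mathieu group of degree 10\<close>

definition m12a :: "nat \<Rightarrow> nat" where
  "m12a = cycle_of_list [1, 2, 3, 4, 5, 6, 7, 8, 9, 10, 11]"
definition m12b :: "nat \<Rightarrow> nat" where
  "m12b = cycle_of_list [3, 7, 11, 8] \<circ> cycle_of_list [4, 10, 5, 6]"
definition m12c :: "nat \<Rightarrow> nat" where
  "m12c = cycle_of_list [1, 12] \<circ> cycle_of_list [2, 11] \<circ> cycle_of_list [3, 6]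
        \<circ> cycle_of_list [4, 8] \<circ> cycle_of_list [5, 9] \<circ> cycle_of_list [7, 10]"
text \<open>The element \<open>m = a b a\<^sup>4\<close> of \<open>M\<^sub>1\<^sub>1\<close> fixes 11.\<close>

definition m10m :: "nat \<Rightarrow> nat" where
  "m10m = word_eval (sym_group 12) [m12a, m12b] [0,1,0,0,0,0]"

text \<open>The permutations whose tables are listed in \<open>tabs12\<close>.\<close>

definition gens12 :: "(nat \<Rightarrow> nat) list" where
  "gens12 = [m12a, m12b, m12c, rho a6x, rho a6y, m10m, theta mat_h]"

lemma cycle_permutes12: "set cs \<subseteq> {1..12} \<Longrightarrow> cycle cs \<Longrightarrow> cycle_of_list cs permutes {1..12}"
  using cycle_permutes permutes_subset by blast

lemma m12_permutes: "m12a permutes {1..12}" "m12b permutes {1..12}" "m12c permutes {1..12}"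
  unfolding m12a_def m12b_def m12c_def
  by (intro permutes_compose cycle_permutes12; simp)+

lemma tab12_points:
  "tab 12 p = [p 1, p 2, p 3, p 4, p 5, p 6, p 7, p 8, p 9, p 10, p 11, p 12]"
proof -
  have "[1..<Suc 12] = [1,2,3,4,5,6,7,8,9,10,11,12]" by code_simp
  then show ?thesis unfolding tab_def by (simp only: list.map)
qed

lemma m12_tabs: "tab 12 m12a = tabs12 ! 0" "tab 12 m12b = tabs12 ! 1" "tab 12 m12c = tabs12 ! 2"
  unfolding tab12_points m12a_def m12b_def m12c_def
  by (simp_all add: tabs12_def transpose_apply_other)

lemma gens12_permutes: "p \<in> set gens12 \<Longrightarrow> p permutes {1..12}"
proof -
  have "m10m permutes {1..12}"
    unfolding m10m_def using m12_permutes by (intro word_eval_permutes) auto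
  moreover have "rho a permutes {1..12}" if "a \<in> carrier A6" for a
    using rho.hom_closed[OF that] by (simp add: sym_group_carrier)
  moreover have "theta mat_h permutes {1..12}"
    using theta.hom_closed[of mat_h] mat_invertible by (simp add: sym_group_carrier GL2_simps)
  ultimately show "p \<in> set gens12 \<Longrightarrow> p permutes {1..12}"
    using m12_permutes a6_closed by (auto simp: gens12_def)
qed

lemma gens12_carrier: "set gens12 \<subseteq> carrier (sym_group 12)"
  using gens12_permutes by (auto simp: sym_group_carrier)

lemma length_gens12: "length gens12 = 7"
  by (simp add: gens12_def)

lemma gens12_tabs: "map (tab 12) gens12 = tabs12"
proof -
  have "tab 12 m10m = tword 12 (map (tab 12) [m12a, m12b]) [0,1,0,0,0,0]"
    unfolding m10m_def using m12_permutes by (intro tab_word_eval) auto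
  also have "\<dots> = tword 12 [tabs12 ! 0, tabs12 ! 1] [0,1,0,0,0,0]"
    by (simp add: m12_tabs)
  also have "\<dots> = tabs12 ! 5" by code_simp
  finally show ?thesis
    by (simp add: gens12_def m12_tabs mat_tabs tab_rho_gens) (simp add: tabs12_def)
qed

abbreviation W :: "nat list \<Rightarrow> nat \<Rightarrow> nat" where
  "W \<equiv> word_eval (sym_group 12) gens12"

lemma W_eq_iff:
  assumes "set u \<subseteq> {..<7}" "set v \<subseteq> {..<7}"
  shows "W u = W v \<longleftrightarrow> tword 12 tabs12 u = tword 12 tabs12 v"
  using word_eval_eq_iff[of gens12 12 u v] gens12_permutes assms by (simp add: length_gens12 gens12_tabs)

lemma W_closed: "set u \<subseteq> {..<7} \<Longrightarrow> W u \<in> carrier (sym_group 12)"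
  using gens12_carrier length_gens12 by (intro word_eval_subgroup S12.subgroup_self) auto

lemma tab_W: "set u \<subseteq> {..<7} \<Longrightarrow> tab 12 (W u) = tword 12 tabs12 u"
  using tab_word_eval[of gens12 12 u] gens12_permutes by (simp add: length_gens12 gens12_tabs)

lemma W_apply: "set u \<subseteq> {..<7} \<Longrightarrow> i \<in> {1..12} \<Longrightarrow> W u i = tword 12 tabs12 u ! (i - 1)"
  using tab_nth[of i 12 "W u"] tab_W[of u] by simp

lemma W_append:
  assumes "set u \<subseteq> {..<7}" "set v \<subseteq> {..<7}"
  shows "W (u @ v) = W u \<circ> W v"
  using assms(1)
proof (induction u)
  case Nil
  show ?case by (simp add: word_eval_simps sym_group_one)
next
  case (Cons k u)
  then show ?case by (simp only: append_Cons word_eval_simps sym_group_mult) (simp add: comp_assoc)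
qed

lemma W_Cons: "W (k # u) = gens12 ! k \<circ> W u"
  by (simp only: word_eval_simps sym_group_mult)

lemma W_Nil: "W [] = id"
  by (simp only: word_eval_simps sym_group_one)

lemma W_gen: "k < 7 \<Longrightarrow> W [k] = gens12 ! k"
  by (simp only: W_Cons W_Nil comp_id)

lemma W_relation:
  assumes "(u, v) \<in> set relations12"
  shows "W u = W v"
proof -
  have "list_all (\<lambda>(u,v). set u \<subseteq> {..<7} \<and> set v \<subseteq> {..<7}) relations12"
    by code_simp
  then show ?thesis
    using assms relations12_check by (subst W_eq_iff) (auto simp: list_all_iff)
qed

text \<open>The set \<open>U = T K\<close> is mapped into itself by left multiplication with the generators. As it is finite, it is
mapped onto itself, so it is closed under left multiplication with inverses of generators as well and
contains the whole generated subgroup.\<close>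

lemma generate_subset_cosets:
  fixes G (structure)
  assumes G: "group G" "finite (carrier G)" and K: "subgroup K G" and S: "S \<subseteq> carrier G"
    and T: "T \<subseteq> carrier G" "\<one>\<^bsub>G\<^esub> \<in> T"
    and step: "\<And>s t. s \<in> S \<Longrightarrow> t \<in> T \<Longrightarrow> \<exists>t'\<in>T. \<exists>k\<in>K. s \<otimes>\<^bsub>G\<^esub> t = t' \<otimes>\<^bsub>G\<^esub> k"
    and g: "g \<in> generate G S"
  shows "\<exists>t\<in>T. \<exists>k\<in>K. g = t \<otimes>\<^bsub>G\<^esub> k"
proof -
  interpret group G by fact
  interpret K: subgroup K G by fact
  define U where "U = {t \<otimes> k |t k. t \<in> T \<and> k \<in> K}"
  have U: "U \<subseteq> carrier G" using T by (auto simp: U_def)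
  have finU: "finite U" using U G(2) by (rule finite_subset)
  have s1: "(\<lambda>u. s \<otimes> u) ` U = U" if s: "s \<in> S" for s
  proof (rule endo_inj_surj[OF finU])
    show "inj_on (\<lambda>u. s \<otimes> u) U" using s S U by (intro inj_onI) (simp add: subset_iff)
    show "(\<lambda>u. s \<otimes> u) ` U \<subseteq> U"
    proof
      fix x assume "x \<in> (\<lambda>u. s \<otimes> u) ` U"
      then obtain t k where tk: "t \<in> T" "k \<in> K" "x = s \<otimes> (t \<otimes> k)" by (auto simp: U_def)
      obtain t' k' where t': "t' \<in> T" "k' \<in> K" "s \<otimes> t = t' \<otimes> k'" using step[OF s tk(1)] by blast
      have "x = s \<otimes> t \<otimes> k" using tk s S T by (simp add: m_assoc subset_iff)
      also have "\<dots> = t' \<otimes> (k' \<otimes> k)" unfolding t'(3) using t' tk T by (simp add: m_assoc subset_iff)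
      finally show "x \<in> U" using t' tk by (auto simp: U_def)
    qed
  qed
  have "h \<otimes> u \<in> U" if "h \<in> generate G S" "u \<in> U" for h u
    using that
  proof (induction arbitrary: u)
    case (inv h)
    then obtain v where v: "v \<in> U" "u = h \<otimes> v" using s1[OF inv(1)] by blast
    then have "inv h \<otimes> u = v" using inv S U by (simp add: m_assoc[symmetric] subset_iff)
    then show ?case using v by simp
  next
    case (eng h1 h2)
    have "h1 \<otimes> h2 \<otimes> u = h1 \<otimes> (h2 \<otimes> u)"
      using generate_in_carrier[OF S] eng.hyps eng.prems U by (simp add: m_assoc subset_iff)
    then show ?case using eng by simp
  qed (use U s1 in auto)
  moreover have "\<one> \<in> U"
  proof -
    have "\<one> = \<one> \<otimes> \<one>" by simp
    then show ?thesis unfolding U_def using T(2) K.one_closed by blast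
  qed
  ultimately have "g \<otimes> \<one> \<in> U" using g by blast
  then have "g \<in> U" using generate_in_carrier[OF S g] by simp
  then show ?thesis by (auto simp: U_def)
qed

abbreviation rho_image :: "(nat \<Rightarrow> nat) set" where "rho_image \<equiv> rho ` carrier A6"

definition M10_gens :: "(nat \<Rightarrow> nat) set" where "M10_gens = {rho a6x, rho a6y, m10m}"

definition M11_set :: "(nat \<Rightarrow> nat) set" where "M11_set = generate (sym_group 12) {m12a, m12b}"
definition M10_set :: "(nat \<Rightarrow> nat) set" where "M10_set = generate (sym_group 12) M10_gens"

lemma finite_S12: "finite (carrier (sym_group 12))"
  using sym_group_card_carrier[of 12] by (intro card_ge_0_finite) simp

lemma gens12_nth:
  "gens12 ! 0 = m12a" "gens12 ! 1 = m12b" "gens12 ! 2 = m12c" "gens12 ! 3 = rho a6x" "gens12 ! 4 = rho a6y"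
  "gens12 ! 5 = m10m" "gens12 ! 6 = theta mat_h"
  by (simp_all add: gens12_def)

lemma gens_in_S12: "m12a \<in> carrier (sym_group 12)" "m12b \<in> carrier (sym_group 12)"
  "m12c \<in> carrier (sym_group 12)" "rho a6x \<in> carrier (sym_group 12)"
  "rho a6y \<in> carrier (sym_group 12)" "m10m \<in> carrier (sym_group 12)" "theta mat_h \<in> carrier (sym_group 12)"
  using gens12_carrier by (auto simp: gens12_def)

lemma M11_subgroup: "subgroup M11_set (sym_group 12)"
  unfolding M11_set_def using gens_in_S12 by (intro S12.generate_is_subgroup) auto

lemma M10_subgroup: "subgroup M10_set (sym_group 12)"
  unfolding M10_set_def M10_gens_def using gens_in_S12 by (intro S12.generate_is_subgroup) auto

lemma W_in_subgroup:
  assumes "subgroup J (sym_group 12)" "\<And>k. k \<in> set u \<Longrightarrow> gens12 ! k \<in> J"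
  shows "W u \<in> J"
  using assms(2)
proof (induction u)
  case Nil
  then show ?case using subgroup.one_closed[OF assms(1)] by (simp only: word_eval_simps)
next
  case (Cons k u)
  then show ?case using subgroup.m_closed[OF assms(1)] by (simp only: word_eval_simps) simp
qed

lemma W_in_M10:
  assumes "set u \<subseteq> {3,4,5}" shows "W u \<in> M10_set"
proof (rule W_in_subgroup[OF M10_subgroup])
  fix k assume "k \<in> set u"
  then have "gens12 ! k \<in> M10_gens" using assms by (auto simp: gens12_nth M10_gens_def)
  then show "gens12 ! k \<in> M10_set" unfolding M10_set_def by (rule generate.incl)
qed

lemma W_in_M11:
  assumes "set u \<subseteq> {0,1}" shows "W u \<in> M11_set"
proof (rule W_in_subgroup[OF M11_subgroup])
  fix k assume "k \<in> set u"
  then have "gens12 ! k \<in> {m12a, m12b}" using assms by (auto simp: gens12_nth)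
  then show "gens12 ! k \<in> M11_set" unfolding M11_set_def by (rule generate.incl)
qed

lemma stabilizer_subgroup: "subgroup {p \<in> carrier (sym_group 12). p i = i} (sym_group 12)"
proof (rule S12.subgroupI)
  fix p assume "p \<in> {p \<in> carrier (sym_group 12). p i = i}"
  then have p: "p \<in> carrier (sym_group 12)" "p i = i" by auto
  have "inv' p i = i" using p by (metis permutes_inverses(2) sym_group_carrier)
  then show "inv\<^bsub>sym_group 12\<^esub> p \<in> {p \<in> carrier (sym_group 12). p i = i}"
    using p S12.inv_closed by simp
next
  have "id \<in> {p \<in> carrier (sym_group 12). p i = i}"
    using S12.one_closed by (simp add: sym_group_one)
  then show "{p \<in> carrier (sym_group 12). p i = i} \<noteq> {}" by blast
next
  fix p q assume "p \<in> {p \<in> carrier (sym_group 12). p i = i}" "q \<in> {p \<in> carrier (sym_group 12). p i = i}"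
  then show "p \<otimes>\<^bsub>sym_group 12\<^esub> q \<in> {p \<in> carrier (sym_group 12). p i = i}"
    using S12.m_closed[of p q] by (simp add: sym_group_mult)
qed auto

lemma rho_fixes: "rho a 11 = 11" "rho a 12 = 12"
  by (simp_all add: rho_def relabel_def)

lemma m10m_apply: "m10m i = (if i \<in> {1..12} then tabs12 ! 5 ! (i - 1) else i)"
proof (cases "i \<in> {1..12}")
  case True
  have "tab 12 m10m = tabs12 ! 5"
    using gens12_tabs gens12_nth length_gens12 nth_map[of 5 gens12 "tab 12"] by simp
  then show ?thesis using tab_nth[OF True, of m10m] True by simp
next
  case False
  then show ?thesis using gens_in_S12(6) by (auto simp: sym_group_carrier dest: permutes_not_in)
qed

lemma M10_set_fixes: assumes "p \<in> M10_set" shows "p 11 = 11" "p 12 = 12"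
proof -
  have "M10_gens \<subseteq> {p \<in> carrier (sym_group 12). p i = i}" if "i \<in> {11, 12}" for i
    using gens_in_S12 that by (auto simp: M10_gens_def rho_fixes m10m_apply tabs12_def)
  then have "M10_set \<subseteq> {p \<in> carrier (sym_group 12). p i = i}" if "i \<in> {11, 12}" for i
    unfolding M10_set_def using that by (intro S12.generate_subgroup_incl stabilizer_subgroup) auto
  then show "p 11 = 11" "p 12 = 12" using assms by auto
qed

lemma M10_in_M11: "M10_set \<subseteq> M11_set"
proof -
  have "W [3] \<in> M11_set" "W [4] \<in> M11_set" "W [5] \<in> M11_set"
    using W_relation[of "[3]" "[1,1,0,0,0]"] W_relation[of "[4]" "[0,1,0,0,1,0,0]"]
      W_relation[of "[5]" "[0,1,0,0,0,0]"] W_in_M11[of "[1,1,0,0,0]"] W_in_M11[of "[0,1,0,0,1,0,0]"]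
      W_in_M11[of "[0,1,0,0,0,0]"]
    by (simp_all add: relations12_def)
  then have "M10_gens \<subseteq> M11_set" by (simp add: W_gen gens12_nth M10_gens_def)
  then show ?thesis unfolding M10_set_def by (intro S12.generate_subgroup_incl M11_subgroup)
qed

lemma rot_letters: "set (replicate i 0) \<subseteq> {..<(7::nat)}" by auto

text \<open>Left multiplication by \<open>a\<close> permutes the powers of \<open>a\<close> below 11 cyclically, since \<open>a\<^sup>1\<^sup>1 = 1\<close>.\<close>

lemma rot_step: "i < 11 \<Longrightarrow> \<exists>j<11. W (0 # replicate i 0 @ u) = W (replicate j 0 @ u)" if "set u \<subseteq> {..<7}"
proof (cases "i = 10")
  case True
  have "W (replicate 11 0 @ u) = W u"
    using W_append[OF rot_letters that, of 11] W_relation[of "replicate 11 0" "[]"]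
    by (simp only: W_Nil id_comp) (simp add: relations12_def W_Nil)
  then have "W (0 # replicate i 0 @ u) = W (replicate 0 0 @ u)"
    unfolding True by (simp add: numeral_eq_Suc)
  moreover have "0 < (11::nat)" by simp
  ultimately show ?thesis by blast
next
  case False
  moreover assume "i < 11"
  ultimately show ?thesis by (intro exI[of _ "Suc i"]) auto
qed

text \<open>The representatives \<open>a\<^sup>i\<close> are permuted by \<open>a\<close>; for \<open>b\<close> the coset table applies.\<close>

lemma M11_cosets:
  assumes "g \<in> M11_set"
  shows "\<exists>i<11. \<exists>k\<in>M10_set. g = W (replicate i 0) \<circ> k"
proof -
  let ?T = "(\<lambda>i. W (replicate i 0)) ` {..<11}"
  have "\<exists>t\<in>?T. \<exists>k\<in>M10_set. g = t \<otimes>\<^bsub>sym_group 12\<^esub> k"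
  proof (rule generate_subset_cosets[OF sym_group_is_group finite_S12 M10_subgroup])
    show "g \<in> generate (sym_group 12) {m12a, m12b}" using assms by (simp add: M11_set_def)
    show "{m12a, m12b} \<subseteq> carrier (sym_group 12)" using gens_in_S12 by auto
    show "?T \<subseteq> carrier (sym_group 12)" using W_closed[OF rot_letters] by auto
    show "\<one>\<^bsub>sym_group 12\<^esub> \<in> ?T" using W_Nil by (force simp: sym_group_one image_iff intro!: bexI[of _ 0])
    fix s t assume "s \<in> {m12a, m12b}" "t \<in> ?T"
    then obtain i where i: "i < 11" "t = W (replicate i 0)" by auto
    show "\<exists>t'\<in>?T. \<exists>k\<in>M10_set. s \<otimes>\<^bsub>sym_group 12\<^esub> t = t' \<otimes>\<^bsub>sym_group 12\<^esub> k"
    proof (cases "s = m12a")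
      case True
      then have "s \<circ> t = W (0 # replicate i 0 @ [])" using i by (simp only: W_Cons gens12_nth append_Nil2)
      then obtain j where "j < 11" "s \<circ> t = W (replicate j 0) \<circ> id"
        using rot_step[OF _ i(1), of "[]"] by (simp only: append_Nil2 comp_id) auto
      moreover have "id \<in> M10_set" using subgroup.one_closed[OF M10_subgroup] by (simp only: sym_group_one)
      ultimately show ?thesis unfolding sym_group_mult by blast
    next
      case False
      then have s: "s \<circ> t = W (1 # replicate i 0)"
        using i \<open>s \<in> {m12a, m12b}\<close> by (simp only: W_Cons gens12_nth) auto
      have "list_all (\<lambda>i. \<exists>(i',j,k)\<in>set M11_coset_moves. i' = i \<and> j < 11 \<and> set k \<subseteq> {3,4,5}) [0..<11]"
        by code_simp
      then obtain j k where jk: "(i,j,k) \<in> set M11_coset_moves" "j < 11" "set k \<subseteq> {3,4,5}"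
        using i(1) by (force simp: list_all_iff)
      have k7: "set k \<subseteq> {..<7}" using jk(3) by auto
      have "tword 12 tabs12 (1 # replicate i 0) = tword 12 tabs12 (replicate j 0 @ k)"
        using M11_coset_moves_check jk(1) by (auto simp: list_all_iff)
      then have "s \<circ> t = W (replicate j 0 @ k)"
        unfolding s using k7 by (subst W_eq_iff) auto
      also have "\<dots> = W (replicate j 0) \<circ> W k" by (rule W_append[OF rot_letters k7])
      finally show ?thesis unfolding sym_group_mult using jk(2) W_in_M10[OF jk(3)] by blast
    qed
  qed
  then show ?thesis unfolding sym_group_mult by blast
qed

text \<open>Among the cosets \<open>a\<^sup>i M\<^sub>1\<^sub>0\<close> only the one with \<open>i = 0\<close> fixes 11, as \<open>M\<^sub>1\<^sub>0\<close> itself does.\<close>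

lemma M11_stabilizer: assumes "g \<in> M11_set" "g 11 = 11" shows "g \<in> M10_set"
proof -
  obtain i k where i: "i < 11" "k \<in> M10_set" "g = W (replicate i 0) \<circ> k" using M11_cosets[OF assms(1)] by blast
  have "W (replicate i 0) 11 = 11" using assms(2) i(3) M10_set_fixes[OF i(2)] by simp
  then have "tword 12 tabs12 (replicate i 0) ! 10 = 11" using W_apply[OF rot_letters, of 11 i] by simp
  then have "i = 0" using M11_points_check i(1) by (force simp: list_all_iff)
  then show ?thesis using i by (simp add: W_Nil)
qed

lemma M11_fixes_12: "g \<in> M11_set \<Longrightarrow> g 12 = 12"
proof -
  have "{m12a, m12b} \<subseteq> {p \<in> carrier (sym_group 12). p 12 = 12}"
    using gens_in_S12 by (auto simp: m12a_def m12b_def transpose_apply_other)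
  then have "M11_set \<subseteq> {p \<in> carrier (sym_group 12). p 12 = 12}"
    unfolding M11_set_def by (intro S12.generate_subgroup_incl stabilizer_subgroup) auto
  then show "g \<in> M11_set \<Longrightarrow> g 12 = 12" by auto
qed

lemma M12_carrier: "carrier M12 = generate (sym_group 12) {m12a, m12b, m12c}"
  by (simp add: M12_def m12a_def m12b_def m12c_def)

lemma M12_cosets:
  assumes "g \<in> carrier M12"
  shows "g \<in> M11_set \<or> (\<exists>i<11. \<exists>k\<in>M11_set. g = W (replicate i 0 @ [2]) \<circ> k)"
proof -
  let ?T = "insert id ((\<lambda>i. W (replicate i 0 @ [2])) ` {..<11})"
  have idM: "id \<in> M11_set" using subgroup.one_closed[OF M11_subgroup] by (simp only: sym_group_one)
  have letters: "set (replicate i 0 @ [2]) \<subseteq> {..<(7::nat)}" for i by auto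
  have coset_word: "W (replicate j 0 @ 2 # replicate l 0 @ k) = W (replicate j 0 @ [2]) \<circ> W (replicate l 0 @ k)
      \<and> W (replicate l 0 @ k) \<in> M11_set" if k: "set k \<subseteq> {3,4,5}" for j l k
  proof -
    have k7: "set k \<subseteq> {..<7}" using k by auto
    have "W (replicate l 0 @ k) = W (replicate l 0) \<circ> W k" by (rule W_append[OF rot_letters k7])
    moreover have "W (replicate l 0) \<in> M11_set" by (rule W_in_M11) auto
    ultimately have "W (replicate l 0 @ k) \<in> M11_set"
      using subgroup.m_closed[OF M11_subgroup] W_in_M10[OF k] M10_in_M11 by (simp add: sym_group_mult subset_iff)
    moreover have "W ((replicate j 0 @ [2]) @ (replicate l 0 @ k)) = W (replicate j 0 @ [2]) \<circ> W (replicate l 0 @ k)"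
      using k7 by (intro W_append) auto
    ultimately show ?thesis by simp
  qed
  have "\<exists>t\<in>?T. \<exists>k\<in>M11_set. g = t \<otimes>\<^bsub>sym_group 12\<^esub> k"
  proof (rule generate_subset_cosets[OF sym_group_is_group finite_S12 M11_subgroup])
    show "g \<in> generate (sym_group 12) {m12a, m12b, m12c}" using assms by (simp add: M12_carrier)
    show "{m12a, m12b, m12c} \<subseteq> carrier (sym_group 12)" using gens_in_S12 by auto
    show "?T \<subseteq> carrier (sym_group 12)" using W_closed[OF letters] S12.one_closed by (auto simp: sym_group_one)
    show "\<one>\<^bsub>sym_group 12\<^esub> \<in> ?T" by (simp add: sym_group_one)
    fix s t assume s: "s \<in> {m12a, m12b, m12c}" and t: "t \<in> ?T"
    have M11: "s \<in> M11_set" if "s \<noteq> m12c"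
      using s that unfolding M11_set_def by (auto intro: generate.incl)
    from t consider "t = id" | i where "i < 11" "t = W (replicate i 0 @ [2])" by auto
    then show "\<exists>t'\<in>?T. \<exists>k\<in>M11_set. s \<otimes>\<^bsub>sym_group 12\<^esub> t = t' \<otimes>\<^bsub>sym_group 12\<^esub> k"
    proof cases
      case 1
      show ?thesis
      proof (cases "s = m12c")
        case True
        then have "s = W (replicate 0 0 @ [2])" by (simp add: W_gen gens12_nth)
        then show ?thesis using 1 idM unfolding sym_group_mult by (metis comp_id imageI insertI2 lessThan_iff zero_less_numeral)
      next
        case False
        then show ?thesis using 1 M11 unfolding sym_group_mult by (metis comp_id id_comp insertI1)
      qed
    next
      case (2 i)
      consider "s = m12a" | "s = m12b" | "s = m12c" using s by blast
      then show ?thesis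
      proof cases
        case 1
        then have "s \<circ> t = W (0 # replicate i 0 @ [2])" using 2 by (simp only: W_Cons gens12_nth)
        moreover obtain j where "j < 11" "W (0 # replicate i 0 @ [2]) = W (replicate j 0 @ [2])"
          using rot_step[OF _ 2(1), of "[2]"] by auto
        ultimately show ?thesis using idM unfolding sym_group_mult by (metis comp_id imageI insertI2 lessThan_iff)
      next
        case s: 2
        then have eq: "s \<circ> t = W (1 # replicate i 0 @ [2])" using 2 by (simp only: W_Cons gens12_nth)
        have "list_all (\<lambda>i. \<exists>(i',j,l,k)\<in>set M12_coset_moves_b. i' = i \<and> j < 11 \<and> set k \<subseteq> {3,4,5}) [0..<11]"
          by code_simp
        then obtain j l k where jk: "(i,j,l,k) \<in> set M12_coset_moves_b" "j < 11" "set k \<subseteq> {3,4,5}"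
          using 2(1) by (force simp: list_all_iff)
        have "tword 12 tabs12 (1 # replicate i 0 @ [2]) = tword 12 tabs12 (replicate j 0 @ 2 # replicate l 0 @ k)"
          using M12_coset_moves_b_check jk(1) by (auto simp: list_all_iff)
        then have "s \<circ> t = W (replicate j 0 @ 2 # replicate l 0 @ k)"
          unfolding eq using jk(3) by (subst W_eq_iff) auto
        then have "s \<circ> t = W (replicate j 0 @ [2]) \<circ> W (replicate l 0 @ k)" "W (replicate l 0 @ k) \<in> M11_set"
          using coset_word[OF jk(3), of j l] by simp_all
        moreover have "W (replicate j 0 @ [2]) \<in> ?T" using jk(2) by simp
        ultimately show ?thesis unfolding sym_group_mult by metis
      next
        case s: 3
        then have eq: "s \<circ> t = W (2 # replicate i 0 @ [2])" using 2 by (simp only: W_Cons gens12_nth)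
        show ?thesis
        proof (cases "i = 0")
          case True
          then have "s \<circ> t = id \<circ> id" using eq W_relation[of "[2,2]" "[]"] by (simp add: relations12_def W_Nil)
          then show ?thesis using idM unfolding sym_group_mult by blast
        next
          case False
          have "list_all (\<lambda>i. \<exists>(i',j,l,k)\<in>set M12_coset_moves_c. i' = i \<and> j < 11 \<and> set k \<subseteq> {3,4,5}) [1..<11]"
            by code_simp
          then obtain j l k where jk: "(i,j,l,k) \<in> set M12_coset_moves_c" "j < 11" "set k \<subseteq> {3,4,5}"
            using 2(1) False by (force simp: list_all_iff)
          have "tword 12 tabs12 (2 # replicate i 0 @ [2]) = tword 12 tabs12 (replicate j 0 @ 2 # replicate l 0 @ k)"
            using M12_coset_moves_c_check jk(1) by (auto simp: list_all_iff)
          then have "s \<circ> t = W (replicate j 0 @ 2 # replicate l 0 @ k)"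
            unfolding eq using jk(3) by (subst W_eq_iff) auto
          then have "s \<circ> t = W (replicate j 0 @ [2]) \<circ> W (replicate l 0 @ k)" "W (replicate l 0 @ k) \<in> M11_set"
          using coset_word[OF jk(3), of j l] by simp_all
        moreover have "W (replicate j 0 @ [2]) \<in> ?T" using jk(2) by simp
        ultimately show ?thesis unfolding sym_group_mult by metis
        qed
      qed
    qed
  qed
  then show ?thesis unfolding sym_group_mult by auto
qed

text \<open>An element of \<open>a\<^sup>i c M\<^sub>1\<^sub>1\<close> sends 12 to \<open>a\<^sup>i 1\<close>, which is not 12 because \<open>a\<^sup>i\<close> fixes 12.\<close>

lemma M12_stabilizer: assumes "g \<in> carrier M12" "g 12 = 12" shows "g \<in> M11_set"
proof (rule ccontr)
  assume "g \<notin> M11_set"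
  then obtain i k where i: "i < 11" "k \<in> M11_set" "g = W (replicate i 0 @ [2]) \<circ> k"
    using M12_cosets[OF assms(1)] by blast
  have "W (replicate i 0 @ [2]) = W (replicate i 0) \<circ> m12c"
    using W_append[OF rot_letters, of "[2]" i] by (simp add: W_gen gens12_nth)
  moreover have "m12c 12 = 1" by (simp add: m12c_def transpose_apply_other)
  ultimately have "W (replicate i 0) 1 = 12" using assms(2) i(3) M11_fixes_12[OF i(2)] by simp
  moreover have "W (replicate i 0) 12 = 12"
    by (rule M11_fixes_12, rule W_in_M11) auto
  moreover have "inj (W (replicate i 0))"
    using W_closed[OF rot_letters, of i] permutes_inj by (auto simp: sym_group_carrier)
  ultimately show False by (metis injD numeral_eq_one_iff semiring_norm(85))
qed

text \<open>The two-point stabilizer in \<open>M\<^sub>1\<^sub>2\<close> is generated by the action of \<open>A\<^sub>6\<close> and \<open>m\<close>.\<close>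

lemma M10_carrier: "carrier M10 = M10_set"
proof
  show "carrier M10 \<subseteq> M10_set"
    using M12_stabilizer M11_stabilizer by (auto simp: M10_def)
  have "M11_set \<subseteq> carrier M12"
    unfolding M11_set_def M12_carrier by (rule S12.mono_generate) auto
  then show "M10_set \<subseteq> carrier M10"
    using M10_in_M11 M10_set_fixes by (auto simp: M10_def)
qed

lemma M10_eq: "M10 = (sym_group 12)\<lparr>carrier := M10_set\<rparr>"
  using M10_carrier by (simp add: M10_def M12_def)

lemma group_M10: "group M10"
  unfolding M10_eq by (rule S12.subgroup_imp_group[OF M10_subgroup])

section \<open>The three groups that contain the alternating group with index 2\<close>

lemma rho_fixed_points:
  assumes "i \<in> {1..10}"
  shows "\<exists>a\<in>carrier A6. \<forall>j\<in>{1..10}. rho a j = j \<longleftrightarrow> j = i"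
proof -
  let ?w = "fixing_words ! (i - 1)"
  have letters: "list_all (\<lambda>w. set w \<subseteq> {3,4}) fixing_words" and len: "length fixing_words = 10" by code_simp+
  have "?w \<in> set fixing_words" using assms len by (intro nth_mem) auto
  then have w: "set ?w \<subseteq> {3,4}" using letters unfolding list_all_iff by blast
  then have w7: "set ?w \<subseteq> {..<7}" by auto
  have J: "subgroup rho_image (sym_group 12)" by (rule rho.img_is_subgroup)
  have "W ?w \<in> rho_image"
    using w a6_closed by (intro W_in_subgroup[OF J]) (auto simp: gens12_nth)
  then obtain a where a: "a \<in> carrier A6" "W ?w = rho a" by auto
  have "rho a j = j \<longleftrightarrow> j = i" if "j \<in> {1..10}" for j
    using fixing_words_check assms that W_apply[OF w7, of j] unfolding a(2)[symmetric]
    by (auto simp: list_all_iff)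
  then show ?thesis using a(1) by blast
qed

text \<open>A permutation that commutes with the action of \<open>A\<^sub>6\<close> preserves the set of fixed points of each element;
some elements have just one, and each of the ten points occurs. Hence \<open>A\<^sub>6\<close> has trivial centralizer
in \<open>PGL(2,9)\<close> and in \<open>M\<^sub>1\<^sub>0\<close>.\<close>

lemma rho_centralizer:
  assumes q: "q permutes {1..10}" and comm: "\<And>a. a \<in> carrier A6 \<Longrightarrow> q \<circ> rho a = rho a \<circ> q"
  shows "q = id"
proof
  fix i show "q i = id i"
  proof (cases "i \<in> {1..10}")
    case True
    then obtain a where a: "a \<in> carrier A6" "\<forall>j\<in>{1..10}. rho a j = j \<longleftrightarrow> j = i" using rho_fixed_points by blast
    have "q i \<in> {1..10}" using True by (simp only: permutes_in_image[OF q])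
    moreover have "rho a (q i) = q i" using comm[OF a(1)] a True by (metis comp_apply)
    ultimately show ?thesis using a(2) by simp
  next
    case False then show ?thesis using q by (simp add: permutes_not_in)
  qed
qed

lemma small_order_hom:
  assumes h: "group_hom G H h" and g: "g \<in> carrier G" and k: "\<exists>k\<in>{4,5,6::nat}. g [^]\<^bsub>G\<^esub> k = \<one>\<^bsub>G\<^esub>"
  shows "\<exists>k\<in>{4,5,6::nat}. h g [^]\<^bsub>H\<^esub> k = \<one>\<^bsub>H\<^esub>"
proof -
  interpret group_hom G H h by fact
  obtain n :: nat where n: "n \<in> {4,5,6}" "g [^]\<^bsub>G\<^esub> n = \<one>\<^bsub>G\<^esub>" using k by blast
  have "h g [^]\<^bsub>H\<^esub> n = h (g [^]\<^bsub>G\<^esub> n)" using hom_nat_pow[OF g] by simp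
  then have "h g [^]\<^bsub>H\<^esub> n = \<one>\<^bsub>H\<^esub>" unfolding n(2) by simp
  then show ?thesis using n(1) by blast
qed

lemma A6_small_order: "a \<in> carrier A6 \<Longrightarrow> \<exists>k\<in>{4,5,6::nat}. a [^]\<^bsub>A6\<^esub> k = \<one>\<^bsub>A6\<^esub>"
proof -
  assume a: "a \<in> carrier A6"
  have "a [^]\<^bsub>A6\<^esub> k = a [^]\<^bsub>sym_group 6\<^esub> k" for k :: nat
    by (induction k) (simp_all add: alt_group_mult alt_group_one sym_group_mult sym_group_one)
  then show ?thesis
    using S6_small_order[of a] a by (simp add: alt_group_carrier sym_group_carrier alt_group_one sym_group_one)
qed

lemma W_pow: "k < 7 \<Longrightarrow> gens12 ! k [^]\<^bsub>sym_group 12\<^esub> n = W (replicate n k)"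
proof (induction n)
  case 0
  show ?case by (simp add: word_eval_simps)
next
  case (Suc n)
  then have "gens12 ! k \<in> carrier (sym_group 12)"
    using gens12_carrier nth_mem length_gens12 by fastforce
  then show ?case using Suc by (simp only: S12.nat_pow_Suc2 replicate_Suc word_eval_simps)
qed

lemma not_relation12:
  assumes "w \<in> set nonrelations12"
  shows "W w \<noteq> \<one>\<^bsub>sym_group 12\<^esub>"
proof -
  have "list_all (\<lambda>w. set w \<subseteq> {..<7}) nonrelations12" by code_simp
  then have "set w \<subseteq> {..<7}" using assms unfolding list_all_iff by blast
  moreover have "tword 12 tabs12 w \<noteq> tword 12 tabs12 []"
    using nonrelations12_check assms unfolding list_all_iff nonrelations12_def by blast
  ultimately have "W w \<noteq> W []" by (subst W_eq_iff) simp_all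
  then show ?thesis unfolding word_eval_simps(1) .
qed

lemma xm_large_order: "k \<in> {4,5,6::nat} \<Longrightarrow> (rho a6x \<circ> m10m) [^]\<^bsub>sym_group 12\<^esub> k \<noteq> \<one>\<^bsub>sym_group 12\<^esub>"
proof -
  assume k: "k \<in> {4,5,6::nat}"
  let ?g = "rho a6x \<circ> m10m"
  have "?g = rho a6x \<otimes>\<^bsub>sym_group 12\<^esub> m10m" by (simp only: sym_group_mult)
  then have g: "?g \<in> carrier (sym_group 12)" using gens_in_S12 by simp
  have "?g [^]\<^bsub>sym_group 12\<^esub> n = W (concat (replicate n [3,5]))" for n
  proof (induction n)
    case 0 show ?case by (simp add: word_eval_simps)
  next
    case (Suc n)
    have "?g [^]\<^bsub>sym_group 12\<^esub> Suc n = ?g \<circ> W (concat (replicate n [3,5]))"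
      using Suc by (simp only: S12.nat_pow_Suc2[OF g] sym_group_mult)
    also have "\<dots> = W (3 # 5 # concat (replicate n [3,5]))"
      by (simp only: W_Cons gens12_nth comp_assoc)
    finally show ?case by (simp only: replicate_Suc concat.simps append_Cons append_Nil)
  qed
  moreover have "\<forall>k\<in>{4,5,6::nat}. concat (replicate k [3,5]) \<in> set nonrelations12" by code_simp
  ultimately show "?g [^]\<^bsub>sym_group 12\<^esub> k \<noteq> \<one>\<^bsub>sym_group 12\<^esub>"
    using not_relation12 k by metis
qed

lemma h_large_order: "k \<in> {2,4,5,6::nat} \<Longrightarrow> theta mat_h [^]\<^bsub>sym_group 12\<^esub> k \<noteq> \<one>\<^bsub>sym_group 12\<^esub>"
proof -
  assume k: "k \<in> {2,4,5,6}"
  have "\<forall>k\<in>{2,4,5,6::nat}. replicate k 6 \<in> set nonrelations12" by code_simp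
  then have "W (replicate k 6) \<noteq> \<one>\<^bsub>sym_group 12\<^esub>" using not_relation12 k by blast
  then show ?thesis using W_pow[of 6 k] gens12_nth(7) by simp
qed

lemma h_order: "theta mat_h [^]\<^bsub>sym_group 12\<^esub> (10::nat) = \<one>\<^bsub>sym_group 12\<^esub>"
proof -
  have "W (replicate 10 6) = W []" by (rule W_relation) (simp add: relations12_def)
  then show ?thesis using W_pow[of 6 10] gens12_nth by (simp only: word_eval_simps)
qed

lemma m_order: "m10m [^]\<^bsub>sym_group 12\<^esub> (4::nat) = \<one>\<^bsub>sym_group 12\<^esub>" "m10m [^]\<^bsub>sym_group 12\<^esub> (2::nat) \<noteq> \<one>\<^bsub>sym_group 12\<^esub>"
proof -
  have "W (replicate 4 5) = W []" by (rule W_relation) (simp add: relations12_def)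
  then show "m10m [^]\<^bsub>sym_group 12\<^esub> (4::nat) = \<one>\<^bsub>sym_group 12\<^esub>"
    using W_pow[of 5 4] gens12_nth by (simp only: word_eval_simps)
  show "m10m [^]\<^bsub>sym_group 12\<^esub> (2::nat) \<noteq> \<one>\<^bsub>sym_group 12\<^esub>"
  proof -
    have "replicate 2 5 \<in> set nonrelations12" by code_simp
    then have "W (replicate 2 5) \<noteq> \<one>\<^bsub>sym_group 12\<^esub>" by (rule not_relation12)
    then show ?thesis using W_pow[of 5 2] gens12_nth(6) by simp
  qed
qed

lemma rho_preimage_subgroup:
  assumes J: "subgroup J (sym_group 12)"
  shows "subgroup {a \<in> carrier A6. rho a \<in> J} A6"
proof (rule A6.subgroupI)
  have "\<one>\<^bsub>A6\<^esub> \<in> {a \<in> carrier A6. rho a \<in> J}" using subgroup.one_closed[OF J] rho.hom_one by simp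
  then show "{a \<in> carrier A6. rho a \<in> J} \<noteq> {}" by blast
  fix a assume a: "a \<in> {a \<in> carrier A6. rho a \<in> J}"
  then have "rho (inv\<^bsub>A6\<^esub> a) = inv\<^bsub>sym_group 12\<^esub> (rho a)" by (intro rho.hom_inv) simp
  then show "inv\<^bsub>A6\<^esub> a \<in> {a \<in> carrier A6. rho a \<in> J}"
    using a subgroup.m_inv_closed[OF J, of "rho a"] A6.inv_closed by (simp del: sym_group_inv_equality)
  fix b assume "b \<in> {a \<in> carrier A6. rho a \<in> J}"
  then show "a \<otimes>\<^bsub>A6\<^esub> b \<in> {a \<in> carrier A6. rho a \<in> J}"
    using a subgroup.m_closed[OF J] by simp
qed auto

lemma rho_image_subset:
  assumes J: "subgroup J (sym_group 12)" "rho a6x \<in> J" "rho a6y \<in> J"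
  shows "rho_image \<subseteq> J"
  using A6_generated[OF rho_preimage_subgroup[OF J(1)]] J(2,3) a6_closed by auto

lemma rho_image_in_theta: "rho_image \<subseteq> theta ` carrier GL2"
proof -
  have J: "subgroup (theta ` carrier GL2) (sym_group 12)" by (rule theta.img_is_subgroup)
  have gens: "rho a6x = theta mat_x" "rho a6y = theta mat_y"
  proof -
    have "theta A permutes {1..12}" if "invertible A" for A
      using theta.hom_closed[of A] that by (simp add: sym_group_carrier GL2_simps)
    then show "rho a6x = theta mat_x" "rho a6y = theta mat_y"
      using tab_eq_iff[of "rho a6x" 12 "theta mat_x"] tab_eq_iff[of "rho a6y" 12 "theta mat_y"]
        tab_rho_gens mat_tabs mat_invertible gens_in_S12 by (auto simp: sym_group_carrier)
  qed
  show ?thesis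
    using gens mat_invertible by (intro rho_image_subset[OF J]) (auto simp: GL2_simps)
qed

lemma card_rho_image: "card rho_image = 360"
  using card_image[OF rho_inj] card_A6 by simp

lemma h_notin_rho: "theta mat_h \<notin> rho_image"
proof
  assume "theta mat_h \<in> rho_image"
  then obtain a where a: "a \<in> carrier A6" "theta mat_h = rho a" by auto
  show False
    using small_order_hom[OF rho.group_hom_axioms a(1) A6_small_order[OF a(1)]] h_large_order a(2) by auto
qed

text \<open>If \<open>m\<close> were projective, it would equal the projective map \<open>X\<^sup>2 h Y X\<close>, with which it agrees on the frame
2, 4, 5; but these two permutations differ.\<close>

lemma m_notin_theta: "m10m \<notin> theta ` carrier GL2"
proof
  assume "m10m \<in> theta ` carrier GL2"
  then obtain A where A: "invertible A" "m10m = theta A" by (auto simp: GL2_simps)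
  have J: "subgroup (theta ` carrier GL2) (sym_group 12)" by (rule theta.img_is_subgroup)
  have "rho a6x \<in> theta ` carrier GL2" "rho a6y \<in> theta ` carrier GL2" "theta mat_h \<in> theta ` carrier GL2"
    using rho_image_in_theta a6_closed mat_invertible by (auto simp: GL2_simps)
  then have "W [3,3,6,4,3] \<in> theta ` carrier GL2"
    by (intro W_in_subgroup[OF J]) (auto simp: gens12_nth)
  then obtain B where B: "invertible B" "W [3,3,6,4,3] = theta B" by (auto simp: GL2_simps)
  have m: "m10m = W [5]" by (simp add: W_gen gens12_nth)
  have "theta A i = theta B i" if "i \<in> {2,4,5}" for i
    using that m_differs_check(2) W_apply[of "[5]" i] W_apply[of "[3,3,6,4,3]" i]
    unfolding A(2)[symmetric] B(2)[symmetric] m by auto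
  from theta_frame_eq[OF A(1) B(1) this] have "W [5] = W [3,3,6,4,3]"
    using A(2) B(2) m by simp
  then show False using m_differs_check(1) W_eq_iff[of "[5]" "[3,3,6,4,3]"] by simp
qed

text \<open>A proper subgroup has index at least 2.\<close>

lemma double_card:
  fixes G (structure)
  assumes G: "group G" and H: "subgroup H G" "H \<noteq> carrier G" and H0: "card H = n" "n > 0"
    and le: "card (carrier G) \<le> 2 * n" and fin: "finite (carrier G)"
  shows "card (carrier G) = 2 * n"
proof -
  interpret group G by fact
  have l: "card (carrier G) = card (rcosets H) * n"
    using lagrange[OF H(1)] H0 by (simp add: order_def)
  have "H \<subset> carrier G" using H subgroup.subset by blast
  then have "n < card (carrier G)" using psubset_card_mono[OF fin] H0 by blast
  then have "card (rcosets H) > 1" using l H0 by (metis less_one linorder_neqE_nat mult_0 mult_1 not_less_zero order_less_irrefl)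
  moreover have "card (rcosets H) \<le> 2" using l le H0(2) by simp
  ultimately show ?thesis using l by simp
qed

text \<open>The embedding of \<open>A\<^sub>6\<close> into \<open>PGL(2,9)\<close> identifies the two actions on the ten points.\<close>

definition iota_P :: "(nat \<Rightarrow> nat) \<Rightarrow> (f9^2^2) set" where
  "iota_P a = inv_into (carrier PGL29) theta_bar (rho a)"

interpretation P: group_hom PGL29 "sym_group 12" theta_bar
  by (intro group_hom.intro group_hom_axioms.intro group_PGL29 sym_group_is_group theta_bar_hom)

lemma iota_P:
  assumes "a \<in> carrier A6"
  shows "iota_P a \<in> carrier PGL29" "theta_bar (iota_P a) = rho a"
proof -
  have "rho a \<in> theta_bar ` carrier PGL29" using rho_image_in_theta assms theta_bar_image by auto
  then show "iota_P a \<in> carrier PGL29" "theta_bar (iota_P a) = rho a"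
    by (simp_all add: iota_P_def inv_into_into f_inv_into_f)
qed

lemma iota_P_mon: "iota_P \<in> mon A6 PGL29"
proof -
  have "iota_P (a \<otimes>\<^bsub>A6\<^esub> b) = iota_P a \<otimes>\<^bsub>PGL29\<^esub> iota_P b" if "a \<in> carrier A6" "b \<in> carrier A6" for a b
    using that iota_P by (intro inj_onD[OF theta_bar_inj]) auto
  moreover have "inj_on iota_P (carrier A6)"
    using rho_inj iota_P(2) by (metis inj_on_def)
  ultimately show ?thesis using iota_P by (auto simp: mon_def hom_def)
qed

lemma finite_PGL29: "finite (carrier PGL29)"
  using finite_subset[OF _ finite_S12, of "theta_bar ` carrier PGL29"] theta_bar_inj P.hom_closed
  by (meson finite_imageD image_subsetI)

lemma card_PGL29: "card (carrier PGL29) = 720"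
proof -
  have eq: "card (carrier PGL29) = card (theta ` carrier GL2)"
    using card_image[OF theta_bar_inj] theta_bar_image by simp
  have "card (iota_P ` carrier A6) = 360" using iota_P_mon card_A6 by (simp add: mon_def card_image)
  moreover have "subgroup (iota_P ` carrier A6) PGL29"
  proof -
    interpret group_hom A6 PGL29 iota_P
      using iota_P_mon by (intro group_hom.intro group_hom_axioms.intro group_PGL29 A6.is_group) (simp add: mon_def)
    show ?thesis by (rule img_is_subgroup)
  qed
  moreover have "iota_P ` carrier A6 \<noteq> carrier PGL29"
  proof
    assume "iota_P ` carrier A6 = carrier PGL29"
    then have "theta_bar ` iota_P ` carrier A6 = theta ` carrier GL2" using theta_bar_image by simp
    then have "rho_image = theta ` carrier GL2" unfolding image_image using iota_P(2) by simp
    then show False using h_notin_rho mat_invertible by (auto simp: GL2_simps)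
  qed
  ultimately show ?thesis
    using double_card[OF group_PGL29, of "iota_P ` carrier A6" 360] finite_PGL29 card_image_theta eq by simp
qed

lemma PGL29_centralizer:
  assumes g: "g \<in> carrier PGL29" and comm: "\<And>a. a \<in> carrier A6 \<Longrightarrow> g \<otimes>\<^bsub>PGL29\<^esub> iota_P a = iota_P a \<otimes>\<^bsub>PGL29\<^esub> g"
  shows "g = \<one>\<^bsub>PGL29\<^esub>"
proof (rule inj_onD[OF theta_bar_inj])
  have "theta_bar g \<in> theta ` carrier GL2" using theta_bar_image g by blast
  then have "theta_bar g permutes {1..10}" using theta_permutes by (auto simp: GL2_simps)
  moreover have "theta_bar g \<circ> rho a = rho a \<circ> theta_bar g" if "a \<in> carrier A6" for a
    using P.hom_mult[of g "iota_P a"] P.hom_mult[of "iota_P a" g] comm[OF that] g iota_P[OF that]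
    by (simp only: sym_group_mult)
  ultimately have "theta_bar g = id" by (rule rho_centralizer)
  then show "theta_bar g = theta_bar \<one>\<^bsub>PGL29\<^esub>" using P.hom_one by (simp only: sym_group_one)
qed (use g in auto)

lemma rho_image_M10: "rho_image \<subseteq> M10_set"
proof -
  have "rho a6x \<in> M10_set" "rho a6y \<in> M10_set"
    unfolding M10_set_def M10_gens_def by (auto intro: generate.incl)
  then show ?thesis by (rule rho_image_subset[OF M10_subgroup])
qed

lemma m_in_M10: "m10m \<in> M10_set"
  unfolding M10_set_def M10_gens_def by (auto intro: generate.incl)

text \<open>The relations that move \<open>m\<close> to the left, together with the one for \<open>m\<^sup>2\<close>, form a coset table with the
two representatives \<open>1\<close> and \<open>m\<close>.\<close>

lemma M10_subset_cosets: "M10_set \<subseteq> rho_image \<union> (\<lambda>q. m10m \<circ> q) ` rho_image"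
proof
  fix g assume g: "g \<in> M10_set"
  have J: "subgroup rho_image (sym_group 12)" by (rule rho.img_is_subgroup)
  have J34: "W u \<in> rho_image" if "set u \<subseteq> {3,4}" for u
    using that a6_closed by (intro W_in_subgroup[OF J]) (auto simp: gens12_nth)
  have rels: "rho a6x \<circ> m10m = m10m \<circ> W [4,4,3,3,4,3,4,4,3]" "rho a6y \<circ> m10m = m10m \<circ> W [3,3,4,3,3,4,3,4]"
    "m10m \<circ> m10m = W [4,3,3,4,4,3,4,3]"
  proof -
    have "W [3,5] = W (5 # [4,4,3,3,4,3,4,4,3])" by (rule W_relation) (simp add: relations12_def)
    then show "rho a6x \<circ> m10m = m10m \<circ> W [4,4,3,3,4,3,4,4,3]"
      using W_Cons[of 3 "[5]"] W_Cons[of 5 "[4,4,3,3,4,3,4,4,3]"] by (simp only: W_gen gens12_nth)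
    have "W [4,5] = W (5 # [3,3,4,3,3,4,3,4])" by (rule W_relation) (simp add: relations12_def)
    then show "rho a6y \<circ> m10m = m10m \<circ> W [3,3,4,3,3,4,3,4]"
      using W_Cons[of 4 "[5]"] W_Cons[of 5 "[3,3,4,3,3,4,3,4]"] by (simp only: W_gen gens12_nth)
    have "W [5,5] = W [4,3,3,4,4,3,4,3]" by (rule W_relation) (simp add: relations12_def)
    then show "m10m \<circ> m10m = W [4,3,3,4,4,3,4,3]"
      using W_Cons[of 5 "[5]"] by (simp only: W_gen gens12_nth)
  qed
  have "\<exists>t\<in>{id, m10m}. \<exists>k\<in>rho_image. g = t \<otimes>\<^bsub>sym_group 12\<^esub> k"
  proof (rule generate_subset_cosets[OF sym_group_is_group finite_S12 J])
    show "g \<in> generate (sym_group 12) M10_gens" using g by (simp add: M10_set_def)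
    show "M10_gens \<subseteq> carrier (sym_group 12)" using gens_in_S12 by (auto simp: M10_gens_def)
    show "{id, m10m} \<subseteq> carrier (sym_group 12)"
      using gens_in_S12 S12.one_closed by (simp add: sym_group_one)
    show "\<one>\<^bsub>sym_group 12\<^esub> \<in> {id, m10m}" by (simp add: sym_group_one)
    have idJ: "id \<in> rho_image" using subgroup.one_closed[OF J] by (simp only: sym_group_one)
    have XY: "rho a6x \<in> rho_image" "rho a6y \<in> rho_image" using a6_closed by auto
    fix s t assume "s \<in> M10_gens" "t \<in> {id, m10m}"
    then consider "t = id" "s \<in> rho_image" | "t = id" "s = m10m" | "t = m10m" "s = rho a6x"
      | "t = m10m" "s = rho a6y" | "t = m10m" "s = m10m"
      using XY by (auto simp: M10_gens_def)
    then show "\<exists>t'\<in>{id, m10m}. \<exists>k\<in>rho_image. s \<otimes>\<^bsub>sym_group 12\<^esub> t = t' \<otimes>\<^bsub>sym_group 12\<^esub> k"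
      unfolding sym_group_mult
    proof cases
      case 1 then show "\<exists>t'\<in>{id, m10m}. \<exists>k\<in>rho_image. s \<circ> t = t' \<circ> k" by (metis comp_id id_comp insertI1)
    next
      case 2 then show "\<exists>t'\<in>{id, m10m}. \<exists>k\<in>rho_image. s \<circ> t = t' \<circ> k" using idJ by blast
    next
      case 3 then show "\<exists>t'\<in>{id, m10m}. \<exists>k\<in>rho_image. s \<circ> t = t' \<circ> k"
        using rels(1) J34[of "[4,4,3,3,4,3,4,4,3]"] by auto
    next
      case 4 then show "\<exists>t'\<in>{id, m10m}. \<exists>k\<in>rho_image. s \<circ> t = t' \<circ> k"
        using rels(2) J34[of "[3,3,4,3,3,4,3,4]"] by auto
    next
      case 5
      have "W [4,3,3,4,4,3,4,3] \<in> rho_image" by (rule J34) auto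
      then show "\<exists>t'\<in>{id, m10m}. \<exists>k\<in>rho_image. s \<circ> t = t' \<circ> k"
        using 5 rels(3) by (metis id_comp insertI1)
    qed
  qed
  then show "g \<in> rho_image \<union> (\<lambda>q. m10m \<circ> q) ` rho_image" unfolding sym_group_mult by auto
qed

lemma rho_mon_M10: "rho \<in> mon A6 M10"
  using rho_inj rho_image_M10 rho.hom_mult by (auto simp: mon_def hom_def M10_eq)

lemma card_M10: "card (carrier M10) = 720"
proof -
  have fin: "finite M10_set" using finite_subset[OF subgroup.subset[OF M10_subgroup] finite_S12] .
  have finL: "finite rho_image" using finite_A6 by simp
  have "card M10_set \<le> card (rho_image \<union> (\<lambda>q. m10m \<circ> q) ` rho_image)"
    using M10_subset_cosets finL by (intro card_mono) auto
  also have "\<dots> \<le> 360 + 360"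
    using card_Un_le[of rho_image "(\<lambda>q. m10m \<circ> q) ` rho_image"] card_image_le[OF finL, of "\<lambda>q. m10m \<circ> q"]
      card_rho_image by linarith
  finally have le: "card (carrier M10) \<le> 2 * 360" using M10_carrier by simp
  have "subgroup rho_image M10"
    unfolding M10_eq by (rule S12.subgroup_incl[OF rho.img_is_subgroup M10_subgroup rho_image_M10])
  moreover have "rho_image \<noteq> carrier M10"
    using m_in_M10 m_notin_theta rho_image_in_theta M10_carrier by auto
  ultimately show ?thesis
    using double_card[OF group_M10 _ _ card_rho_image _ le] fin M10_carrier by simp
qed

lemma M10_permutes: assumes "q \<in> M10_set" shows "q permutes {1..10}"
proof -
  have "q permutes {1..12}" using subgroup.mem_carrier[OF M10_subgroup assms] by (simp add: sym_group_carrier)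
  moreover have "q i = i" if "i \<in> {1..12} - {1..10}" for i
  proof -
    have "i = 11 \<or> i = 12" using that by auto
    then show ?thesis using M10_set_fixes[OF assms] by auto
  qed
  ultimately show ?thesis by (rule permutes_superset)
qed

lemma M10_centralizer:
  assumes g: "g \<in> carrier M10" and comm: "\<And>a. a \<in> carrier A6 \<Longrightarrow> g \<otimes>\<^bsub>M10\<^esub> rho a = rho a \<otimes>\<^bsub>M10\<^esub> g"
  shows "g = \<one>\<^bsub>M10\<^esub>"
proof -
  have "g = id"
    using g comm M10_permutes M10_carrier
    by (intro rho_centralizer) (simp_all add: M10_eq sym_group_mult)
  then show ?thesis by (simp add: M10_eq sym_group_one)
qed

section \<open>The automorphism group\<close>

lemma A6_overgroup:
  assumes "group H" "\<iota> \<in> mon A6 H" "card (carrier H) = 720"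
    and cent: "\<And>g. g \<in> carrier H \<Longrightarrow> (\<And>a. a \<in> carrier A6 \<Longrightarrow> g \<otimes>\<^bsub>H\<^esub> \<iota> a = \<iota> a \<otimes>\<^bsub>H\<^esub> g) \<Longrightarrow> g = \<one>\<^bsub>H\<^esub>"
  shows "A6_ext H \<iota>" "inj_on (conj_A6 H \<iota>) (carrier H)"
    "subgroup (conj_A6 H \<iota> ` carrier H) AutA6" "InnA6 \<subseteq> conj_A6 H \<iota> ` carrier H"
    "card (conj_A6 H \<iota> ` carrier H) = 720"
    "AutA6\<lparr>carrier := conj_A6 H \<iota> ` carrier H\<rparr> \<cong> H"
proof -
  show ext: "A6_ext H \<iota>" using assms(1-3) by (rule A6_ext_index2I)
  interpret A6_ext H \<iota> by fact
  show inj: "inj_on (conj_A6 H \<iota>) (carrier H)" using cent by (rule inj_c)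
  show "subgroup (conj_A6 H \<iota> ` carrier H) AutA6" by (rule image_subgroup)
  show "InnA6 \<subseteq> conj_A6 H \<iota> ` carrier H" by (rule Inn_subset)
  show "card (conj_A6 H \<iota> ` carrier H) = 720" using card_image[OF inj] assms(3) by simp
  have "conj_A6 H \<iota> \<in> iso H (AutA6\<lparr>carrier := conj_A6 H \<iota> ` carrier H\<rparr>)"
    using inj c_hom by (auto simp: iso_def hom_def bij_betw_def)
  then have "H \<cong> AutA6\<lparr>carrier := conj_A6 H \<iota> ` carrier H\<rparr>" by (auto simp: is_iso_def)
  then show "AutA6\<lparr>carrier := conj_A6 H \<iota> ` carrier H\<rparr> \<cong> H" by (rule iso_sym)
qed

text \<open>The images of \<open>S\<^sub>6\<close>, \<open>PGL(2,9)\<close> and \<open>M\<^sub>1\<^sub>0\<close> in \<open>Aut(A\<^sub>6)\<close>.\<close>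

definition K_S :: "aut set" where "K_S = conj_A6 (sym_group 6) id ` carrier (sym_group 6)"
definition K_P :: "aut set" where "K_P = conj_A6 PGL29 iota_P ` carrier PGL29"
definition K_M :: "aut set" where "K_M = conj_A6 M10 rho ` carrier M10"

lemma S6_mon: "id \<in> mon A6 (sym_group 6)"
  by (auto simp: mon_def hom_def alt_group_carrier sym_group_carrier alt_group_mult sym_group_mult)

lemma S6_centralizer:
  assumes "g \<in> carrier (sym_group 6)"
    "\<And>a. a \<in> carrier A6 \<Longrightarrow> g \<otimes>\<^bsub>sym_group 6\<^esub> id a = id a \<otimes>\<^bsub>sym_group 6\<^esub> g"
  shows "g = \<one>\<^bsub>sym_group 6\<^esub>"
  unfolding sym_group_one using assms by (intro A6_centralizer_sym) (simp_all add: sym_group_carrier sym_group_mult)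

lemmas S_facts = A6_overgroup[OF sym_group_is_group S6_mon card_S6 S6_centralizer, folded K_S_def]
lemmas P_facts = A6_overgroup[OF group_PGL29 iota_P_mon card_PGL29 PGL29_centralizer, folded K_P_def]
lemmas M_facts = A6_overgroup[OF group_M10 rho_mon_M10 card_M10 M10_centralizer, folded K_M_def]

interpretation S: A6_ext "sym_group 6" id by (rule S_facts(1))
interpretation P: A6_ext PGL29 iota_P by (rule P_facts(1))
interpretation M: A6_ext M10 rho by (rule M_facts(1))

lemma ord_eqI:
  assumes "group G" "x \<in> carrier G" "x [^]\<^bsub>G\<^esub> n = \<one>\<^bsub>G\<^esub>" "n > 0"
    "\<And>d. d dvd n \<Longrightarrow> d < n \<Longrightarrow> x [^]\<^bsub>G\<^esub> d \<noteq> \<one>\<^bsub>G\<^esub>"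
  shows "group.ord G x = n"
proof -
  interpret group G by fact
  have "ord x dvd n" using assms(2,3) pow_eq_id by blast
  moreover have "x [^]\<^bsub>G\<^esub> ord x = \<one>\<^bsub>G\<^esub>" using assms(2) by simp
  ultimately show ?thesis using assms(4,5) by (metis dvd_imp_le le_neq_implies_less)
qed

lemma dvd_10: "d dvd 10 \<Longrightarrow> d < 10 \<Longrightarrow> d dvd 2 \<or> d dvd (5::nat)"
proof -
  assume d: "d dvd 10" "d < 10"
  then have "d \<in> {0,1,2,3,4,5,6,7,8,9}" by auto
  then show ?thesis using d(1) by auto
qed

lemma dvd_4: "d dvd 4 \<Longrightarrow> d < 4 \<Longrightarrow> d dvd (2::nat)"
proof -
  assume d: "d dvd 4" "d < 4"
  then have "d \<in> {0,1,2,3}" by auto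
  then show ?thesis using d(1) by auto
qed

lemma pow_dvd_one:
  assumes "group G" "x \<in> carrier G" "x [^]\<^bsub>G\<^esub> (d::nat) = \<one>\<^bsub>G\<^esub>" "d dvd n"
  shows "x [^]\<^bsub>G\<^esub> n = \<one>\<^bsub>G\<^esub>"
  using assms by (metis group.pow_eq_id dvd_trans)

text \<open>The embeddings of \<open>PGL(2,9)\<close> into \<open>Aut(A\<^sub>6)\<close> and into the symmetric group preserve orders, so the order can
be computed with tables.\<close>

lemma exists_order_10: obtains h where "h \<in> K_P" "group.ord AutA6 h = 10"
proof -
  have "theta mat_h \<in> theta_bar ` carrier PGL29"
    using theta_bar_image mat_invertible by (auto simp: GL2_simps)
  then obtain g where g: "g \<in> carrier PGL29" "theta_bar g = theta mat_h" by auto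
  have pow: "P.c g [^]\<^bsub>AutA6\<^esub> k = \<one>\<^bsub>AutA6\<^esub> \<longleftrightarrow> theta mat_h [^]\<^bsub>sym_group 12\<^esub> k = \<one>\<^bsub>sym_group 12\<^esub>" for k :: nat
  proof -
    have "P.c g [^]\<^bsub>AutA6\<^esub> k = \<one>\<^bsub>AutA6\<^esub> \<longleftrightarrow> P.c (g [^]\<^bsub>PGL29\<^esub> k) = P.c \<one>\<^bsub>PGL29\<^esub>"
      using g by (simp add: P.c.hom_nat_pow)
    also have "\<dots> \<longleftrightarrow> g [^]\<^bsub>PGL29\<^esub> k = \<one>\<^bsub>PGL29\<^esub>"
      using P_facts(2) g by (subst inj_on_eq_iff[OF P_facts(2)]) auto
    also have "\<dots> \<longleftrightarrow> theta_bar (g [^]\<^bsub>PGL29\<^esub> k) = theta_bar \<one>\<^bsub>PGL29\<^esub>"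
      using g by (subst inj_on_eq_iff[OF theta_bar_inj]) auto
    also have "\<dots> \<longleftrightarrow> theta mat_h [^]\<^bsub>sym_group 12\<^esub> k = \<one>\<^bsub>sym_group 12\<^esub>"
      using g hom_one[OF theta_bar_hom group_PGL29 sym_group_is_group] group_hom.hom_nat_pow[of PGL29 "sym_group 12" theta_bar g k]
      by (simp add: group_hom_def group_hom_axioms_def group_PGL29 sym_group_is_group theta_bar_hom)
    finally show ?thesis .
  qed
  have gA: "P.c g \<in> carrier AutA6" using g by (simp add: P.c_Aut)
  have "group.ord AutA6 (P.c g) = 10"
  proof (rule ord_eqI[OF Aut.is_group gA])
    fix d :: nat assume "d dvd 10" "d < 10"
    then have "d dvd 2 \<or> d dvd 5" by (rule dvd_10)
    then show "P.c g [^]\<^bsub>AutA6\<^esub> d \<noteq> \<one>\<^bsub>AutA6\<^esub>"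
      using pow_dvd_one[OF Aut.is_group gA] pow[of 2] pow[of 5] h_large_order[of 2] h_large_order[of 5] by blast
  qed (use pow h_order in auto)
  then show ?thesis using that g by (auto simp: K_P_def)
qed

lemma M10_pow: "g \<in> M10_set \<Longrightarrow> g [^]\<^bsub>M10\<^esub> (k::nat) = g [^]\<^bsub>sym_group 12\<^esub> k"
  unfolding M10_eq by (metis S12.nat_pow_consistent)

lemma M_pow_iff:
  assumes "g \<in> M10_set"
  shows "M.c g [^]\<^bsub>AutA6\<^esub> k = \<one>\<^bsub>AutA6\<^esub> \<longleftrightarrow> g [^]\<^bsub>sym_group 12\<^esub> (k::nat) = \<one>\<^bsub>sym_group 12\<^esub>"
proof -
  have g: "g \<in> carrier M10" using assms M10_carrier by simp
  have "M.c g [^]\<^bsub>AutA6\<^esub> k = \<one>\<^bsub>AutA6\<^esub> \<longleftrightarrow> M.c (g [^]\<^bsub>M10\<^esub> k) = M.c \<one>\<^bsub>M10\<^esub>"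
    using g by (simp add: M.c.hom_nat_pow)
  also have "\<dots> \<longleftrightarrow> g [^]\<^bsub>M10\<^esub> k = \<one>\<^bsub>M10\<^esub>"
    using g by (subst inj_on_eq_iff[OF M_facts(2)]) auto
  also have "\<dots> \<longleftrightarrow> g [^]\<^bsub>sym_group 12\<^esub> k = \<one>\<^bsub>sym_group 12\<^esub>"
    using M10_pow[OF assms] by (simp add: M10_eq)
  finally show ?thesis .
qed

lemma exists_order_4: obtains g where "g \<in> K_M - InnA6" "group.ord AutA6 g = 4"
proof -
  let ?g = "M.c m10m"
  have m: "m10m \<in> carrier M10" using m_in_M10 M10_carrier by simp
  have gA: "?g \<in> carrier AutA6" using m by (simp add: M.c_Aut)
  have "group.ord AutA6 ?g = 4"
  proof (rule ord_eqI[OF Aut.is_group gA])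
    fix d :: nat assume "d dvd 4" "d < 4"
    then have "d dvd 2" by (rule dvd_4)
    then show "?g [^]\<^bsub>AutA6\<^esub> d \<noteq> \<one>\<^bsub>AutA6\<^esub>"
      using pow_dvd_one[OF Aut.is_group gA] M_pow_iff[OF m_in_M10, of 2] m_order(2) by blast
  qed (use M_pow_iff[OF m_in_M10] m_order in auto)
  moreover have "?g \<notin> InnA6"
  proof
    assume "?g \<in> InnA6"
    then obtain a where a: "a \<in> carrier A6" "?g = M.c (rho a)" by (auto simp: InnA6_def M.c_iota[symmetric])
    have "rho a \<in> carrier M10" using a(1) by (rule M.\<iota>.hom_closed)
    from inj_onD[OF M_facts(2) a(2) m this] have "m10m = rho a" .
    then show False using m_notin_theta rho_image_in_theta a(1) by auto
  qed
  ultimately show ?thesis using that m by (auto simp: K_M_def)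
qed

lemma K_S_small_order: "\<phi> \<in> K_S \<Longrightarrow> \<exists>k\<in>{4,5,6::nat}. \<phi> [^]\<^bsub>AutA6\<^esub> k = \<one>\<^bsub>AutA6\<^esub>"
  unfolding K_S_def using small_order_hom[OF S.c.group_hom_axioms _ S6_small_order] by auto

lemma Inn_small_order: "\<phi> \<in> InnA6 \<Longrightarrow> \<exists>k\<in>{4,5,6::nat}. \<phi> [^]\<^bsub>AutA6\<^esub> k = \<one>\<^bsub>AutA6\<^esub>"
  using K_S_small_order S_facts(4) by blast

lemma order_10_large:
  assumes "\<phi> \<in> carrier AutA6" "group.ord AutA6 \<phi> = 10" "k \<in> {4,5,6::nat}"
  shows "\<phi> [^]\<^bsub>AutA6\<^esub> k \<noteq> \<one>\<^bsub>AutA6\<^esub>"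
  using Aut.pow_eq_id[OF assms(1), of k] assms(2,3) by auto

text \<open>The element \<open>X m\<close> of \<open>M\<^sub>1\<^sub>0\<close>, like an element of order 10 in \<open>PGL(2,9)\<close>, has nontrivial fourth, fifth and
sixth powers, which is impossible in \<open>S\<^sub>6\<close>.\<close>

lemma K_S_noteq: "K_S \<noteq> K_P" "K_S \<noteq> K_M"
proof -
  obtain h where h: "h \<in> K_P" "group.ord AutA6 h = 10" by (rule exists_order_10)
  have "h \<in> carrier AutA6" using h(1) subgroup.mem_carrier[OF P_facts(3)] by blast
  then have "h \<notin> K_S" using order_10_large[OF _ h(2)] K_S_small_order[of h] by blast
  then show "K_S \<noteq> K_P" using h by auto
  have x: "rho a6x \<circ> m10m \<in> M10_set"
    using subgroup.m_closed[OF M10_subgroup, of "rho a6x" m10m] rho_image_M10 m_in_M10 a6_closed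
    by (auto simp: sym_group_mult)
  have "M.c (rho a6x \<circ> m10m) \<notin> K_S"
  proof
    assume "M.c (rho a6x \<circ> m10m) \<in> K_S"
    from K_S_small_order[OF this] show False using M_pow_iff[OF x] xm_large_order by blast
  qed
  moreover have "M.c (rho a6x \<circ> m10m) \<in> K_M" using x M10_carrier by (auto simp: K_M_def)
  ultimately show "K_S \<noteq> K_M" by auto
qed

text \<open>If an element of \<open>PGL(2,9)\<close>, acting on the ten points as \<open>q\<close>, induced the same automorphism as \<open>m\<close>, then
\<open>q\<^sup>-\<^sup>1 m\<close> would centralize the action of \<open>A\<^sub>6\<close>. So \<open>m = q\<close> would be projective.\<close>

lemma K_P_noteq_K_M: "K_P \<noteq> K_M"
proof
  assume *: "K_P = K_M"
  have m: "m10m \<in> carrier M10" using m_in_M10 M10_carrier by simp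
  then have "M.c m10m \<in> K_P" unfolding * by (auto simp: K_M_def)
  then obtain y where y: "y \<in> carrier PGL29" "M.c m10m = P.c y" by (auto simp: K_P_def)
  define q where "q = theta_bar y"
  have q: "q \<in> theta ` carrier GL2" using theta_bar_image y(1) by (auto simp: q_def)
  then have q10: "q permutes {1..10}" using theta_permutes by (auto simp: GL2_simps)
  have m10: "m10m permutes {1..10}" by (rule M10_permutes[OF m_in_M10])
  have "inv' q \<circ> m10m = id"
  proof (rule rho_centralizer)
    show "inv' q \<circ> m10m permutes {1..10}" using m10 permutes_inv[OF q10] by (rule permutes_compose)
    fix a assume a: "a \<in> carrier A6"
    let ?b = "M.c m10m a"
    have b: "?b \<in> carrier A6" using m a by (rule M.c_closed)
    have 1: "rho ?b \<circ> m10m = m10m \<circ> rho a"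
      using M.c_comm[OF m a] by (simp add: M10_eq sym_group_mult)
    have "iota_P ?b \<otimes>\<^bsub>PGL29\<^esub> y = y \<otimes>\<^bsub>PGL29\<^esub> iota_P a"
      using P.c_comm[OF y(1) a] y(2) by simp
    then have "theta_bar (iota_P ?b) \<otimes>\<^bsub>sym_group 12\<^esub> theta_bar y = theta_bar y \<otimes>\<^bsub>sym_group 12\<^esub> theta_bar (iota_P a)"
      unfolding hom_mult[OF theta_bar_hom iota_P(1)[OF b] y(1), symmetric]
        hom_mult[OF theta_bar_hom y(1) iota_P(1)[OF a], symmetric] by (rule arg_cong)
    then have 2: "rho ?b \<circ> q = q \<circ> rho a"
      using iota_P(2)[OF a] iota_P(2)[OF b] by (simp add: sym_group_mult q_def)
    have qi: "q \<circ> inv' q = id" "inv' q \<circ> q = id" using q10 by (rule permutes_inv_o)+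
    have "inv' q \<circ> rho ?b \<circ> (q \<circ> inv' q) = inv' q \<circ> (rho ?b \<circ> q) \<circ> inv' q" by (simp add: comp_assoc)
    also have "\<dots> = (inv' q \<circ> q) \<circ> rho a \<circ> inv' q" unfolding 2 by (simp add: comp_assoc)
    finally have 3: "inv' q \<circ> rho ?b = rho a \<circ> inv' q" unfolding qi by simp
    have "inv' q \<circ> m10m \<circ> rho a = inv' q \<circ> (rho ?b \<circ> m10m)" unfolding 1 by (simp add: comp_assoc)
    also have "\<dots> = rho a \<circ> inv' q \<circ> m10m" using 3 by (simp add: comp_assoc[symmetric])
    finally show "inv' q \<circ> m10m \<circ> rho a = rho a \<circ> (inv' q \<circ> m10m)" by (simp add: comp_assoc)
  qed
  then have "m10m = q"
    using permutes_inv_o(1)[OF q10] by (metis comp_assoc comp_id id_comp)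
  then show False using q m_notin_theta by simp
qed

lemma card_Aut: "card (carrier AutA6) = 1440"
proof -
  have "K_S \<noteq> carrier AutA6"
  proof
    assume *: "K_S = carrier AutA6"
    then have "K_P \<subseteq> K_S" using subgroup.subset[OF P_facts(3)] by simp
    then have "K_P = K_S" using S_facts(5) P_facts(5) finite_Aut * by (intro card_subset_eq) auto
    then show False using K_S_noteq by simp
  qed
  then show ?thesis
    using double_card[OF Aut.is_group S_facts(3) _ S_facts(5)] card_Aut_le finite_Aut by simp
qed

lemma index2_coset:
  assumes K: "subgroup K AutA6" "InnA6 \<subseteq> K" "card K = 720" and \<phi>: "\<phi> \<in> K - InnA6"
  shows "K = InnA6 \<union> (\<lambda>\<psi>. \<phi> \<otimes>\<^bsub>AutA6\<^esub> \<psi>) ` InnA6"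
proof -
  let ?C = "(\<lambda>\<psi>. \<phi> \<otimes>\<^bsub>AutA6\<^esub> \<psi>) ` InnA6"
  have KA: "K \<subseteq> carrier AutA6" using K(1) by (rule subgroup.subset)
  have IA: "InnA6 \<subseteq> carrier AutA6" using Inn_subgroup by (rule subgroup.subset)
  have finK: "finite K" using KA finite_Aut by (rule finite_subset)
  have \<phi>A: "\<phi> \<in> carrier AutA6" using \<phi> KA by auto
  have "?C \<subseteq> K" using \<phi> K(2) subgroup.m_closed[OF K(1)] by auto
  have "InnA6 \<inter> ?C = {}"
  proof (rule ccontr)
    assume "InnA6 \<inter> ?C \<noteq> {}"
    then obtain \<psi> where \<psi>: "\<psi> \<in> InnA6" "\<phi> \<otimes>\<^bsub>AutA6\<^esub> \<psi> \<in> InnA6" by auto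
    have "\<phi> = \<phi> \<otimes>\<^bsub>AutA6\<^esub> \<psi> \<otimes>\<^bsub>AutA6\<^esub> inv\<^bsub>AutA6\<^esub> \<psi>" using \<psi> \<phi>A IA by (simp add: Aut.m_assoc subset_iff)
    then have "\<phi> \<in> InnA6" using \<psi> subgroup.m_closed[OF Inn_subgroup] subgroup.m_inv_closed[OF Inn_subgroup] by metis
    with \<phi> show False by simp
  qed
  moreover have "card ?C = 360"
    using card_Inn \<phi>A IA by (subst card_image) (auto intro!: inj_onI simp: subset_iff)
  ultimately have "card (InnA6 \<union> ?C) = 720"
    using card_Inn finite_subset[OF K(2) finK] by (subst card_Un_disjoint) auto
  then show ?thesis
    using \<open>?C \<subseteq> K\<close> K(2,3) finK by (intro card_subset_eq[symmetric]) auto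
qed

lemma K_members: "K_S \<in> {K_S, K_P, K_M}" "K_P \<in> {K_S, K_P, K_M}" "K_M \<in> {K_S, K_P, K_M}"
  by blast+

lemma K_facts:
  assumes "K \<in> {K_S, K_P, K_M}"
  shows "subgroup K AutA6" "InnA6 \<subseteq> K" "card K = 720" "K \<lhd> AutA6"
proof -
  show K: "subgroup K AutA6" "InnA6 \<subseteq> K" "card K = 720"
    using assms S_facts P_facts M_facts by auto
  show "K \<lhd> AutA6"
    using index2_subgroup_normal(1)[OF Aut.is_group K(1) finite_Aut] card_Aut K(3) by simp
qed

text \<open>Two of the subgroups that share an element outside \<open>A\<^sub>6\<close> are equal, because each is generated by \<open>A\<^sub>6\<close>
and any such element. So the three complements of \<open>A\<^sub>6\<close> are disjoint, and \<open>360 + 3 * 360 = 1440\<close>.\<close>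

lemma Aut_cover: "carrier AutA6 = K_S \<union> K_P \<union> K_M"
proof -
  have KA: "K \<subseteq> carrier AutA6" if "K \<in> {K_S, K_P, K_M}" for K
    using K_facts(1)[OF that] by (rule subgroup.subset)
  have fin: "finite K" if "K \<in> {K_S, K_P, K_M}" for K
    using KA[OF that] finite_Aut by (rule finite_subset)
  have disj: "(K - InnA6) \<inter> (K' - InnA6) = {}" if "K \<in> {K_S, K_P, K_M}" "K' \<in> {K_S, K_P, K_M}" "K \<noteq> K'" for K K'
  proof (rule ccontr)
    assume "(K - InnA6) \<inter> (K' - InnA6) \<noteq> {}"
    then obtain \<phi> where "\<phi> \<in> K - InnA6" "\<phi> \<in> K' - InnA6" by blast
    then have "K = K'"
      using index2_coset[OF K_facts(1,2,3)[OF that(1)], of \<phi>] index2_coset[OF K_facts(1,2,3)[OF that(2)], of \<phi>] by simp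
    with that(3) show False by simp
  qed
  have card: "card (K - InnA6) = 360" if "K \<in> {K_S, K_P, K_M}" for K
    using K_facts(2,3)[OF that] card_Inn fin[OF that] by (simp add: card_Diff_subset finite_subset)
  have finI: "finite InnA6" using fin[of K_S] K_facts(2)[of K_S] by (auto intro: finite_subset)
  let ?U = "InnA6 \<union> (K_S - InnA6) \<union> (K_P - InnA6) \<union> (K_M - InnA6)"
  note d = disj[OF K_members(1,2) K_S_noteq(1)] disj[OF K_members(1,3) K_S_noteq(2)]
    disj[OF K_members(2,3) K_P_noteq_K_M]
  have finD: "finite (K - InnA6)" if "K \<in> {K_S, K_P, K_M}" for K using fin[OF that] by simp
  have 1: "card (InnA6 \<union> (K_S - InnA6)) = 720"
    using card_Un_disjoint[OF finI finD[OF K_members(1)]] card[OF K_members(1)] card_Inn by simp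
  have 2: "card (InnA6 \<union> (K_S - InnA6) \<union> (K_P - InnA6)) = 1080"
  proof (subst card_Un_disjoint)
    show "(InnA6 \<union> (K_S - InnA6)) \<inter> (K_P - InnA6) = {}" using d(1) by blast
  qed (use 1 card[OF K_members(2)] finI finD[OF K_members(1)] finD[OF K_members(2)] in simp_all)
  have "card ?U = 1440"
  proof (subst card_Un_disjoint)
    show "(InnA6 \<union> (K_S - InnA6) \<union> (K_P - InnA6)) \<inter> (K_M - InnA6) = {}" using d(2,3) by blast
  qed (use 2 card[OF K_members(3)] finI finD[OF K_members(1)] finD[OF K_members(2)] finD[OF K_members(3)] in simp_all)
  moreover have "?U \<subseteq> carrier AutA6"
    using KA[OF K_members(1)] KA[OF K_members(2)] KA[OF K_members(3)] subgroup.subset[OF Inn_subgroup] by blast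
  ultimately have "?U = carrier AutA6"
    using card_Aut finite_Aut by (intro card_subset_eq) simp_all
  then show ?thesis using K_facts(2)[of K_S] by auto
qed

text \<open>The outer automorphism group has exponent 2.\<close>

lemma square_Inn:
  assumes "\<phi> \<in> carrier AutA6" shows "\<phi> \<otimes>\<^bsub>AutA6\<^esub> \<phi> \<in> InnA6"
proof (cases "\<phi> \<in> InnA6")
  case True then show ?thesis using subgroup.m_closed[OF Inn_subgroup] by blast
next
  case False
  obtain K where K: "K \<in> {K_S, K_P, K_M}" "\<phi> \<in> K" using assms Aut_cover by blast
  have "\<phi> \<otimes>\<^bsub>AutA6\<^esub> \<phi> \<in> K" using K subgroup.m_closed[OF K_facts(1)[OF K(1)]] by blast
  then have "\<phi> \<otimes>\<^bsub>AutA6\<^esub> \<phi> \<in> InnA6 \<or> (\<exists>\<psi>\<in>InnA6. \<phi> \<otimes>\<^bsub>AutA6\<^esub> \<phi> = \<phi> \<otimes>\<^bsub>AutA6\<^esub> \<psi>)"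
    using index2_coset[OF K_facts(1,2,3)[OF K(1)], of \<phi>] K(2) False by blast
  moreover have "\<phi> = \<psi>" if "\<psi> \<in> InnA6" "\<phi> \<otimes>\<^bsub>AutA6\<^esub> \<phi> = \<phi> \<otimes>\<^bsub>AutA6\<^esub> \<psi>" for \<psi>
    using that assms subgroup.mem_carrier[OF Inn_subgroup that(1)] by simp
  ultimately show ?thesis using False by blast
qed

text \<open>A subgroup of order 720 has index 2, so it contains the derived subgroup and with it all inner
automorphisms. An isomorphism then makes it a conjugate of the given normal subgroup.\<close>

lemma the_subgroup_eq:
  assumes ext: "A6_ext H \<iota>" and K: "K = conj_A6 H \<iota> ` carrier H" "K \<in> {K_S, K_P, K_M}"
    and iso: "AutA6\<lparr>carrier := K\<rparr> \<cong> H"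
  shows "the_subgroup H = K"
  unfolding the_subgroup_def
proof (rule the_equality)
  show "subgroup K AutA6 \<and> AutA6\<lparr>carrier := K\<rparr> \<cong> H" using iso K_facts(1)[OF K(2)] by simp
  fix K' assume K': "subgroup K' AutA6 \<and> AutA6\<lparr>carrier := K'\<rparr> \<cong> H"
  interpret H: A6_ext H \<iota> by fact
  have sub: "subgroup K' AutA6" using K' by simp
  have g': "group (AutA6\<lparr>carrier := K'\<rparr>)" using sub by (rule Aut.subgroup_imp_group)
  have gK: "group (AutA6\<lparr>carrier := K\<rparr>)" using K_facts(1)[OF K(2)] by (rule Aut.subgroup_imp_group)
  have "card K' = card (carrier H)" "card K = card (carrier H)"
    using iso_same_card[of "AutA6\<lparr>carrier := K'\<rparr>" H] iso_same_card[of "AutA6\<lparr>carrier := K\<rparr>" H] K' iso by auto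
  then have c720: "card K' = 720" using K_facts(3)[OF K(2)] by simp
  have "derived AutA6 (carrier AutA6) \<subseteq> K'"
    using index2_subgroup_normal(2)[OF Aut.is_group sub finite_Aut] card_Aut c720 by simp
  moreover have "InnA6 \<subseteq> derived AutA6 (carrier AutA6)"
    using perfect_image_in_derived[OF Aut.is_group inn_mon] by (simp add: InnA6_def)
  ultimately have Inn: "InnA6 \<subseteq> K'" by simp
  interpret K': A6_normal "AutA6\<lparr>carrier := K'\<rparr>" inn using sub Inn by (rule A6_normal_Aut)
  have ext': "A6_ext (AutA6\<lparr>carrier := K'\<rparr>) inn"
    using A6_ext_index2I[OF g' K'.mon] c720 by simp
  have iso': "H \<cong> AutA6\<lparr>carrier := K'\<rparr>" using K' g' group.iso_sym by blast
  obtain \<alpha> where \<alpha>: "\<alpha> \<in> carrier AutA6"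
    "conj_A6 (AutA6\<lparr>carrier := K'\<rparr>) inn ` carrier (AutA6\<lparr>carrier := K'\<rparr>)
      = (\<lambda>\<phi>. \<alpha> \<otimes>\<^bsub>AutA6\<^esub> \<phi> \<otimes>\<^bsub>AutA6\<^esub> inv\<^bsub>AutA6\<^esub> \<alpha>) ` conj_A6 H \<iota> ` carrier H"
    by (rule A6_ext_iso[OF ext ext' iso'])
  have "conj_A6 (AutA6\<lparr>carrier := K'\<rparr>) inn ` carrier (AutA6\<lparr>carrier := K'\<rparr>) = K'"
    using conj_Aut_self[OF sub Inn] by simp
  then show "K' = K"
    using \<alpha>(2) conj_normal[OF K_facts(4)[OF K(2)] \<alpha>(1)] K(1) by simp
qed

lemma S6_sub_eq: "S6_sub = K_S"
  by (rule the_subgroup_eq[OF S_facts(1) K_S_def K_members(1) S_facts(6)])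

lemma PGL29_sub_eq: "PGL29_sub = K_P"
  by (rule the_subgroup_eq[OF P_facts(1) K_P_def K_members(2) P_facts(6)])

lemma M10_sub_eq: "M10_sub = K_M"
  by (rule the_subgroup_eq[OF M_facts(1) K_M_def K_members(3) M_facts(6)])

lemma swap12: "swap12 \<in> K_S - InnA6" "swap12 \<otimes>\<^bsub>AutA6\<^esub> swap12 = \<one>\<^bsub>AutA6\<^esub>"
proof -
  let ?t = "cycle_of_list [1, 2 :: nat]"
  have tr: "?t = Transposition.transpose 1 2" by simp
  have t: "?t \<in> carrier (sym_group 6)"
    unfolding sym_group_carrier tr by (rule permutes_swap_id) auto
  have "swap12 \<notin> InnA6"
  proof
    assume "swap12 \<in> InnA6"
    then obtain a where a: "a \<in> carrier A6" "swap12 = S.c (id a)" by (auto simp: InnA6_def S.c_iota[symmetric])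
    then have "?t = a" using t S.\<iota>.hom_closed[OF a(1)] inj_onD[OF S_facts(2), of ?t a] by (simp add: swap12_def)
    then have "evenperm (Transposition.transpose 1 (2::nat))" using a(1) tr by (simp add: alt_group_carrier)
    then show False by (simp add: evenperm_swap)
  qed
  then show "swap12 \<in> K_S - InnA6" using t by (auto simp: K_S_def swap12_def)
  have "swap12 \<otimes>\<^bsub>AutA6\<^esub> swap12 = S.c (?t \<otimes>\<^bsub>sym_group 6\<^esub> ?t)"
    unfolding swap12_def using S.c.hom_mult[OF t t] by simp
  also have "?t \<otimes>\<^bsub>sym_group 6\<^esub> ?t = \<one>\<^bsub>sym_group 6\<^esub>"
    unfolding sym_group_mult sym_group_one tr by (rule transpose_comp_involutory)
  also have "S.c \<one>\<^bsub>sym_group 6\<^esub> = \<one>\<^bsub>AutA6\<^esub>" by (rule S.c.hom_one)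
  finally show "swap12 \<otimes>\<^bsub>AutA6\<^esub> swap12 = \<one>\<^bsub>AutA6\<^esub>" .
qed

text \<open>An element \<open>h\<close> of order 10 is not inner, and \<open>h\<^sup>2\<close> is; so \<open>h\<^sup>5\<close> is an involution outside \<open>A\<^sub>6\<close>.\<close>

lemma order_10_power:
  assumes h: "h \<in> K_P" "group.ord AutA6 h = 10"
  shows "h [^]\<^bsub>AutA6\<^esub> (5::nat) \<in> K_P - InnA6" "(h [^]\<^bsub>AutA6\<^esub> (5::nat)) \<otimes>\<^bsub>AutA6\<^esub> (h [^]\<^bsub>AutA6\<^esub> (5::nat)) = \<one>\<^bsub>AutA6\<^esub>"
proof -
  interpret K: subgroup K_P AutA6 by (rule P_facts(3))
  interpret I: subgroup InnA6 AutA6 by (rule Inn_subgroup)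
  have hA: "h \<in> carrier AutA6" using h(1) by simp
  have "h \<notin> InnA6" using Inn_small_order order_10_large[OF hA h(2)] by blast
  let ?s = "h \<otimes>\<^bsub>AutA6\<^esub> h"
  have s: "?s \<in> InnA6" by (rule square_Inn[OF hA])
  have pow5: "h [^]\<^bsub>AutA6\<^esub> (5::nat) = h \<otimes>\<^bsub>AutA6\<^esub> (?s \<otimes>\<^bsub>AutA6\<^esub> ?s)"
  proof -
    have five: "(5::nat) = Suc (Suc (Suc (Suc (Suc 0))))" by simp
    show ?thesis unfolding five using hA by (simp add: Aut.m_assoc)
  qed
  have "h [^]\<^bsub>AutA6\<^esub> (5::nat) \<notin> InnA6"
  proof
    assume "h [^]\<^bsub>AutA6\<^esub> (5::nat) \<in> InnA6"
    moreover have "h = h [^]\<^bsub>AutA6\<^esub> (5::nat) \<otimes>\<^bsub>AutA6\<^esub> inv\<^bsub>AutA6\<^esub> (?s \<otimes>\<^bsub>AutA6\<^esub> ?s)"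
      unfolding pow5 using hA by (subst Aut.m_assoc) auto
    ultimately have "h \<in> InnA6" using s by (metis I.m_closed I.m_inv_closed)
    with \<open>h \<notin> InnA6\<close> show False ..
  qed
  moreover have "h [^]\<^bsub>AutA6\<^esub> (5::nat) \<in> K_P" unfolding pow5 using h(1) by simp
  ultimately show "h [^]\<^bsub>AutA6\<^esub> (5::nat) \<in> K_P - InnA6" by simp
  have "(h [^]\<^bsub>AutA6\<^esub> (5::nat)) \<otimes>\<^bsub>AutA6\<^esub> (h [^]\<^bsub>AutA6\<^esub> (5::nat)) = h [^]\<^bsub>AutA6\<^esub> (10::nat)"
    using hA by (simp add: Aut.nat_pow_mult)
  also have "\<dots> = \<one>\<^bsub>AutA6\<^esub>" using Aut.pow_ord_eq_1[OF hA] h(2) by simp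
  finally show "(h [^]\<^bsub>AutA6\<^esub> (5::nat)) \<otimes>\<^bsub>AutA6\<^esub> (h [^]\<^bsub>AutA6\<^esub> (5::nat)) = \<one>\<^bsub>AutA6\<^esub>" .
qed

section \<open>Fourth roots of unity\<close>

lemma zeta4_eq: "zeta4 = \<i>"
proof -
  have "zeta4 = cis (pi / 2)" unfolding zeta4_def cis_conv_exp by (simp add: mult.commute)
  then show ?thesis by simp
qed

lemma group_complex_units: "group complex_units"
proof (rule groupI)
  fix x assume "x \<in> carrier complex_units"
  then show "\<exists>y\<in>carrier complex_units. y \<otimes>\<^bsub>complex_units\<^esub> x = \<one>\<^bsub>complex_units\<^esub>"
    by (intro bexI[of _ "inverse x"]) (auto simp: complex_units_def)
qed (auto simp: complex_units_def)

lemma mu4_carrier: "carrier mu4 = {1, \<i>, -1, -\<i>}"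
proof -
  interpret U: group complex_units by (rule group_complex_units)
  have "subgroup {1, \<i>, -1, -\<i>} complex_units"
  proof (rule U.subgroupI)
    fix x assume x: "x \<in> {1, \<i>, -1, -\<i>}"
    then have "inv\<^bsub>complex_units\<^esub> x = inverse x"
      by (intro U.inv_equality) (auto simp: complex_units_def)
    then show "inv\<^bsub>complex_units\<^esub> x \<in> {1, \<i>, -1, -\<i>}" using x by auto
  qed (auto simp: complex_units_def)
  then have "generate complex_units {\<i>} \<subseteq> {1, \<i>, -1, -\<i>}"
    by (rule U.generate_subgroup_incl[rotated]) simp
  moreover have "{1, \<i>, -1, -\<i>} \<subseteq> generate complex_units {\<i>}"
  proof -
    have m: "x * y \<in> generate complex_units {\<i>}"
      if "x \<in> generate complex_units {\<i>}" "y \<in> generate complex_units {\<i>}" for x y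
      using generate.eng[OF that] by (simp add: complex_units_def)
    have 1: "1 \<in> generate complex_units {\<i>}" using generate.one[of complex_units] by (simp add: complex_units_def)
    have i: "\<i> \<in> generate complex_units {\<i>}" by (rule generate.incl) simp
    have "-1 \<in> generate complex_units {\<i>}" using m[OF i i] by simp
    moreover from m[OF i this] have "-\<i> \<in> generate complex_units {\<i>}" by simp
    ultimately show ?thesis using 1 i by simp
  qed
  ultimately show ?thesis by (simp add: mu4_def zeta4_eq)
qed

lemma mu4_simps [simp]: "x \<otimes>\<^bsub>mu4\<^esub> y = x * y" "\<one>\<^bsub>mu4\<^esub> = 1"
  by (simp_all add: mu4_def complex_units_def)

lemma comm_group_mu4: "comm_group mu4"
proof (rule group.group_comm_groupI)
  interpret U: group complex_units by (rule group_complex_units)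
  show "group mu4"
    unfolding mu4_def by (intro U.subgroup_imp_group U.generate_is_subgroup) (auto simp: complex_units_def zeta4_eq)
qed simp

interpretation mu4: comm_group mu4 by (rule comm_group_mu4)

lemma mu4_pow: "z [^]\<^bsub>mu4\<^esub> (k::nat) = z ^ k"
  by (induction k) simp_all

lemma mu4_powers: assumes "z \<in> carrier mu4" obtains k :: nat where "k < 4" "z = \<i> ^ k"
proof -
  have "\<i> ^ 3 = - \<i>" by (simp add: numeral_eq_Suc)
  then show ?thesis using assms that[of 0] that[of 1] that[of 2] that[of 3] by (auto simp: mu4_carrier)
qed

lemma i_pow_inj: "j < 4 \<Longrightarrow> k < 4 \<Longrightarrow> \<i> ^ j = \<i> ^ k \<Longrightarrow> j = (k::nat)"
proof -
  assume jk: "j < 4" "k < 4" "\<i> ^ j = \<i> ^ k"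
  have 3: "\<i> ^ 3 = - \<i>" by (simp add: numeral_eq_Suc)
  have "j \<in> {0,1,2,3}" "k \<in> {0,1,2,3}" using jk by auto
  then show ?thesis using jk(3) 3 by (auto simp: complex_eq_iff)
qed

lemma i_pow4: "\<i> ^ 4 = 1"
  by (simp add: numeral_eq_Suc)

section \<open>The candidate extensions\<close>

lemma times_mu4_simps [simp]:
  "carrier (times_mu4 N) = N \<times> carrier mu4" "\<one>\<^bsub>times_mu4 N\<^esub> = (\<one>\<^bsub>AutA6\<^esub>, 1)"
  "p \<otimes>\<^bsub>times_mu4 N\<^esub> q = (fst p \<otimes>\<^bsub>AutA6\<^esub> fst q, snd p * snd q)"
  by (simp_all add: times_mu4_def DirProd_def split: prod.splits)

lemma group_times_mu4: "subgroup N AutA6 \<Longrightarrow> group (times_mu4 N)"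
  unfolding times_mu4_def by (intro DirProd_group Aut.subgroup_imp_group mu4.is_group)

lemma times_mu4_pow:
  "p [^]\<^bsub>(times_mu4 N)\<lparr>carrier := C\<rparr>\<^esub> (k::nat) = (fst p [^]\<^bsub>AutA6\<^esub> k, snd p ^ k)"
  by (induction k) (simp_all add: mult.commute)

definition iota_1 :: "(nat \<Rightarrow> nat) \<Rightarrow> aut \<times> complex" where
  "iota_1 a = (inn a, 1)"

lemma generate_order_4:
  assumes "group G" "x \<in> carrier G" "x [^]\<^bsub>G\<^esub> (4::nat) = \<one>\<^bsub>G\<^esub>" "p \<in> generate G {x}"
  obtains k :: nat where "k < 4" "p = x [^]\<^bsub>G\<^esub> k"
proof -
  interpret group G by fact
  obtain k :: int where k: "p = x [^]\<^bsub>G\<^esub> k" using assms(4) generate_pow[OF assms(2)] by auto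
  define r where "r = nat (k mod 4)"
  have r: "int r = k mod 4" "r < 4" by (auto simp: r_def)
  have "x [^]\<^bsub>G\<^esub> k = x [^]\<^bsub>G\<^esub> (4 * (k div 4) + int r)" using r by simp
  also have "\<dots> = x [^]\<^bsub>G\<^esub> (4 * (k div 4)) \<otimes>\<^bsub>G\<^esub> x [^]\<^bsub>G\<^esub> int r"
    using assms(2) by (rule int_pow_mult)
  also have "x [^]\<^bsub>G\<^esub> (4 * (k div 4)) = (x [^]\<^bsub>G\<^esub> (4::int)) [^]\<^bsub>G\<^esub> (k div 4)"
    using assms(2) by (simp add: int_pow_pow)
  also have "x [^]\<^bsub>G\<^esub> (4::int) = \<one>\<^bsub>G\<^esub>"
    using assms(3) int_pow_int[of G x 4] by simp
  finally have "p = x [^]\<^bsub>G\<^esub> r" using assms(2) by (simp add: k int_pow_int)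
  then show ?thesis using that r(2) by blast
qed

text \<open>A subgroup that the projection maps bijectively to the quotient is a complement of the kernel. Composing
the projection with the inverse of this bijection presents the complement itself as the quotient.\<close>

lemma split_section:
  assumes E: "group E" and Q: "group Q" and \<pi>: "\<pi> \<in> epi E Q" and B: "subgroup B E"
    and bij: "bij_betw \<pi> B (carrier Q)"
  shows "internal_semidirect E (kernel E Q \<pi>) B"
    and "\<exists>\<sigma> \<in> epi E (E\<lparr>carrier := B\<rparr>). kernel E (E\<lparr>carrier := B\<rparr>) \<sigma> = kernel E Q \<pi>"
proof -
  interpret E: group E by fact
  interpret Q: group Q by fact
  interpret B: subgroup B E by fact
  have hom: "\<pi> \<in> hom E Q" and surj: "\<pi> ` carrier E = carrier Q" using \<pi> by (auto simp: epi_def)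
  interpret group_hom E Q \<pi> using hom by unfold_locales
  have inj: "inj_on \<pi> B" and im: "\<pi> ` B = carrier Q" using bij by (auto simp: bij_betw_def)
  have one: "b = \<one>\<^bsub>E\<^esub>" if "b \<in> B" "\<pi> b = \<one>\<^bsub>Q\<^esub>" for b
    using that inj_onD[OF inj, of b "\<one>\<^bsub>E\<^esub>"] by simp
  show "internal_semidirect E (kernel E Q \<pi>) B"
    unfolding internal_semidirect_def
  proof (intro conjI)
    show "kernel E Q \<pi> \<lhd> E" by (rule normal_kernel)
    show "subgroup B E" by (rule B)
    show "kernel E Q \<pi> \<inter> B = {\<one>\<^bsub>E\<^esub>}" using one by (auto simp: kernel_def)
    show "kernel E Q \<pi> <#>\<^bsub>E\<^esub> B = carrier E"
    proof
      show "kernel E Q \<pi> <#>\<^bsub>E\<^esub> B \<subseteq> carrier E" by (auto simp: set_mult_def kernel_def)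
      show "carrier E \<subseteq> kernel E Q \<pi> <#>\<^bsub>E\<^esub> B"
      proof
        fix e assume e: "e \<in> carrier E"
        then have "\<pi> e \<in> \<pi> ` B" using im by auto
        then obtain b where b: "b \<in> B" "\<pi> b = \<pi> e" by auto
        then have "e \<otimes>\<^bsub>E\<^esub> inv\<^bsub>E\<^esub> b \<in> kernel E Q \<pi>" using e by (simp add: kernel_def)
        moreover have "e = e \<otimes>\<^bsub>E\<^esub> inv\<^bsub>E\<^esub> b \<otimes>\<^bsub>E\<^esub> b" using e b by (simp add: E.m_assoc)
        ultimately show "e \<in> kernel E Q \<pi> <#>\<^bsub>E\<^esub> B" using b(1) by (auto simp: set_mult_def)
      qed
    qed
  qed
  define \<sigma> where "\<sigma> e = inv_into B \<pi> (\<pi> e)" for e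
  have \<sigma>: "\<sigma> e \<in> B" "\<pi> (\<sigma> e) = \<pi> e" if "e \<in> carrier E" for e
  proof -
    have "\<pi> e \<in> \<pi> ` B" using im that by auto
    then show "\<sigma> e \<in> B" "\<pi> (\<sigma> e) = \<pi> e" by (simp_all add: \<sigma>_def inv_into_into f_inv_into_f)
  qed
  have \<sigma>B: "\<sigma> b = b" if "b \<in> B" for b using inj that by (simp add: \<sigma>_def)
  have "\<sigma> (e \<otimes>\<^bsub>E\<^esub> e') = \<sigma> e \<otimes>\<^bsub>E\<^esub> \<sigma> e'" if "e \<in> carrier E" "e' \<in> carrier E" for e e'
    using that \<sigma> by (intro inj_onD[OF inj]) auto
  then have "\<sigma> \<in> epi E (E\<lparr>carrier := B\<rparr>)"
    using \<sigma> \<sigma>B by (auto simp: epi_def hom_def image_iff) (metis B.mem_carrier)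
  moreover have "kernel E (E\<lparr>carrier := B\<rparr>) \<sigma> = kernel E Q \<pi>"
    using \<sigma> one by (auto simp: kernel_def) (metis hom_one)
  ultimately show "\<exists>\<sigma> \<in> epi E (E\<lparr>carrier := B\<rparr>). kernel E (E\<lparr>carrier := B\<rparr>) \<sigma> = kernel E Q \<pi>" by blast
qed

text \<open>What the four candidates have in common: a subgroup of \<open>N \<times> \<mu>\<^sub>4\<close> that projects onto both factors and
whose elements over \<open>1\<close> are those of \<open>A\<^sub>6 \<times> {1}\<close>.\<close>

locale mu4_model =
  fixes N :: "aut set" and C :: "(aut \<times> complex) set"
  assumes N: "subgroup N AutA6" and C: "subgroup C (times_mu4 N)" and A6x1: "A6x1 \<subseteq> C"
    and fst_C: "fst ` C = N" and snd_C: "snd ` C = carrier mu4"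
    and kernel_C: "(\<phi>, 1) \<in> C \<Longrightarrow> \<phi> \<in> InnA6"
begin

definition E :: "(aut \<times> complex) monoid" where "E = (times_mu4 N)\<lparr>carrier := C\<rparr>"

lemma E_simps [simp]: "carrier E = C" "\<one>\<^bsub>E\<^esub> = (\<one>\<^bsub>AutA6\<^esub>, 1)"
  "p \<otimes>\<^bsub>E\<^esub> q = (fst p \<otimes>\<^bsub>AutA6\<^esub> fst q, snd p * snd q)"
  by (simp_all add: E_def)

lemma group_E: "group E"
  unfolding E_def by (rule group.subgroup_imp_group[OF group_times_mu4[OF N] C])

lemma snd_epi: "snd \<in> epi E mu4"
  using snd_C by (auto simp: epi_def hom_def)

lemma kernel_snd: "kernel E mu4 snd = A6x1"
  using kernel_C A6x1 by (auto simp: kernel_def A6x1_def)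

lemma iota_1_image: "iota_1 ` carrier A6 = A6x1"
  by (auto simp: iota_1_def A6x1_def InnA6_def)

lemma iota_1_mon: "iota_1 \<in> mon A6 E"
  using inn_mon iota_1_image A6x1 by (auto simp: mon_def hom_def inj_on_def iota_1_def)

lemma extension: "group_extension A6 E mu4 iota_1 snd"
  using group_E iota_1_mon snd_epi kernel_snd iota_1_image A6.is_group mu4.is_group
  by (simp add: group_extension_def)

lemma A6_ext_E: "A6_ext E iota_1"
  using snd_epi kernel_snd iota_1_image
  by (intro A6_ext_kernelI[OF group_E iota_1_mon comm_group_mu4, of snd]) (auto simp: epi_def)

lemma conj_image: "conj_A6 E iota_1 ` carrier E = N"
proof -
  interpret X: A6_ext E iota_1 by (rule A6_ext_E)
  have "conj_A6 E iota_1 p = fst p" if p: "p \<in> carrier E" for p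
  proof (rule X.c_Aut_eqI[OF p])
    have "fst p \<in> N" using p fst_C by auto
    then show A: "fst p \<in> carrier AutA6" using subgroup.mem_carrier[OF N] by blast
    fix a assume "a \<in> carrier A6"
    then show "iota_1 (fst p a) \<otimes>\<^bsub>E\<^esub> p = p \<otimes>\<^bsub>E\<^esub> iota_1 a"
      using Aut_inn[OF A] by (simp add: iota_1_def)
  qed
  then have "conj_A6 E iota_1 ` carrier E = fst ` carrier E" by (intro image_cong) auto
  then show ?thesis using fst_C by simp
qed

text \<open>The powers \<open>(n, i)\<^sup>k\<close> with \<open>k < 4\<close> exhaust the cyclic group and have different second components.\<close>

lemma section_bij:
  assumes x: "(n, zeta4) \<in> C" and n4: "n [^]\<^bsub>AutA6\<^esub> (4::nat) = \<one>\<^bsub>AutA6\<^esub>"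
  shows "subgroup (generate E {(n, zeta4)}) E" "bij_betw snd (generate E {(n, zeta4)}) (carrier mu4)"
proof -
  interpret E: group E by (rule group_E)
  let ?x = "(n, zeta4)"
  have xE: "?x \<in> carrier E" using x by simp
  show sub: "subgroup (generate E {?x}) E" using x by (intro E.generate_is_subgroup) simp
  have pow: "?x [^]\<^bsub>E\<^esub> (k::nat) = (n [^]\<^bsub>AutA6\<^esub> k, \<i> ^ k)" for k
    by (simp add: E_def times_mu4_pow zeta4_eq)
  have "?x [^]\<^bsub>E\<^esub> (4::nat) = \<one>\<^bsub>E\<^esub>" unfolding pow using n4 by (simp add: i_pow4)
  note powers = generate_order_4[OF group_E xE this]
  have "inj_on snd (generate E {?x})"
  proof (rule inj_onI)
    fix p q assume pq: "p \<in> generate E {?x}" "q \<in> generate E {?x}" "snd p = snd q"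
    obtain j :: nat where j: "j < 4" "p = ?x [^]\<^bsub>E\<^esub> j" by (rule powers[OF pq(1)])
    obtain k :: nat where k: "k < 4" "q = ?x [^]\<^bsub>E\<^esub> k" by (rule powers[OF pq(2)])
    have "j = k" using pq(3) j k by (intro i_pow_inj) (auto simp: pow)
    then show "p = q" using j k by simp
  qed
  moreover have "snd ` generate E {?x} = carrier mu4"
  proof
    show "snd ` generate E {?x} \<subseteq> carrier mu4" using subgroup.subset[OF sub] snd_C by auto
    show "carrier mu4 \<subseteq> snd ` generate E {?x}"
    proof
      fix z assume "z \<in> carrier mu4"
      then obtain k :: nat where "z = \<i> ^ k" by (rule mu4_powers)
      then have "z = snd (?x [^]\<^bsub>E\<^esub> k)" by (simp add: pow)
      moreover have "?x [^]\<^bsub>E\<^esub> k \<in> generate E {?x}"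
      proof (induction k)
        case 0 show ?case using generate.one[of E] by simp
      next
        case (Suc k)
        have "?x \<in> generate E {?x}" by (rule generate.incl) simp
        from generate.eng[OF Suc this] show ?case by simp
      qed
      ultimately show "z \<in> snd ` generate E {?x}" by blast
    qed
  qed
  ultimately show "bij_betw snd (generate E {?x}) (carrier mu4)" by (simp add: bij_betw_def)
qed

lemma split:
  assumes x: "(n, zeta4) \<in> C" and n4: "n [^]\<^bsub>AutA6\<^esub> (4::nat) = \<one>\<^bsub>AutA6\<^esub>"
  shows "internal_semidirect E A6x1 (generate E {(n, zeta4)})" "split_by E N (n, zeta4)"
proof -
  let ?B = "generate E {(n, zeta4)}"
  note sect = split_section[OF group_E mu4.is_group snd_epi section_bij[OF assms], unfolded kernel_snd]
  show "internal_semidirect E A6x1 ?B" by (rule sect(1))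
  obtain \<sigma> where \<sigma>: "\<sigma> \<in> epi E (E\<lparr>carrier := ?B\<rparr>)" "kernel E (E\<lparr>carrier := ?B\<rparr>) \<sigma> = A6x1"
    using sect(2) by blast
  have "group (E\<lparr>carrier := ?B\<rparr>)"
    by (rule group.subgroup_imp_group[OF group_E section_bij(1)[OF assms]])
  then have "group_extension A6 E (E\<lparr>carrier := ?B\<rparr>) iota_1 \<sigma>"
    using \<sigma> group_E iota_1_mon iota_1_image A6.is_group by (simp add: group_extension_def)
  moreover have "iota_1 = (\<lambda>a. (inn a, 1))" by (auto simp: iota_1_def)
  ultimately show "split_by E N (n, zeta4)"
    unfolding split_by_def using C sect(1) by auto
qed

end

lemma mu4_model_not_iso:
  assumes "mu4_model N C" "mu4_model N' C'" "N \<lhd> AutA6" "N \<noteq> N'"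
  shows "\<not> mu4_model.E N C \<cong> mu4_model.E N' C'"
proof
  interpret M: mu4_model N C by fact
  interpret M': mu4_model N' C' by fact
  assume "M.E \<cong> M'.E"
  then obtain \<alpha> where \<alpha>: "\<alpha> \<in> carrier AutA6"
    "conj_A6 M'.E iota_1 ` carrier M'.E
      = (\<lambda>\<phi>. \<alpha> \<otimes>\<^bsub>AutA6\<^esub> \<phi> \<otimes>\<^bsub>AutA6\<^esub> inv\<^bsub>AutA6\<^esub> \<alpha>) ` conj_A6 M.E iota_1 ` carrier M.E"
    by (rule A6_ext_iso[OF M.A6_ext_E M'.A6_ext_E])
  then have "N' = N" unfolding M.conj_image M'.conj_image using conj_normal[OF assms(3) \<alpha>(1)] by simp
  with assms(4) show False by simp
qed

lemma mu4_model_direct: "mu4_model InnA6 (InnA6 \<times> carrier mu4)"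
proof (rule mu4_model.intro)
  show "subgroup InnA6 AutA6" by (rule Inn_subgroup)
  show "subgroup (InnA6 \<times> carrier mu4) (times_mu4 InnA6)"
    using group.subgroup_self[OF group_times_mu4[OF Inn_subgroup]] by simp
  show "fst ` (InnA6 \<times> carrier mu4) = InnA6" "snd ` (InnA6 \<times> carrier mu4) = carrier mu4"
    using subgroup.one_closed[OF Inn_subgroup] by (auto simp: mu4_carrier)
qed (auto simp: A6x1_def mu4_carrier)

lemma direct_E: "mu4_model.E InnA6 (InnA6 \<times> carrier mu4) = A6_4"
  unfolding mu4_model.E_def[OF mu4_model_direct] A6_4_def times_mu4_def DirProd_def by simp

definition gen_carrier :: "aut set \<Rightarrow> aut \<Rightarrow> (aut \<times> complex) set" where
  "gen_carrier N n = generate (times_mu4 N) (A6x1 \<union> {(n, zeta4)})"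

lemma gens_in_times:
  assumes "InnA6 \<subseteq> N" "n \<in> N" shows "A6x1 \<union> {(n, zeta4)} \<subseteq> carrier (times_mu4 N)"
  using assms by (auto simp: A6x1_def mu4_carrier zeta4_eq)

text \<open>Let \<open>s\<close> be the sign character of \<open>K\<close> with kernel \<open>A\<^sub>6\<close>. The character \<open>(\<phi>, z) \<mapsto> z\<^sup>2 s(\<phi>)\<close> of
\<open>K \<times> \<mu>\<^sub>4\<close> is trivial on \<open>A\<^sub>6 \<times> {1}\<close> and on \<open>(n, i)\<close>, because \<open>i\<^sup>2 = -1 = s(n)\<close>. On the elements over
\<open>1\<close> its triviality says that \<open>\<phi>\<close> is inner.\<close>

lemma mu4_model_gen:
  assumes K: "K \<in> {K_S, K_P, K_M}" and n: "n \<in> K - InnA6"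
  shows "mu4_model K (gen_carrier K n)"
proof -
  note KF = K_facts[OF K]
  interpret T: group "times_mu4 K" using KF(1) by (rule group_times_mu4)
  have gens: "A6x1 \<union> {(n, zeta4)} \<subseteq> carrier (times_mu4 K)" using KF(2) n by (intro gens_in_times) auto
  have sub: "subgroup (gen_carrier K n) (times_mu4 K)"
    unfolding gen_carrier_def using gens by (rule T.generate_is_subgroup)
  have A: "A6x1 \<subseteq> gen_carrier K n" and x: "(n, zeta4) \<in> gen_carrier K n"
    unfolding gen_carrier_def by (auto intro: generate.incl)
  note mult = subgroup.m_closed[OF sub]
  have in_C: "(\<psi>, 1) \<in> gen_carrier K n" "(n \<otimes>\<^bsub>AutA6\<^esub> \<psi>, \<i>) \<in> gen_carrier K n" if "\<psi> \<in> InnA6" for \<psi>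
  proof -
    show 1: "(\<psi>, 1) \<in> gen_carrier K n" using A that by (auto simp: A6x1_def)
    show "(n \<otimes>\<^bsub>AutA6\<^esub> \<psi>, \<i>) \<in> gen_carrier K n" using mult[OF x 1] by (simp add: zeta4_eq)
  qed
  show ?thesis
  proof (rule mu4_model.intro)
    show "subgroup K AutA6" by (rule KF(1))
    show "subgroup (gen_carrier K n) (times_mu4 K)" by (rule sub)
    show "A6x1 \<subseteq> gen_carrier K n" by (rule A)
    show "fst ` gen_carrier K n = K"
    proof
      show "fst ` gen_carrier K n \<subseteq> K" using subgroup.subset[OF sub] by auto
      show "K \<subseteq> fst ` gen_carrier K n"
        using index2_coset[OF KF(1-3) n] in_C by force
    qed
    show "snd ` gen_carrier K n = carrier mu4"
    proof
      show "snd ` gen_carrier K n \<subseteq> carrier mu4" using subgroup.subset[OF sub] by auto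
      have m: "z * w \<in> snd ` gen_carrier K n" if zw: "z \<in> snd ` gen_carrier K n" "w \<in> snd ` gen_carrier K n" for z w
      proof -
        obtain p q where "p \<in> gen_carrier K n" "z = snd p" "q \<in> gen_carrier K n" "w = snd q"
          using zw unfolding image_iff by blast
        then show ?thesis using imageI[OF mult[of p q], of snd] by simp
      qed
      have i: "\<i> \<in> snd ` gen_carrier K n" using imageI[OF x, of snd] by (simp add: zeta4_eq)
      have "1 \<in> snd ` gen_carrier K n" using imageI[OF in_C(1)[OF subgroup.one_closed[OF Inn_subgroup]], of snd] by simp
      moreover have "-1 \<in> snd ` gen_carrier K n" using m[OF i i] by simp
      moreover from m[OF i this] have "-\<i> \<in> snd ` gen_carrier K n" by simp
      ultimately show "carrier mu4 \<subseteq> snd ` gen_carrier K n" using i by (simp add: mu4_carrier)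
    qed
  next
    let ?s = "\<lambda>\<phi>. if \<phi> \<in> InnA6 then 1 else (-1 :: int)"
    have gK: "group (AutA6\<lparr>carrier := K\<rparr>)" using KF(1) by (rule Aut.subgroup_imp_group)
    have "subgroup InnA6 (AutA6\<lparr>carrier := K\<rparr>)" using Aut.subgroup_incl[OF Inn_subgroup KF(1,2)] .
    moreover have "finite (carrier (AutA6\<lparr>carrier := K\<rparr>))"
      using finite_subset[OF subgroup.subset[OF KF(1)] finite_Aut] by simp
    ultimately have "?s \<in> hom (AutA6\<lparr>carrier := K\<rparr>) sign_img"
      using KF(3) card_Inn by (intro index2_hom[OF gK]) auto
    then have s: "?s (\<phi> \<otimes>\<^bsub>AutA6\<^esub> \<psi>) = ?s \<phi> * ?s \<psi>" if "\<phi> \<in> K" "\<psi> \<in> K" for \<phi> \<psi>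
      using that by (simp add: hom_def sign_img_def)
    let ?t = "\<lambda>p. (snd p)\<^sup>2 * of_int (?s (fst p)) :: complex"
    have "?t \<in> hom (times_mu4 K) mu4"
    proof (rule homI)
      fix p assume p: "p \<in> carrier (times_mu4 K)"
      then show "?t p \<in> carrier mu4" by (cases "fst p \<in> InnA6") (auto simp: mu4_carrier)
      fix q assume q: "q \<in> carrier (times_mu4 K)"
      have "fst p \<in> K" "fst q \<in> K" using p q by auto
      then show "?t (p \<otimes>\<^bsub>times_mu4 K\<^esub> q) = ?t p \<otimes>\<^bsub>mu4\<^esub> ?t q"
        using s[of "fst p" "fst q"] by (simp add: power_mult_distrib del: of_int_mult if_split)
    qed
    then interpret t: group_hom "times_mu4 K" mu4 ?t by unfold_locales
    have "gen_carrier K n \<subseteq> kernel (times_mu4 K) mu4 ?t"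
      unfolding gen_carrier_def
    proof (rule T.generate_subgroup_incl[OF _ t.subgroup_kernel])
      show "A6x1 \<union> {(n, zeta4)} \<subseteq> kernel (times_mu4 K) mu4 ?t"
        using gens n by (auto simp: kernel_def A6x1_def zeta4_eq)
    qed
    then show "\<phi> \<in> InnA6" if "(\<phi>, 1) \<in> gen_carrier K n" for \<phi>
      using that by (auto simp: kernel_def split: if_splits)
  qed
qed

lemma gen_E:
  assumes K: "K \<in> {K_S, K_P, K_M}" and n: "n \<in> K - InnA6"
  shows "mu4_model.E K (gen_carrier K n) = gen_group K n"
  using mu4_model.E_def[OF mu4_model_gen[OF assms]] unfolding gen_group_def gen_carrier_def .

section \<open>The structure of an extension\<close>

locale A6_mu4 =
  fixes G (structure) and \<iota> :: "(nat \<Rightarrow> nat) \<Rightarrow> 'a" and \<pi> :: "'a \<Rightarrow> complex"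
  assumes ext: "group_extension A6 G mu4 \<iota> \<pi>"
begin

lemma ext_facts: "group G" "\<iota> \<in> mon A6 G" "\<pi> \<in> hom G mu4" "\<pi> ` carrier G = carrier mu4"
  "kernel G mu4 \<pi> = \<iota> ` carrier A6"
  using ext by (auto simp: group_extension_def epi_def)

sublocale A6_ext G \<iota>
  using ext_facts by (intro A6_ext_kernelI[OF ext_facts(1,2) comm_group_mu4 ext_facts(3)]) simp

sublocale \<pi>: group_hom G mu4 \<pi>
  using ext_facts(3) by unfold_locales

abbreviation N :: "aut set" where "N \<equiv> c ` carrier G"

definition F :: "'a \<Rightarrow> aut \<times> complex" where "F g = (c g, \<pi> g)"

lemma pi_iota: "a \<in> carrier A6 \<Longrightarrow> \<pi> (\<iota> a) = 1"
  using ext_facts(5) by (auto simp: kernel_def)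

lemma F_hom: "F \<in> hom G (times_mu4 N)"
  by (auto simp: hom_def F_def)

sublocale F: group_hom G "times_mu4 N" F
  by (intro group_hom.intro group_hom_axioms.intro is_group group_times_mu4[OF image_subgroup] F_hom)

lemma same_pi:
  assumes "g \<in> carrier G" "g' \<in> carrier G" "\<pi> g = \<pi> g'"
  obtains a where "a \<in> carrier A6" "g = g' \<otimes> \<iota> a"
proof -
  have "inv g' \<otimes> g \<in> kernel G mu4 \<pi>"
    using assms \<pi>.hom_closed[OF assms(2)] by (auto simp: kernel_def simp flip: mu4_simps)
  then obtain a where "a \<in> carrier A6" "inv g' \<otimes> g = \<iota> a" using ext_facts(5) by auto
  moreover have "g = g' \<otimes> (inv g' \<otimes> g)" using assms by (simp add: m_assoc[symmetric])
  ultimately show ?thesis using that by metis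
qed

lemma F_inj: "inj_on F (carrier G)"
proof (rule F.trivial_ker_imp_inj, rule equalityI)
  show "kernel G (times_mu4 N) F \<subseteq> {\<one>}"
  proof
    fix g assume "g \<in> kernel G (times_mu4 N) F"
    then have g: "g \<in> carrier G" "c g = \<one>\<^bsub>AutA6\<^esub>" "\<pi> g = \<pi> \<one>" by (auto simp: kernel_def F_def)
    from same_pi[OF g(1) one_closed g(3)] obtain a where a: "a \<in> carrier A6" "g = \<iota> a" by auto
    then have "inn a = inn id" using g(2) c_iota A6self.c.hom_one by (simp add: alt_group_one)
    then have "a = id" using inn_mon a A6.one_closed by (auto simp: mon_def alt_group_one dest: inj_onD)
    then show "g \<in> {\<one>}" using a \<iota>.hom_one by (simp add: alt_group_one)
  qed
qed (auto simp: kernel_def)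

text \<open>A subgroup of the image of \<open>G\<close> that contains \<open>A\<^sub>6\<close> and covers \<open>\<mu>\<^sub>4\<close> is the whole image: each element of
the image differs from an element of the subgroup with the same second component by an element of \<open>A\<^sub>6\<close>.\<close>

lemma iso_subgroup:
  assumes C: "subgroup C (times_mu4 N)" "A6x1 \<subseteq> C" "snd ` C = carrier mu4" "C \<subseteq> F ` carrier G"
  shows "G \<cong> (times_mu4 N)\<lparr>carrier := C\<rparr>"
proof -
  have "F g \<in> C" if g: "g \<in> carrier G" for g
  proof -
    have "\<pi> g \<in> snd ` C" using C(3) g by simp
    then obtain p where p: "p \<in> C" "snd p = \<pi> g" by auto
    then obtain g' where g': "g' \<in> carrier G" "p = F g'" using C(4) by auto
    then obtain a where a: "a \<in> carrier A6" "g = g' \<otimes> \<iota> a"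
      using same_pi[OF g g'(1)] p(2) by (auto simp: F_def)
    have "F (\<iota> a) \<in> C" using C(2) a(1) by (auto simp: F_def c_iota pi_iota A6x1_def InnA6_def)
    then have "p \<otimes>\<^bsub>times_mu4 N\<^esub> F (\<iota> a) \<in> C" using p(1) subgroup.m_closed[OF C(1)] by blast
    then show ?thesis using a g' by (simp del: times_mu4_simps)
  qed
  then have "F ` carrier G = C" using C(4) by auto
  then have "F \<in> iso G ((times_mu4 N)\<lparr>carrier := C\<rparr>)"
    using F_inj F_hom by (auto simp: iso_def bij_betw_def hom_def simp del: times_mu4_simps)
  then show ?thesis by (auto simp: is_iso_def)
qed

lemma generator:
  obtains g where "g \<in> carrier G" "\<pi> g = \<i>"
    "\<forall>h\<in>carrier G. \<exists>(k::nat) a. a \<in> carrier A6 \<and> h = g [^] k \<otimes> \<iota> a"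
proof -
  have "\<i> \<in> \<pi> ` carrier G" using ext_facts(4) by (simp add: mu4_carrier)
  then obtain g where g: "g \<in> carrier G" "\<pi> g = \<i>" by auto
  have "\<exists>(k::nat) a. a \<in> carrier A6 \<and> h = g [^] k \<otimes> \<iota> a" if h: "h \<in> carrier G" for h
  proof -
    obtain k :: nat where "\<pi> h = \<i> ^ k" using mu4_powers[OF \<pi>.hom_closed[OF h]] by metis
    then have "\<pi> h = \<pi> (g [^] k)" using g \<pi>.hom_nat_pow[OF g(1), of k] by (simp add: mu4_pow)
    from same_pi[OF h nat_pow_closed[OF g(1)] this]
    obtain a where "a \<in> carrier A6" "h = g [^] k \<otimes> \<iota> a" .
    then show ?thesis by blast
  qed
  then show ?thesis using that g by blast
qed

lemma N_generated:
  assumes "g \<in> carrier G" "\<forall>h\<in>carrier G. \<exists>(k::nat) a. a \<in> carrier A6 \<and> h = g [^] k \<otimes> \<iota> a"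
    and K: "subgroup K AutA6" "InnA6 \<subseteq> K" "c g \<in> K"
  shows "N \<subseteq> K"
proof
  fix \<phi> assume "\<phi> \<in> N"
  then obtain h where h: "h \<in> carrier G" "\<phi> = c h" by auto
  then obtain k :: nat and a where ka: "a \<in> carrier A6" "h = g [^] k \<otimes> \<iota> a" using assms(2) by blast
  have "c g [^]\<^bsub>AutA6\<^esub> k \<in> K"
    by (induction k) (use K(1,3) in \<open>simp_all add: subgroup.one_closed subgroup.m_closed\<close>)
  moreover have "inn a \<in> K" using K(2) ka(1) by (auto simp: InnA6_def)
  ultimately show "\<phi> \<in> K"
    using subgroup.m_closed[OF K(1)] h ka assms(1) by (simp add: c.hom_nat_pow c_iota)
qed

text \<open>If \<open>g\<close> generates \<open>G\<close> modulo \<open>A\<^sub>6\<close>, then \<open>N\<close> is the smallest subgroup that contains \<open>A\<^sub>6\<close> and \<open>c(g)\<close>.\<close>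

lemma N_cases: "N \<in> {InnA6, K_S, K_P, K_M}"
proof -
  obtain g where g: "g \<in> carrier G" "\<pi> g = \<i>"
    "\<forall>h\<in>carrier G. \<exists>(k::nat) a. a \<in> carrier A6 \<and> h = g [^] k \<otimes> \<iota> a"
    by (rule generator)
  show ?thesis
  proof (cases "c g \<in> InnA6")
    case True
    then have "N \<subseteq> InnA6" using N_generated[OF g(1,3) Inn_subgroup] by simp
    then show ?thesis using Inn_subset by auto
  next
    case False
    obtain K where K: "K \<in> {K_S, K_P, K_M}" "c g \<in> K" using Aut_cover c_Aut[OF g(1)] by blast
    have "N \<subseteq> K" using N_generated[OF g(1,3) K_facts(1,2)[OF K(1)] K(2)] .
    moreover have "K \<subseteq> N"
      using index2_coset[OF K_facts(1-3)[OF K(1)], of "c g"] K(2) False Inn_subset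
        subgroup.m_closed[OF image_subgroup] g(1) by blast
    ultimately show ?thesis using K(1) by auto
  qed
qed

lemma F_iota: "a \<in> carrier A6 \<Longrightarrow> F (\<iota> a) = (inn a, 1)"
  by (simp add: F_def c_iota pi_iota)

lemma F_coset:
  assumes "g \<in> carrier G" "\<psi> \<in> InnA6"
  shows "(c g \<otimes>\<^bsub>AutA6\<^esub> \<psi>, \<pi> g) \<in> F ` carrier G"
proof -
  obtain a where a: "a \<in> carrier A6" "\<psi> = inn a" using assms(2) by (auto simp: InnA6_def)
  have "F (g \<otimes> \<iota> a) = (c g \<otimes>\<^bsub>AutA6\<^esub> \<psi>, \<pi> g)"
    using a assms(1) F.hom_mult[of g "\<iota> a"] by (simp add: F_iota) (simp add: F_def)
  then show ?thesis using a assms(1) by (metis \<iota>.hom_closed imageI m_closed)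
qed

text \<open>Since \<open>c(g)\<close> is always inner, the elements of \<open>G\<close> over a given \<open>z\<close> realize every \<open>(\<phi>, z)\<close> with \<open>\<phi>\<close> inner.\<close>

lemma iso_direct: assumes N: "N = InnA6" shows "G \<cong> A6_4"
proof -
  interpret M: mu4_model InnA6 "InnA6 \<times> carrier mu4" by (rule mu4_model_direct)
  have "InnA6 \<times> carrier mu4 \<subseteq> F ` carrier G"
  proof safe
    fix \<phi> z assume \<phi>: "\<phi> \<in> InnA6" and "z \<in> carrier mu4"
    then have "z \<in> \<pi> ` carrier G" using ext_facts(4) by simp
    then obtain g where g: "g \<in> carrier G" "\<pi> g = z" by auto
    have cg: "c g \<in> InnA6" using N g by auto
    then have "inv\<^bsub>AutA6\<^esub> c g \<otimes>\<^bsub>AutA6\<^esub> \<phi> \<in> InnA6"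
      using \<phi> subgroup.m_closed[OF Inn_subgroup] subgroup.m_inv_closed[OF Inn_subgroup] by blast
    from F_coset[OF g(1) this] show "(\<phi>, z) \<in> F ` carrier G"
      using g c_Aut[OF g(1)] subgroup.mem_carrier[OF Inn_subgroup \<phi>] by (simp add: Aut.m_assoc[symmetric])
  qed
  then have "G \<cong> M.E"
    unfolding M.E_def using iso_subgroup M.C M.A6x1 M.snd_C unfolding N by blast
  then show ?thesis unfolding direct_E .
qed

text \<open>The generator \<open>g\<close> over \<open>i\<close> has \<open>c(g)\<close> in \<open>K - A\<^sub>6 = n A\<^sub>6\<close>, so a translate of \<open>g\<close> by \<open>A\<^sub>6\<close> is mapped to
\<open>(n, i)\<close>.\<close>

lemma iso_gen:
  assumes N: "N = K" and K: "K \<in> {K_S, K_P, K_M}" and n: "n \<in> K - InnA6"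
  shows "G \<cong> gen_group K n"
proof -
  interpret M: mu4_model K "gen_carrier K n" using K n by (rule mu4_model_gen)
  note KF = K_facts[OF K]
  obtain g where g: "g \<in> carrier G" "\<pi> g = \<i>"
    "\<forall>h\<in>carrier G. \<exists>(k::nat) a. a \<in> carrier A6 \<and> h = g [^] k \<otimes> \<iota> a"
    by (rule generator)
  have "c g \<notin> InnA6"
  proof
    assume "c g \<in> InnA6"
    then have "N \<subseteq> InnA6" using N_generated[OF g(1,3) Inn_subgroup] by simp
    then show False using n N by auto
  qed
  then have "K = InnA6 \<union> (\<lambda>\<psi>. c g \<otimes>\<^bsub>AutA6\<^esub> \<psi>) ` InnA6"
    using index2_coset[OF KF(1-3), of "c g"] N g(1) by blast
  then obtain \<psi> where "\<psi> \<in> InnA6" "n = c g \<otimes>\<^bsub>AutA6\<^esub> \<psi>" using n by auto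
  then have "(n, zeta4) \<in> F ` carrier G" using F_coset[OF g(1)] g(2) by (simp add: zeta4_eq)
  moreover have "A6x1 \<subseteq> F ` carrier G"
  proof
    fix p assume "p \<in> A6x1"
    then obtain a where a: "a \<in> carrier A6" "p = (inn a, 1)" by (auto simp: A6x1_def InnA6_def)
    then have "p = F (\<iota> a)" by (simp add: F_iota)
    then show "p \<in> F ` carrier G" using \<iota>.hom_closed[OF a(1)] by blast
  qed
  moreover have "subgroup (F ` carrier G) (times_mu4 K)" using F.img_is_subgroup unfolding N .
  ultimately have "gen_carrier K n \<subseteq> F ` carrier G"
    unfolding gen_carrier_def
    by (intro group.generate_subgroup_incl[OF group_times_mu4[OF KF(1)]] Un_least) simp_all
  then have "G \<cong> M.E"
    unfolding M.E_def using iso_subgroup M.C M.A6x1 M.snd_C unfolding N by blast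
  then show ?thesis unfolding gen_E[OF K n] .
qed

end

lemma A6_4_order: "group.ord A6_4 (\<one>\<^bsub>AutA6\<^esub>, zeta4) = 4"
proof -
  interpret M: mu4_model InnA6 "InnA6 \<times> carrier mu4" by (rule mu4_model_direct)
  have "(\<one>\<^bsub>AutA6\<^esub>, zeta4) \<in> InnA6 \<times> carrier mu4"
    using subgroup.one_closed[OF Inn_subgroup] by (simp add: mu4_carrier zeta4_eq)
  then have x: "(\<one>\<^bsub>AutA6\<^esub>, zeta4) \<in> carrier M.E" by (simp only: M.E_simps)
  have pow: "(\<one>\<^bsub>AutA6\<^esub>, zeta4) [^]\<^bsub>M.E\<^esub> (k::nat) = (\<one>\<^bsub>AutA6\<^esub>, \<i> ^ k)" for k
    by (simp add: M.E_def times_mu4_pow zeta4_eq)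
  have "group.ord M.E (\<one>\<^bsub>AutA6\<^esub>, zeta4) = 4"
  proof (rule ord_eqI[OF M.group_E x])
    fix d :: nat assume "d dvd 4" "d < 4"
    then have "d dvd 2" by (rule dvd_4)
    then show "(\<one>\<^bsub>AutA6\<^esub>, zeta4) [^]\<^bsub>M.E\<^esub> d \<noteq> \<one>\<^bsub>M.E\<^esub>"
      using pow_dvd_one[OF M.group_E x, of d 2] pow[of 2] by auto
  qed (simp_all add: pow i_pow4)
  then show ?thesis unfolding direct_E .
qed

lemma A6_4_direct: "internal_direct A6_4 A6x1 (generate A6_4 {(\<one>\<^bsub>AutA6\<^esub>, zeta4)})"
proof -
  interpret M: mu4_model InnA6 "InnA6 \<times> carrier mu4" by (rule mu4_model_direct)
  let ?x = "(\<one>\<^bsub>AutA6\<^esub>, zeta4)"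
  interpret E: group M.E by (rule M.group_E)
  have xC: "?x \<in> InnA6 \<times> carrier mu4"
    using subgroup.one_closed[OF Inn_subgroup] by (simp add: mu4_carrier zeta4_eq)
  then have x: "?x \<in> carrier M.E" by (simp only: M.E_simps)
  have "generate M.E {?x} \<lhd> M.E"
  proof (rule E.normal_generateI)
    show "{?x} \<subseteq> carrier M.E" using x by simp
    fix h g assume h: "h \<in> {?x}" and g: "g \<in> carrier M.E"
    have "fst g \<in> carrier AutA6" using g subgroup.mem_carrier[OF Inn_subgroup] by auto
    then have "g \<otimes>\<^bsub>M.E\<^esub> ?x = ?x \<otimes>\<^bsub>M.E\<^esub> g" by (simp add: mult.commute)
    then have "g \<otimes>\<^bsub>M.E\<^esub> ?x \<otimes>\<^bsub>M.E\<^esub> inv\<^bsub>M.E\<^esub> g = ?x"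
      using g x by (metis E.inv_solve_right' E.m_closed)
    then show "g \<otimes>\<^bsub>M.E\<^esub> h \<otimes>\<^bsub>M.E\<^esub> inv\<^bsub>M.E\<^esub> g \<in> {?x}" using h by simp
  qed
  moreover have "internal_semidirect M.E A6x1 (generate M.E {?x})"
    by (rule M.split(1)[OF xC]) simp
  ultimately show ?thesis unfolding internal_direct_def direct_E by blast
qed

section \<open>The classification\<close>

theorem theorem2p3:
  shows
  "(\<exists>h \<in> PGL29_sub. group.ord AutA6 h = 10) \<and>
   (\<exists>g \<in> M10_sub - InnA6. group.ord AutA6 g = 4) \<and>
   (\<forall>h \<in> PGL29_sub. \<forall>g \<in> M10_sub - InnA6.
      group.ord AutA6 h = 10 \<longrightarrow> group.ord AutA6 g = 4 \<longrightarrow>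
      (\<forall>(G :: ('g, 'm) monoid_scheme) \<iota> \<pi>. group_extension A6 G mu4 \<iota> \<pi> \<longrightarrow>
         (let N = conj_A6 G \<iota> ` carrier G in
            N \<in> {InnA6, S6_sub, PGL29_sub, M10_sub} \<and>
            (N = InnA6 \<longrightarrow> G \<cong> A6_4) \<and>
            (N = S6_sub \<longrightarrow> G \<cong> S6_2) \<and>
            (N = PGL29_sub \<longrightarrow> G \<cong> PGL29_2 h) \<and>
            (N = M10_sub \<longrightarrow> G \<cong> M10_2 g))) \<and>
      (\<forall>(N, E) \<in> {(InnA6, A6_4), (S6_sub, S6_2), (PGL29_sub, PGL29_2 h), (M10_sub, M10_2 g)}.
         \<exists>\<iota> \<pi>. group_extension A6 E mu4 \<iota> \<pi> \<and> conj_A6 E \<iota> ` carrier E = N) \<and>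
      sorted_wrt (\<lambda>E E'. \<not> E \<cong> E') [A6_4, S6_2, PGL29_2 h, M10_2 g] \<and>
      group.ord A6_4 (\<one>\<^bsub>AutA6\<^esub>, zeta4) = 4 \<and>
      internal_direct A6_4 A6x1 (generate A6_4 {(\<one>\<^bsub>AutA6\<^esub>, zeta4)}) \<and>
      split_by S6_2 S6_sub (swap12, zeta4) \<and>
      split_by (PGL29_2 h) PGL29_sub (h [^]\<^bsub>AutA6\<^esub> (5::nat), zeta4) \<and>
      split_by (M10_2 g) M10_sub (g, zeta4))"
proof -
  have order4: "g [^]\<^bsub>AutA6\<^esub> (4::nat) = \<one>\<^bsub>AutA6\<^esub>"
    if "g \<in> carrier AutA6" "g \<otimes>\<^bsub>AutA6\<^esub> g = \<one>\<^bsub>AutA6\<^esub>" for g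
  proof -
    have four: "(4::nat) = Suc (Suc (Suc (Suc 0)))" by simp
    show ?thesis unfolding four using that by (simp add: Aut.m_assoc)
  qed
  note K = K_members
  have KA: "\<phi> \<in> carrier AutA6" if "K \<in> {K_S, K_P, K_M}" "\<phi> \<in> K" for K \<phi>
    using subgroup.mem_carrier[OF K_facts(1)[OF that(1)] that(2)] .
  have Inn_noteq: "InnA6 \<noteq> K" if "K \<in> {K_S, K_P, K_M}" for K
    using K_facts(3)[OF that] card_Inn by auto
  have E_eqs: "S6_2 = gen_group K_S swap12" "PGL29_2 h = gen_group K_P (h [^]\<^bsub>AutA6\<^esub> (5::nat))"
    "M10_2 g = gen_group K_M g" for h g
    by (simp_all add: S6_2_def PGL29_2_def M10_2_def S6_sub_eq PGL29_sub_eq M10_sub_eq)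
  have main: "(\<forall>(G :: ('g, 'm) monoid_scheme) \<iota> \<pi>. group_extension A6 G mu4 \<iota> \<pi> \<longrightarrow>
         (let N = conj_A6 G \<iota> ` carrier G in
            N \<in> {InnA6, K_S, K_P, K_M} \<and>
            (N = InnA6 \<longrightarrow> G \<cong> A6_4) \<and>
            (N = K_S \<longrightarrow> G \<cong> S6_2) \<and>
            (N = K_P \<longrightarrow> G \<cong> PGL29_2 h) \<and>
            (N = K_M \<longrightarrow> G \<cong> M10_2 g))) \<and>
      (\<forall>(N, E) \<in> {(InnA6, A6_4), (K_S, S6_2), (K_P, PGL29_2 h), (K_M, M10_2 g)}.
         \<exists>\<iota> \<pi>. group_extension A6 E mu4 \<iota> \<pi> \<and> conj_A6 E \<iota> ` carrier E = N) \<and>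
      sorted_wrt (\<lambda>E E'. \<not> E \<cong> E') [A6_4, S6_2, PGL29_2 h, M10_2 g] \<and>
      split_by S6_2 K_S (swap12, zeta4) \<and>
      split_by (PGL29_2 h) K_P (h [^]\<^bsub>AutA6\<^esub> (5::nat), zeta4) \<and>
      split_by (M10_2 g) K_M (g, zeta4)"
    if h: "h \<in> K_P" "group.ord AutA6 h = 10" and g: "g \<in> K_M - InnA6" "group.ord AutA6 g = 4" for h g
  proof -
    note h5 = order_10_power[OF h]
    let ?h5 = "h [^]\<^bsub>AutA6\<^esub> (5::nat)"
    note s12 = swap12
    note models = mu4_model_direct mu4_model_gen[OF K(1) s12(1)] mu4_model_gen[OF K(2) h5(1)] mu4_model_gen[OF K(3) g(1)]
    note Es = direct_E gen_E[OF K(1) s12(1), folded E_eqs] gen_E[OF K(2) h5(1), folded E_eqs] gen_E[OF K(3) g(1), folded E_eqs]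
    have x: "(n, zeta4) \<in> gen_carrier N n" for n N
      unfolding gen_carrier_def by (auto intro: generate.incl)
    have struct: "N \<in> {InnA6, K_S, K_P, K_M} \<and> (N = InnA6 \<longrightarrow> G \<cong> A6_4) \<and> (N = K_S \<longrightarrow> G \<cong> S6_2) \<and>
        (N = K_P \<longrightarrow> G \<cong> PGL29_2 h) \<and> (N = K_M \<longrightarrow> G \<cong> M10_2 g)"
      if ext: "group_extension A6 G mu4 \<iota> \<pi>" and N: "N = conj_A6 G \<iota> ` carrier G"
      for G :: "('g, 'm) monoid_scheme" and \<iota> \<pi> N
    proof -
      interpret X: A6_mu4 G \<iota> \<pi> using ext by unfold_locales
      show ?thesis
        unfolding N E_eqs
        using X.N_cases X.iso_direct X.iso_gen[OF _ K(1) s12(1)] X.iso_gen[OF _ K(2) h5(1)] X.iso_gen[OF _ K(3) g(1)]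
        by blast
    qed
    have occurs: "\<exists>\<iota> \<pi>. group_extension A6 E mu4 \<iota> \<pi> \<and> conj_A6 E \<iota> ` carrier E = N"
      if "(N, E) \<in> {(InnA6, A6_4), (K_S, S6_2), (K_P, PGL29_2 h), (K_M, M10_2 g)}" for N E
    proof -
      have *: "\<exists>\<iota> \<pi>. group_extension A6 (mu4_model.E N C) mu4 \<iota> \<pi> \<and>
          conj_A6 (mu4_model.E N C) \<iota> ` carrier (mu4_model.E N C) = N" if "mu4_model N C" for N C
        using mu4_model.extension[OF that] mu4_model.conj_image[OF that] by blast
      show ?thesis
        using that *[OF models(1)] *[OF models(2)] *[OF models(3)] *[OF models(4)] unfolding Es by blast
    qed
    have distinct: "sorted_wrt (\<lambda>E E'. \<not> E \<cong> E') [A6_4, S6_2, PGL29_2 h, M10_2 g]"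
      using mu4_model_not_iso[OF models(1) models(2) Inn_normal Inn_noteq[OF K(1)]]
        mu4_model_not_iso[OF models(1) models(3) Inn_normal Inn_noteq[OF K(2)]]
        mu4_model_not_iso[OF models(1) models(4) Inn_normal Inn_noteq[OF K(3)]]
        mu4_model_not_iso[OF models(2) models(3) K_facts(4)[OF K(1)] K_S_noteq(1)]
        mu4_model_not_iso[OF models(2) models(4) K_facts(4)[OF K(1)] K_S_noteq(2)]
        mu4_model_not_iso[OF models(3) models(4) K_facts(4)[OF K(2)] K_P_noteq_K_M]
      unfolding Es by simp
    have split_S: "split_by S6_2 K_S (swap12, zeta4)"
      using mu4_model.split(2)[OF models(2) x order4] s12 KA[OF K(1)] unfolding Es by blast
    have split_P: "split_by (PGL29_2 h) K_P (?h5, zeta4)"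
      using mu4_model.split(2)[OF models(3) x order4] h5 KA[OF K(2)] unfolding Es by blast
    have split_M: "split_by (M10_2 g) K_M (g, zeta4)"
    proof -
      have "g \<in> carrier AutA6" using g(1) KA[OF K(3)] by blast
      then have "g [^]\<^bsub>AutA6\<^esub> (4::nat) = \<one>\<^bsub>AutA6\<^esub>" using Aut.pow_ord_eq_1[of g] g(2) by simp
      from mu4_model.split(2)[OF models(4) x this] show ?thesis unfolding Es .
    qed
    show ?thesis
    proof (intro conjI distinct split_S split_P split_M)
      show "\<forall>(G :: ('g, 'm) monoid_scheme) \<iota> \<pi>. group_extension A6 G mu4 \<iota> \<pi> \<longrightarrow>
         (let N = conj_A6 G \<iota> ` carrier G in
            N \<in> {InnA6, K_S, K_P, K_M} \<and>
            (N = InnA6 \<longrightarrow> G \<cong> A6_4) \<and>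
            (N = K_S \<longrightarrow> G \<cong> S6_2) \<and>
            (N = K_P \<longrightarrow> G \<cong> PGL29_2 h) \<and>
            (N = K_M \<longrightarrow> G \<cong> M10_2 g))"
        unfolding Let_def by (intro allI impI, rule struct[OF _ refl])
      show "\<forall>(N, E) \<in> {(InnA6, A6_4), (K_S, S6_2), (K_P, PGL29_2 h), (K_M, M10_2 g)}.
         \<exists>\<iota> \<pi>. group_extension A6 E mu4 \<iota> \<pi> \<and> conj_A6 E \<iota> ` carrier E = N"
        by (intro ballI case_prodI2, rule occurs, simp only:)
    qed
  qed
  have ex: "\<exists>h \<in> K_P. group.ord AutA6 h = 10" "\<exists>g \<in> K_M - InnA6. group.ord AutA6 g = 4"
    using exists_order_10 exists_order_4 by metis+
  show ?thesis
    unfolding S6_sub_eq PGL29_sub_eq M10_sub_eq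
    by (rule conjI[OF ex(1) conjI[OF ex(2)]], intro ballI impI, drule (3) main, elim conjE,
        intro conjI A6_4_order A6_4_direct; assumption)
qed

end
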